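(* Let $q_+,q_-$ be parameters such that either $q_+=\frac{\epsilon}{M+N}$, $q_-=\frac{M-N}{M+N}$ with $M,N\in\{0,1,2,\dots\}$, $M+N\neq0$, $\epsilon\in\{1,-1\}$, or $q_+=0$, $-1\le q_-\le1$. Suppose $x_1,\dots,x_{2n}\in H_{\mathbb R}$ and put $x_{\overline i}:=x_i$ for $1\le i\le 2n$. Then $$\varphi\big(G(x_{2n})\cdots G(x_1)\big)=\sum_{\pi\in\mathcal P_2^{sym}(2n)}q_-^{c_-(\pi)}q_+^{l_c(\pi)}\prod_{\{i,j\}\in\mathrm{Pair}(\pi)}\langle x_i,x_j\rangle=\sum_{\pi\in\mathcal P_2^{sym}(2n)}q_-^{c_-(\pi)}q_+^{\,n-c(\pi)}\prod_{\{i,j\}\in\mathrm{Pair}(\pi)}\langle x_i,x_j\rangle,$$ where $\mathrm{Pair}(\pi)$ is the set of all pairs of $\pi$ and $c(\pi)$ is the number of cycles (positive and negative) of $\pi$.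
   Context: **Fock space.** $[\pm n]=\{\overline n,\dots,\overline1,1,\dots,n\}$ with $\overline i=-i$, ordered by $\overline n<\dots<\overline1<1<\dots<n$. $B(n)$ is the group of permutations $\sigma$ of $[\pm n]$ with $\sigma(\overline i)=\overline{\sigma(i)}$. Decompose $\sigma$ into disjoint cycles: pairs of disjoint cycles $c=(a_1\dots a_k)$, $\overline c=(\overline{a_1}\dots\overline{a_k})$ form one positive cycle of length $k$, and a cycle $c=\overline c$ of $2m$ elements is one negative cycle of length $m$. $\rho^+,\rho^-$ are the partitions of lengths of positive and negative cycles, $\|\rho\|=|\rho|-\ell(\rho)$ (size minus number of parts), and $\phi_{q_+,q_-}(\sigma)=q_+^{\|\rho^+\|+\|\rho^-\|}q_-^{\ell(\rho^-)}$ (with $0^0=1$ everywhere). $H$ is the complexification of a separable real Hilbert space $H_{\mathbb R}$ (inner product linear in the second argument), $\mathcal K=H\otimes H$, $\mathcal K_n=H^{\otimes2n}$ with simple tensors $x_{\overline n}\otimes\cdots\otimes x_{\overline1}\otimes x_1\otimes\cdots\otimes x_n$, on which $B(n)$ acts by $\sigma(x_{\overline n}\otimes\cdots\otimes x_n)=x_{\sigma(\overline n)}\otimes\cdots\otimes x_{\sigma(n)}$. $\mathcal F(\mathcal K)=\bigoplus_{n\ge0}\mathcal K_n$ (algebraic), $\mathcal K_0=\mathbb C\,\Omega\otimes\Omega$ with $\Omega\otimes\Omega$ a unit vector; $\langle\cdot,\cdot\rangle_{0,0}$ is the usual inner product. $P^{(n)}_{q_+,q_-}=\sum_{\sigma\in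 B(n)}\phi_{q_+,q_-}(\sigma)\sigma$, $P^{(0)}_{q_+,q_-}=\mathrm{id}$, and $\langle f,g\rangle_{q_+,q_-}=\delta_{n,m}\langle f,P^{(m)}_{q_+,q_-}g\rangle_{0,0}$ for $f\in\mathcal K_n,g\in\mathcal K_m$ (a semi-inner product). $\mathsf b^*_{q_+,q_-}(x\otimes y)$ maps $x_{\overline n}\otimes\cdots\otimes x_n$ to $x\otimes x_{\overline n}\otimes\cdots\otimes x_n\otimes y$ and $\Omega\otimes\Omega$ to $x\otimes y$; $\mathsf b_{q_+,q_-}(x\otimes y)$ is its adjoint with respect to $\langle\cdot,\cdot\rangle_{q_+,q_-}$ (on the quotient by null vectors if degenerate). The cyclic Gaussian operator is $G(x)=\mathsf b_{q_+,q_-}(x\otimes x)+\mathsf b^*_{q_+,q_-}(x\otimes x)$ for $x\in H_{\mathbb R}$, and the vacuum state is $\varphi(T)=\langle\Omega\otimes\Omega,T\,\Omega\otimes\Omega\rangle_{q_+,q_-}$. **Pair partitions and cycles.** $\mathcal P_{1,2}^{sym}(n)$ is the set of set partitions $\pi$ of $[\pm n]$ whose blocks are pairs or singletons, with $\overline\pi=\pi$ and $\overline B\ne B$ for every pair $B\in\pi$; $\mathcal P_2^{sym}(n)$ is the subset of those with no singletons. A pair is written $(a,b)$ with $a<b$; $a$ is its left leg, $b$ its right leg; it is positive if $b>\overline a$, otherwise negative. For $\pi\in\mathcal P_{1,2}^{sym}(n)$, $\hat\pi$ denotes the unique non-crossing partition in $\mathcal P_{1,2}^{sym}(n)$ such that: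 the sets of right legs of positive pairs of $\pi$ and $\hat\pi$ coincide; the sets of left legs of negative pairs of $\pi$ and $\hat\pi$ coincide; and no pair $(a,b)$ of $\hat\pi$ covers a singleton $\{s\}$ of $\hat\pi$ (i.e. $a<s<b$ does not occur). Two pairs $A,B$ of $\pi$ are connected if some pair of $\hat\pi$ meets both. Consider the graph on $[\pm n]$ whose edges are the pairs of $\pi$ together with the pairs of $\hat\pi$. A closed alternating component (including the case of a pair lying in both $\pi$ and $\hat\pi$) with support $S$ is a cycle of pairs $(l_1,r_1)\sim\cdots\sim(l_m,r_m)\sim(l_1,r_1)$ of $\pi$. Either $\overline S\cap S=\emptyset$, and then this component together with its image under the bar operation is counted as one positive cycle of $\pi$, of length $m$ ($m$ = number of pairs of $\pi$ in the component); or $\overline S=S$, and then $m=2m'$ is even and the component is one negative cycle of $\pi$, of length $m'$. Let $\mathrm{Cyc}(\pi)$ be the set of (positive and negative) cycles, $|\sigma|$ the length of a cycle, $l_c(\pi)=\sum_{\sigma\in\mathrm{Cyc}(\pi)}(|\sigma|-1)$, and $c_-(\pi)$ the number of negative cycles. *)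

theory Defs
  imports
    "HOL-Analysis.Analysis"
    "HOL-Combinatorics.Combinatorics"
    "HOL-Library.Multiset"
    "HOL-Library.Disjoint_Sets"
begin

section \<open>The hyperoctahedral group\<close>

text \<open>The element written $\overline i$ is the integer \<open>- i\<close>; the order of $[\pm n]$ is the order of \<open>int\<close>.\<close>

definition pm :: "nat \<Rightarrow> int set" where
  "pm n = {- int n..int n} - {0}"

definition bar :: "int set \<Rightarrow> int set" where
  "bar S = uminus ` S"

definition B_group :: "nat \<Rightarrow> (int \<Rightarrow> int) set" where
  "B_group n = {\<sigma>. \<sigma> permutes pm n \<and> (\<forall>i\<in>pm n. \<sigma> (- i) = - \<sigma> i)}"

text \<open>
  A positive or negative cycle is represented by its support in $[\pm n]$: for a positive cycle
  this is the union of the supports of the two disjoint cycles $c$ and $\overline c$. With this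
  encoding a positive cycle of length \<open>k\<close> and a negative cycle of length \<open>k\<close> both have
  a support with \<open>2 * k\<close> elements.
\<close>

definition perm_pos_cycles :: "nat \<Rightarrow> (int \<Rightarrow> int) \<Rightarrow> int set set" where
  "perm_pos_cycles n \<sigma> = {orbit \<sigma> a \<union> bar (orbit \<sigma> a) | a. a \<in> pm n \<and> bar (orbit \<sigma> a) \<inter> orbit \<sigma> a = {}}"

definition perm_neg_cycles :: "nat \<Rightarrow> (int \<Rightarrow> int) \<Rightarrow> int set set" where
  "perm_neg_cycles n \<sigma> = {orbit \<sigma> a | a. a \<in> pm n \<and> bar (orbit \<sigma> a) = orbit \<sigma> a}"

definition rho_pos :: "nat \<Rightarrow> (int \<Rightarrow> int) \<Rightarrow> nat multiset" where
  "rho_pos n \<sigma> = image_mset (\<lambda>C. card C div 2) (mset_set (perm_pos_cycles n \<sigma>))"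

definition rho_neg :: "nat \<Rightarrow> (int \<Rightarrow> int) \<Rightarrow> nat multiset" where
  "rho_neg n \<sigma> = image_mset (\<lambda>C. card C div 2) (mset_set (perm_neg_cycles n \<sigma>))"

definition partition_norm :: "nat multiset \<Rightarrow> nat" where
  "partition_norm \<rho> = sum_mset \<rho> - size \<rho>"

definition phi :: "real \<Rightarrow> real \<Rightarrow> nat \<Rightarrow> (int \<Rightarrow> int) \<Rightarrow> real" where
  "phi qp qm n \<sigma> =
     qp ^ (partition_norm (rho_pos n \<sigma>) + partition_norm (rho_neg n \<sigma>)) * qm ^ size (rho_neg n \<sigma>)"


section \<open>Complexification and tensor powers\<close>

text \<open>The pair \<open>(a, b)\<close> stands for $a + \mathrm{i} b$ in the complexification of the real Hilbert space.\<close>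

type_synonym 'a cplxn = "'a \<times> 'a"

definition of_H\<^sub>R :: "'a::real_inner \<Rightarrow> 'a cplxn" where
  "of_H\<^sub>R x = (x, 0)"

definition cscale :: "complex \<Rightarrow> 'a::real_inner cplxn \<Rightarrow> 'a cplxn" where
  "cscale c u = (Re c *\<^sub>R fst u - Im c *\<^sub>R snd u, Re c *\<^sub>R snd u + Im c *\<^sub>R fst u)"

definition cinner :: "'a::real_inner cplxn \<Rightarrow> 'a cplxn \<Rightarrow> complex" where
  "cinner u v = Complex (fst u \<bullet> fst v + snd u \<bullet> snd v) (fst u \<bullet> snd v - snd u \<bullet> fst v)"

lemma cinner_commute: "cinner u v = cnj (cinner v u)"
  by (simp add: cinner_def complex_eq_iff inner_commute)

lemma cinner_add_right: "cinner u (v + w) = cinner u v + cinner u w"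
  by (simp add: cinner_def complex_eq_iff inner_add_right)

lemma cinner_scale_right: "cinner u (cscale c v) = c * cinner u v"
  by (simp add: cinner_def cscale_def complex_eq_iff inner_add_right inner_diff_right algebra_simps)

text \<open>
  As in the usual construction of the tensor product of Hilbert spaces, the simple tensor
  $x_{\overline n}\otimes\cdots\otimes x_{\overline 1}\otimes x_1\otimes\cdots\otimes x_n$ is the
  conjugate-multilinear form $z\mapsto\prod_i\langle z_i,x_i\rangle$, and
  $\mathcal K_n=H^{\otimes 2n}$ is the space of finite linear combinations of simple tensors.
  For \<open>n = 0\<close> the forms are constant and the constant \<open>1\<close> is $\Omega\otimes\Omega$.
\<close>

type_synonym 'a tensor = "(int \<Rightarrow> 'a cplxn) \<Rightarrow> complex"

definition simple_tensor :: "nat \<Rightarrow> (int \<Rightarrow> 'a::real_inner cplxn) \<Rightarrow> 'a tensor" where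
  "simple_tensor n x = (\<lambda>z. \<Prod>i\<in>pm n. cinner (z i) (x i))"

definition tensor_comb :: "nat \<Rightarrow> (complex \<times> (int \<Rightarrow> 'a::real_inner cplxn)) list \<Rightarrow> 'a tensor" where
  "tensor_comb n L = (\<lambda>z. \<Sum>(a, x)\<leftarrow>L. a * simple_tensor n x z)"

definition tensor_power :: "nat \<Rightarrow> 'a::real_inner tensor set" where
  "tensor_power n = range (tensor_comb n)"

text \<open>
  The usual inner product, determined by
  $\langle\bigotimes_i x_i,\bigotimes_i y_i\rangle=\prod_i\langle x_i,y_i\rangle$; independence of
  the chosen representations is lemma \<open>tensor_inner_comb\<close> below.
\<close>

definition comb_inner :: "nat \<Rightarrow> (complex \<times> (int \<Rightarrow> 'a::real_inner cplxn)) list \<Rightarrow>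
    (complex \<times> (int \<Rightarrow> 'a cplxn)) list \<Rightarrow> complex" where
  "comb_inner n L M = (\<Sum>(a, x)\<leftarrow>L. \<Sum>(b, y)\<leftarrow>M. cnj a * b * (\<Prod>i\<in>pm n. cinner (x i) (y i)))"

definition tensor_inner :: "nat \<Rightarrow> 'a::real_inner tensor \<Rightarrow> 'a tensor \<Rightarrow> complex" where
  "tensor_inner n f g =
     (THE c. \<exists>L M. f = tensor_comb n L \<and> g = tensor_comb n M \<and> c = comb_inner n L M)"

lemma comb_inner_eval: "comb_inner n L M = (\<Sum>(a, x)\<leftarrow>L. cnj a * tensor_comb n M x)"
proof -
  have "(\<Sum>(b, y)\<leftarrow>M. cnj a * b * (\<Prod>i\<in>pm n. cinner (x i) (y i))) = cnj a * tensor_comb n M x" for a x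
    by (induction M) (auto simp: tensor_comb_def simple_tensor_def algebra_simps)
  then show ?thesis
    by (simp add: comb_inner_def)
qed

lemma comb_inner_commute: "comb_inner n L M = cnj (comb_inner n M L)"
proof (induction L)
  case Nil
  then show ?case by (induction M) (auto simp: comb_inner_def)
next
  case (Cons p L)
  obtain a x where p: "p = (a, x)" by (cases p)
  have "(\<Sum>(b, y)\<leftarrow>M. cnj a * b * (\<Prod>i\<in>pm n. cinner (x i) (y i))) =
      cnj (\<Sum>(b, y)\<leftarrow>M. cnj b * a * (\<Prod>i\<in>pm n. cinner (y i) (x i)))"
  proof (induction M)
    case (Cons r M)
    obtain b y where r: "r = (b, y)" by (cases r)
    have "(\<Prod>i\<in>pm n. cinner (x i) (y i)) = cnj (\<Prod>i\<in>pm n. cinner (y i) (x i))"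
      unfolding cnj_prod by (rule prod.cong[OF refl]) (rule cinner_commute)
    with Cons r show ?case by simp
  qed simp
  moreover have "comb_inner n M ((a, x) # L) =
      (\<Sum>(b, y)\<leftarrow>M. cnj b * a * (\<Prod>i\<in>pm n. cinner (y i) (x i))) + comb_inner n M L"
    by (induction M) (auto simp: comb_inner_def)
  moreover have "comb_inner n ((a, x) # L) M =
      (\<Sum>(b, y)\<leftarrow>M. cnj a * b * (\<Prod>i\<in>pm n. cinner (x i) (y i))) + comb_inner n L M"
    by (simp add: comb_inner_def)
  ultimately show ?case using Cons p by simp
qed

lemma tensor_inner_comb:
  "tensor_inner n (tensor_comb n L) (tensor_comb n M) = comb_inner n L M"
  unfolding tensor_inner_def
proof (rule the_equality)
  fix c
  assume "\<exists>L' M'. tensor_comb n L = tensor_comb n L' \<and> tensor_comb n M = tensor_comb n M' \<and>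
      c = comb_inner n L' M'"
  then obtain L' M' where eq: "tensor_comb n L = tensor_comb n L'" "tensor_comb n M = tensor_comb n M'"
    and c: "c = comb_inner n L' M'" by blast
  have "comb_inner n L M = comb_inner n L M'"
    by (simp add: comb_inner_eval eq)
  also have "\<dots> = cnj (comb_inner n M' L)"
    by (rule comb_inner_commute)
  also have "\<dots> = cnj (comb_inner n M' L')"
    by (simp add: comb_inner_eval eq)
  also have "\<dots> = comb_inner n L' M'"
    by (rule comb_inner_commute[symmetric])
  finally show "c = comb_inner n L M" using c by simp
qed blast

text \<open>
  The action of $B(n)$, defined on forms so that it is linear; lemma \<open>tensor_act_simple\<close> gives it on
  simple tensors.
\<close>

definition tensor_act :: "(int \<Rightarrow> int) \<Rightarrow> 'a tensor \<Rightarrow> 'a tensor" where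
  "tensor_act \<sigma> f = (\<lambda>z. f (z \<circ> inv \<sigma>))"

lemma tensor_act_simple:
  assumes "\<sigma> \<in> B_group n"
  shows "tensor_act \<sigma> (simple_tensor n x) = simple_tensor n (\<lambda>i. x (\<sigma> i))"
proof
  fix z
  have p: "\<sigma> permutes pm n" using assms by (simp add: B_group_def)
  have "(\<Prod>i\<in>pm n. cinner (z (inv \<sigma> i)) (x i)) = (\<Prod>i\<in>pm n. cinner (z (inv \<sigma> (\<sigma> i))) (x (\<sigma> i)))"
    using prod.permute[OF p, of "\<lambda>i. cinner (z (inv \<sigma> i)) (x i)"] by (simp add: comp_def)
  then show "tensor_act \<sigma> (simple_tensor n x) z = simple_tensor n (\<lambda>i. x (\<sigma> i)) z"
    using permutes_inverses(2)[OF p] by (simp add: tensor_act_def simple_tensor_def)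
qed

definition P_op :: "real \<Rightarrow> real \<Rightarrow> nat \<Rightarrow> 'a tensor \<Rightarrow> 'a tensor" where
  "P_op qp qm n f = (\<lambda>z. \<Sum>\<sigma>\<in>B_group n. complex_of_real (phi qp qm n \<sigma>) * tensor_act \<sigma> f z)"


section \<open>The Fock space\<close>

type_synonym 'a fvec = "nat \<Rightarrow> 'a tensor"

definition fock :: "'a::real_inner fvec set" where
  "fock = {F. (\<forall>n. F n \<in> tensor_power n) \<and> finite {n. F n \<noteq> (\<lambda>z. 0)}}"

definition vacuum :: "'a fvec" where
  "vacuum = (\<lambda>n z. if n = 0 then 1 else 0)"

definition fock_add :: "'a fvec \<Rightarrow> 'a fvec \<Rightarrow> 'a fvec" where
  "fock_add F G = (\<lambda>n z. F n z + G n z)"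

definition fock_diff :: "'a fvec \<Rightarrow> 'a fvec \<Rightarrow> 'a fvec" where
  "fock_diff F G = (\<lambda>n z. F n z - G n z)"

definition fock_inner :: "real \<Rightarrow> real \<Rightarrow> 'a::real_inner fvec \<Rightarrow> 'a fvec \<Rightarrow> complex" where
  "fock_inner qp qm F G =
     (\<Sum>n | G n \<noteq> (\<lambda>z. 0). tensor_inner n (F n) (P_op qp qm n (G n)))"

text \<open>
  Creation by \<open>x \<otimes> y\<close>, again defined on forms; lemma \<open>creation_simple\<close> gives it on
  simple tensors.
\<close>

definition creation :: "'a::real_inner cplxn \<Rightarrow> 'a cplxn \<Rightarrow> 'a fvec \<Rightarrow> 'a fvec" where
  "creation x y F = (\<lambda>k z. case k of 0 \<Rightarrow> 0
     | Suc n \<Rightarrow> cinner (z (- int (Suc n))) x * cinner (z (int (Suc n))) y * F n z)"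

lemma creation_simple:
  assumes "F n = simple_tensor n x"
  shows "creation u v F (Suc n) = simple_tensor (Suc n) (x(- int (Suc n) := u, int (Suc n) := v))"
proof -
  have "pm (Suc n) = insert (- int (Suc n)) (insert (int (Suc n)) (pm n))"
    by (auto simp: pm_def)
  moreover have "- int (Suc n) \<notin> insert (int (Suc n)) (pm n)" "int (Suc n) \<notin> pm n" "finite (pm n)"
    by (auto simp: pm_def)
  moreover have "(\<Prod>i\<in>pm n. cinner (z i) (x i)) =
      (\<Prod>i\<in>pm n. cinner (z i) ((x(- int (Suc n) := u, int (Suc n) := v)) i))" for z
    by (rule prod.cong) (auto simp: pm_def)
  ultimately show ?thesis
    using assms by (auto simp: creation_def simple_tensor_def fun_eq_iff)
qed

lemma creation_vacuum:
  "creation u v vacuum 1 = simple_tensor 1 (\<lambda>i. if i = - 1 then u else v)"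
proof -
  have "pm 1 = {- 1, 1}" by (auto simp: pm_def)
  then show ?thesis by (simp add: creation_def vacuum_def simple_tensor_def fun_eq_iff)
qed

text \<open>
  The quotient of the Fock space by the vectors of seminorm zero; its elements are the equivalence
  classes, and operators on it are functions on classes.
\<close>

definition null_rel :: "real \<Rightarrow> real \<Rightarrow> ('a::real_inner fvec \<times> 'a fvec) set" where
  "null_rel qp qm = {(F, G). F \<in> fock \<and> G \<in> fock \<and>
     fock_inner qp qm (fock_diff F G) (fock_diff F G) = 0}"

definition fock_quot :: "real \<Rightarrow> real \<Rightarrow> 'a::real_inner fvec set set" where
  "fock_quot qp qm = fock // null_rel qp qm"

definition quot_inner :: "real \<Rightarrow> real \<Rightarrow> 'a::real_inner fvec set \<Rightarrow> 'a fvec set \<Rightarrow> complex" where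
  "quot_inner qp qm A B = (THE c. \<exists>F\<in>A. \<exists>G\<in>B. c = fock_inner qp qm F G)"

definition quot_add :: "real \<Rightarrow> real \<Rightarrow> 'a::real_inner fvec set \<Rightarrow> 'a fvec set \<Rightarrow> 'a fvec set" where
  "quot_add qp qm A B = null_rel qp qm `` {fock_add F G | F G. F \<in> A \<and> G \<in> B}"

definition quot_adjoint :: "real \<Rightarrow> real \<Rightarrow> ('a::real_inner fvec set \<Rightarrow> 'a fvec set) \<Rightarrow>
    'a fvec set \<Rightarrow> 'a fvec set" where
  "quot_adjoint qp qm T A = (THE B. B \<in> fock_quot qp qm \<and>
     (\<forall>C\<in>fock_quot qp qm. quot_inner qp qm B C = quot_inner qp qm A (T C)))"

definition b_star :: "real \<Rightarrow> real \<Rightarrow> 'a::real_inner cplxn \<Rightarrow> 'a cplxn \<Rightarrow> 'a fvec set \<Rightarrow> 'a fvec set" where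
  "b_star qp qm x y A = null_rel qp qm `` (creation x y ` A)"

definition b_op :: "real \<Rightarrow> real \<Rightarrow> 'a::real_inner cplxn \<Rightarrow> 'a cplxn \<Rightarrow> 'a fvec set \<Rightarrow> 'a fvec set" where
  "b_op qp qm x y = quot_adjoint qp qm (b_star qp qm x y)"

definition G_op :: "real \<Rightarrow> real \<Rightarrow> 'a::real_inner \<Rightarrow> 'a fvec set \<Rightarrow> 'a fvec set" where
  "G_op qp qm x A = quot_add qp qm
     (b_op qp qm (of_H\<^sub>R x) (of_H\<^sub>R x) A) (b_star qp qm (of_H\<^sub>R x) (of_H\<^sub>R x) A)"

definition vacuum_state :: "real \<Rightarrow> real \<Rightarrow> ('a::real_inner fvec set \<Rightarrow> 'a fvec set) \<Rightarrow> complex" where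
  "vacuum_state qp qm T =
     (let \<Omega> = null_rel qp qm `` {vacuum} in quot_inner qp qm \<Omega> (T \<Omega>))"


section \<open>Symmetric pair partitions and their cycles\<close>

definition Pair :: "int set set \<Rightarrow> int set set" where
  "Pair \<pi> = {B \<in> \<pi>. card B = 2}"

definition P12_sym :: "nat \<Rightarrow> int set set set" where
  "P12_sym n = {\<pi>. partition_on (pm n) \<pi> \<and> (\<forall>B\<in>\<pi>. card B = 1 \<or> card B = 2) \<and>
     bar ` \<pi> = \<pi> \<and> (\<forall>B\<in>Pair \<pi>. bar B \<noteq> B)}"

definition P2_sym :: "nat \<Rightarrow> int set set set" where
  "P2_sym n = {\<pi> \<in> P12_sym n. \<forall>B\<in>\<pi>. card B \<noteq> 1}"

text \<open>The left and right legs of a pair \<open>B\<close> are \<open>Min B\<close> and \<open>Max B\<close>.\<close>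

definition pos_pair :: "int set \<Rightarrow> bool" where
  "pos_pair B \<longleftrightarrow> Max B > - Min B"

definition pos_right_legs :: "int set set \<Rightarrow> int set" where
  "pos_right_legs \<pi> = {Max B | B. B \<in> Pair \<pi> \<and> pos_pair B}"

definition neg_left_legs :: "int set set \<Rightarrow> int set" where
  "neg_left_legs \<pi> = {Min B | B. B \<in> Pair \<pi> \<and> \<not> pos_pair B}"

definition noncrossing :: "int set set \<Rightarrow> bool" where
  "noncrossing \<pi> \<longleftrightarrow> \<not> (\<exists>A\<in>\<pi>. \<exists>B\<in>\<pi>. A \<noteq> B \<and>
     (\<exists>a\<in>A. \<exists>b\<in>B. \<exists>c\<in>A. \<exists>d\<in>B. a < b \<and> b < c \<and> c < d))"

definition covers_singleton :: "int set set \<Rightarrow> bool" where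
  "covers_singleton \<pi> \<longleftrightarrow> (\<exists>B\<in>Pair \<pi>. \<exists>s. {s} \<in> \<pi> \<and> Min B < s \<and> s < Max B)"

definition hat :: "nat \<Rightarrow> int set set \<Rightarrow> int set set" where
  "hat n \<pi> = (THE \<pi>'. \<pi>' \<in> P12_sym n \<and> noncrossing \<pi>' \<and>
     pos_right_legs \<pi>' = pos_right_legs \<pi> \<and> neg_left_legs \<pi>' = neg_left_legs \<pi> \<and>
     \<not> covers_singleton \<pi>')"

definition pair_graph :: "nat \<Rightarrow> int set set \<Rightarrow> (int \<times> int) set" where
  "pair_graph n \<pi> = {(i, j). \<exists>B \<in> Pair \<pi> \<union> Pair (hat n \<pi>). i \<in> B \<and> j \<in> B}"

text \<open>
  Supports of the connected components that are closed, i.e. in which every vertex lies both on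
  a pair of \<open>\<pi>\<close> and on a pair of \<open>hat n \<pi>\<close>.
\<close>

definition closed_components :: "nat \<Rightarrow> int set set \<Rightarrow> int set set" where
  "closed_components n \<pi> = {S. (\<exists>v\<in>pm n. S = (pair_graph n \<pi>)\<^sup>* `` {v}) \<and>
     S \<subseteq> \<Union> (Pair \<pi>) \<and> S \<subseteq> \<Union> (Pair (hat n \<pi>))}"

text \<open>
  Again cycles are represented by their supports, a positive cycle by the union of a component
  with its image under the bar operation. In both cases the length is half the number of pairs of
  \<open>\<pi>\<close> inside the support.
\<close>

definition pos_cycles :: "nat \<Rightarrow> int set set \<Rightarrow> int set set" where
  "pos_cycles n \<pi> = {S \<union> bar S | S. S \<in> closed_components n \<pi> \<and> bar S \<inter> S = {}}"

definition neg_cycles :: "nat \<Rightarrow> int set set \<Rightarrow> int set set" where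
  "neg_cycles n \<pi> = {S \<in> closed_components n \<pi>. bar S = S}"

definition Cyc :: "nat \<Rightarrow> int set set \<Rightarrow> int set set" where
  "Cyc n \<pi> = pos_cycles n \<pi> \<union> neg_cycles n \<pi>"

definition cyc_length :: "int set set \<Rightarrow> int set \<Rightarrow> nat" where
  "cyc_length \<pi> C = card {B \<in> Pair \<pi>. B \<subseteq> C} div 2"

definition l_c :: "nat \<Rightarrow> int set set \<Rightarrow> nat" where
  "l_c n \<pi> = (\<Sum>C\<in>Cyc n \<pi>. cyc_length \<pi> C - 1)"

definition c_minus :: "nat \<Rightarrow> int set set \<Rightarrow> nat" where
  "c_minus n \<pi> = card (neg_cycles n \<pi>)"

definition c_total :: "nat \<Rightarrow> int set set \<Rightarrow> nat" where
  "c_total n \<pi> = card (Cyc n \<pi>)"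

text \<open>The factor $\prod\langle x_i,x_j\rangle$ over all pairs, where $x_{\overline i}=x_i$.\<close>

definition pair_product :: "(nat \<Rightarrow> 'a::real_inner) \<Rightarrow> int set set \<Rightarrow> real" where
  "pair_product x \<pi> = (\<Prod>B\<in>Pair \<pi>. x (nat \<bar>Min B\<bar>) \<bullet> x (nat \<bar>Max B\<bar>))"

end

theory Submission
  imports Defs
begin

text \<open>
  Inserting a point into a cycle of a signed permutation multiplies the weight by $q_+$, adding a
  negative fixed point multiplies it by $q_-$; hence $P^{(n+1)} = P^{(n)}R^{(n+1)}$ with $R^{(n+1)}$ a sum
  of $2n+2$ signed transpositions. This yields an explicit annihilation operator which, on tensors
  of real vectors with $x_{\overline i} = x_i$, pairs the new vector either with the top of the stack of
  open vectors (factor $1+q_-$), or with another one, whose place is then taken by the top (factor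
  $2q_+$). On the combinatorial side the first closer $t$ of a pair partition is matched by
  $\hat\pi$ with its predecessor $d$. Contracting the alternating path through $d$ and $t$ deletes
  both points, shortens a cycle by one (or removes a cycle of length one), and gives the same
  recursion.

  The form is pos_finite because the weight is a nonnegative combination, over colourings of the points,
  of characters of the stabilisers; null vectors are therefore exactly the kernel of $P^{(n)}$.
\<close>

section \<open>Partitions of signed points\<close>


text \<open>The operations on the quotient are definite descriptions, so nothing can be computed on
  classes before \<open>null_rel\<close> is known to be linear. This is where the restriction on the
  parameters enters: positivity turns equivalence of F and G into P F = P G in each degree, and
  creation respects that relation because it has an explicit adjoint, not by an estimate. The first
  family of parameters has a probabilistic reading: colour the points independently with M + N
  equally likely colours, M of sign 1 and N of sign -1. Two points agree with probability 1/(M+N),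
  the mean sign is (M-N)/(M+N), and a negative q_+ is absorbed by the sign of the underlying
  permutation. Cycles of pairs are read as cycles of a signed permutation of the closers only, so
  the single insertion lemma \<open>wt_insert\<close> yields both the recursion of the Fock space
  and that of the pair partitions. No formula for the hat is used: it is recognised through
  \<open>is_hat\<close>, which determines it uniquely and survives the insertion of an adjacent
  pair.\<close>

lemma in_bar_iff [simp]: "i \<in> bar S \<longleftrightarrow> - i \<in> S"
  unfolding bar_def by force

lemma bar_bar [simp]: "bar (bar S) = S"
  by auto

lemma bar_Un: "bar (S \<union> T) = bar S \<union> bar T"
  by auto

lemma bar_Int: "bar (S \<inter> T) = bar S \<inter> bar T"
  by auto

lemma card_bar [simp]: "card (bar S) = card S"
  unfolding bar_def by (rule card_image) auto

lemma finite_bar [simp]: "finite (bar S) \<longleftrightarrow> finite S"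
  by (metis bar_bar bar_def finite_imageI)

lemma card_bar_closed:
  assumes "finite C" "0 \<notin> C" "bar C = C"
  shows "card C = 2 * card {i \<in> C. i > 0}"
proof -
  have neg: "\<And>i. i \<in> C \<longleftrightarrow> - i \<in> C"
    using assms(3) in_bar_iff by metis
  have C: "C = {i \<in> C. i > 0} \<union> bar {i \<in> C. i > 0}"
  proof (rule set_eqI)
    fix i show "i \<in> C \<longleftrightarrow> i \<in> {i \<in> C. i > 0} \<union> bar {i \<in> C. i > 0}"
      using neg[of i] assms(2) by (cases i "0::int" rule: linorder_cases) auto
  qed
  have "card C = card {i \<in> C. i > 0} + card (bar {i \<in> C. i > 0})"
    by (subst C, rule card_Un_disjoint) (use assms(1) in auto)
  then show ?thesis by simp
qed

text \<open>Two mirror-image parts give the same set \<open>S \<union> bar S\<close>, so a positive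
  cycle is counted once although it consists of two parts.\<close>

definition ctot :: "int set set \<Rightarrow> nat" where
  "ctot \<S> = card ((\<lambda>S. S \<union> bar S) ` \<S>)"

definition cneg :: "int set set \<Rightarrow> nat" where
  "cneg \<S> = card {S \<in> \<S>. bar S = S}"

text \<open>The common shape of the orbits of a signed permutation and of the components of the
  graph of pairs; facts on counting cycles are proved once for both.\<close>

definition bar_partition :: "int set \<Rightarrow> int set set \<Rightarrow> bool" where
  "bar_partition V \<S> \<longleftrightarrow> finite V \<and> 0 \<notin> V \<and> bar V = V \<and> partition_on V \<S> \<and> (\<forall>S\<in>\<S>. bar S \<in> \<S>)"

lemma partition_on_eqI:
  assumes "partition_on V \<S>" "S \<in> \<S>" "T \<in> \<S>" "i \<in> S" "i \<in> T"
  shows "S = T"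
  using assms unfolding partition_on_def disjoint_def by blast

text \<open>\<open>bar S\<close> is again a part, and two parts are equal or disjoint. This is the
  dichotomy between negative and positive cycles.\<close>

lemma bar_partition_Int_bar:
  assumes "bar_partition V \<S>" "S \<in> \<S>"
  shows "bar S \<inter> S = {} \<longleftrightarrow> bar S \<noteq> S"
proof -
  have "S \<noteq> {}" "bar S \<in> \<S>" "partition_on V \<S>"
    using assms unfolding bar_partition_def partition_on_def by auto
  then show ?thesis
    using partition_on_eqI[of V \<S> "bar S" S] assms(2) by fast
qed

text \<open>If \<open>S \<union> bar S\<close> and \<open>T \<union> bar T\<close> share a point,
  then \<open>S\<close> equals \<open>T\<close> or \<open>bar T\<close>, and the two unions
  coincide.\<close>

lemma bar_partition_sym_closure:
  assumes "bar_partition V \<S>"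
  shows "partition_on V ((\<lambda>S. S \<union> bar S) ` \<S>)"
proof -
  have p: "partition_on V \<S>" and b: "\<And>S. S \<in> \<S> \<Longrightarrow> bar S \<in> \<S>"
    using assms unfolding bar_partition_def by auto
  have eq: "S \<union> bar S = T \<union> bar T" if "S \<in> \<S>" "T \<in> \<S>" "i \<in> S \<union> bar S" "i \<in> T \<union> bar T" for S T i
  proof -
    have "S = T \<or> S = bar T"
      using that b partition_on_eqI[OF p] by (metis UnE bar_bar)
    then show ?thesis by auto
  qed
  show ?thesis
  proof (rule partition_onI)
    show "\<Union> ((\<lambda>S. S \<union> bar S) ` \<S>) = V"
      using b partition_onD1[OF p] by auto
    show "{} \<notin> (\<lambda>S. S \<union> bar S) ` \<S>"
      using partition_onD3[OF p] by auto
  next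
    fix C D assume "C \<in> (\<lambda>S. S \<union> bar S) ` \<S>" "D \<in> (\<lambda>S. S \<union> bar S) ` \<S>" "C \<noteq> D"
    then show "disjnt C D"
      unfolding disjnt_def using eq by (smt (verit, best) disjoint_iff imageE)
  qed
qed

lemma bar_partition_finite: "bar_partition V \<S> \<Longrightarrow> finite \<S>"
  unfolding bar_partition_def using finite_elements by blast

lemma bar_partition_length:
  assumes "bar_partition V \<S>" "C \<in> (\<lambda>S. S \<union> bar S) ` \<S>"
  shows "finite C" "even (card C)" "1 \<le> card C div 2"
proof -
  have p: "partition_on V ((\<lambda>S. S \<union> bar S) ` \<S>)"
    using bar_partition_sym_closure assms(1) by blast
  then have "C \<subseteq> V" "C \<noteq> {}" using assms(2) unfolding partition_on_def by auto
  moreover have "bar C = C" using assms(2) by auto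
  moreover have "finite V" "0 \<notin> V" using assms(1) unfolding bar_partition_def by auto
  ultimately have *: "finite C" "0 \<notin> C" "bar C = C" "C \<noteq> {}" using finite_subset by auto
  have "card C \<noteq> 0" using * by auto
  then show "1 \<le> card C div 2"
    using card_bar_closed[OF *(1-3)] by (metis One_nat_def Suc_leI div_mult_self1_is_m gr0I mult_is_0 pos2)
  show "finite C" "even (card C)"
    using * card_bar_closed[OF *(1-3)] by auto
qed

lemma bar_partition_sum_length:
  assumes "bar_partition V \<S>"
  shows "(\<Sum>C\<in>(\<lambda>S. S \<union> bar S) ` \<S>. card C div 2) = card V div 2"
proof -
  have p: "partition_on V ((\<lambda>S. S \<union> bar S) ` \<S>)" and fin: "finite V"
    using bar_partition_sym_closure assms unfolding bar_partition_def by auto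
  have "card V = (\<Sum>C\<in>(\<lambda>S. S \<union> bar S) ` \<S>. card C)"
    using sum.partition[OF fin p, of "\<lambda>_. 1::nat"] by simp
  also have "\<dots> = (\<Sum>C\<in>(\<lambda>S. S \<union> bar S) ` \<S>. 2 * (card C div 2))"
    using bar_partition_length[OF assms] by (intro sum.cong) auto
  finally show ?thesis by (simp add: sum_distrib_left[symmetric])
qed

text \<open>Every cycle has length at least one, so the truncated subtraction is exact, and the
  lengths add up to half the number of points. This is why the two exponents of q_+ in the theorem
  agree.\<close>

lemma bar_partition_sum_norm:
  assumes "bar_partition V \<S>"
  shows "(\<Sum>C\<in>(\<lambda>S. S \<union> bar S) ` \<S>. card C div 2 - 1) = card V div 2 - ctot \<S>"
    and "ctot \<S> \<le> card V div 2"
proof -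
  let ?Q = "(\<lambda>S. S \<union> bar S) ` \<S>"
  have "(\<Sum>C\<in>?Q. card C div 2 - 1) + (\<Sum>C\<in>?Q. 1) = (\<Sum>C\<in>?Q. card C div 2)"
    unfolding sum.distrib[symmetric]
    using bar_partition_length(3)[OF assms] by (intro sum.cong le_add_diff_inverse2) auto
  then have "(\<Sum>C\<in>?Q. card C div 2 - 1) + ctot \<S> = card V div 2"
    using bar_partition_sum_length[OF assms] by (simp add: ctot_def)
  then show "(\<Sum>C\<in>?Q. card C div 2 - 1) = card V div 2 - ctot \<S>" "ctot \<S> \<le> card V div 2"
    by auto
qed

text \<open>A part is recovered from its trace on \<open>V'\<close>, because traces are nonempty and
  disjoint parts have disjoint traces. It serves to delete a point from a cycle and to discard the
  openers from a cycle of pairs.\<close>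

lemma bar_partition_trace:
  assumes "bar_partition V \<S>" and V': "bar V' = V'" and ne: "\<And>S. S \<in> \<S> \<Longrightarrow> S \<inter> V' \<noteq> {}"
  shows "ctot ((\<lambda>S. S \<inter> V') ` \<S>) = ctot \<S>" "cneg ((\<lambda>S. S \<inter> V') ` \<S>) = cneg \<S>"
proof -
  have p: "partition_on V \<S>" and b: "\<And>S. S \<in> \<S> \<Longrightarrow> bar S \<in> \<S>"
    using assms unfolding bar_partition_def by auto
  have inj: "inj_on (\<lambda>S. S \<inter> V') \<S>"
    using ne partition_on_eqI[OF p] by (intro inj_onI) blast
  have bar_tr: "bar (S \<inter> V') = bar S \<inter> V'" for S
    using V' by (simp add: bar_Int)
  have "{S \<in> (\<lambda>S. S \<inter> V') ` \<S>. bar S = S} = (\<lambda>S. S \<inter> V') ` {S \<in> \<S>. bar S = S}"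
  proof -
    have "bar (S \<inter> V') = S \<inter> V' \<longleftrightarrow> bar S = S" if "S \<in> \<S>" for S
      using inj_onD[OF inj, of "bar S" S] b that bar_tr by metis
    then show ?thesis by auto
  qed
  then show "cneg ((\<lambda>S. S \<inter> V') ` \<S>) = cneg \<S>"
    unfolding cneg_def using inj by (metis (no_types, lifting) card_image inj_on_subset mem_Collect_eq subsetI)
  let ?Q = "(\<lambda>S. S \<union> bar S) ` \<S>"
  have q: "partition_on V ?Q" using bar_partition_sym_closure assms(1) by blast
  have "\<And>C. C \<in> ?Q \<Longrightarrow> C \<inter> V' \<noteq> {}" using ne by blast
  then have "inj_on (\<lambda>S. S \<inter> V') ?Q"
    using partition_on_eqI[OF q] by (intro inj_onI) blast
  moreover have "(\<lambda>S. S \<union> bar S) ` (\<lambda>S. S \<inter> V') ` \<S> = (\<lambda>S. S \<inter> V') ` ?Q"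
    by (simp add: image_image bar_tr Int_Un_distrib2)
  ultimately show "ctot ((\<lambda>S. S \<inter> V') ` \<S>) = ctot \<S>"
    unfolding ctot_def by (simp add: card_image)
qed

section \<open>Connected components and their retraction to a subset\<close>

definition comps :: "int set \<Rightarrow> (int \<times> int) set \<Rightarrow> int set set" where
  "comps V E = (\<lambda>v. E\<^sup>* `` {v}) ` V"

lemma rtrancl_closed_set:
  assumes "E \<subseteq> V \<times> V" "(v, w) \<in> E\<^sup>*" "v \<in> V"
  shows "w \<in> V"
  using assms(2,3,1) by (induction rule: rtrancl_induct) auto

lemma comps_eq:
  assumes "sym (E\<^sup>*)" "(v, w) \<in> E\<^sup>*"
  shows "E\<^sup>* `` {v} = E\<^sup>* `` {w}"
  using assms by (auto dest: symD intro: rtrancl_trans)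

text \<open>Symmetry is asked of the closure \<open>E\<^sup>*\<close> only, which admits the
  directed graph of a permutation of a finite set.\<close>

lemma bar_partition_comps:
  assumes "finite V" "0 \<notin> V" "bar V = V" "E \<subseteq> V \<times> V" "sym (E\<^sup>*)"
    and neg: "\<And>v w. (v, w) \<in> E \<Longrightarrow> (- v, - w) \<in> E"
  shows "bar_partition V (comps V E)"
proof -
  have neg': "(- v, - w) \<in> E\<^sup>*" if "(v, w) \<in> E\<^sup>*" for v w
    using that by (induction rule: rtrancl_induct) (auto intro: rtrancl_into_rtrancl neg)
  have bar_comp: "bar (E\<^sup>* `` {v}) = E\<^sup>* `` {- v}" for v
    using neg'[of v] neg'[of "- v"] by force
  have p: "partition_on V (comps V E)"
  proof (rule partition_onI)
    show "\<Union> (comps V E) = V" "{} \<notin> comps V E"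
      unfolding comps_def using rtrancl_closed_set[OF assms(4)] by blast+
  next
    fix S T assume "S \<in> comps V E" "T \<in> comps V E" "S \<noteq> T"
    then show "disjnt S T"
      unfolding comps_def disjnt_def using comps_eq[OF assms(5)] by (smt (verit) Image_singleton_iff disjoint_iff imageE)
  qed
  have "- v \<in> V" if "v \<in> V" for v using that assms(3) by (metis in_bar_iff minus_minus)
  then show ?thesis
    unfolding bar_partition_def using assms p bar_comp unfolding comps_def by auto
qed

text \<open>\<open>r\<close> moves each vertex inside its component into \<open>V'\<close> and maps
  edges to paths of \<open>E'\<close>, so points of \<open>V'\<close> that are joined in the large
  graph are already joined in the small one.\<close>

lemma comps_retract:
  assumes "V' \<subseteq> V" "E' \<subseteq> E\<^sup>*" "E' \<subseteq> V' \<times> V'" "sym (E\<^sup>*)"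
    and r: "\<And>v. v \<in> V \<Longrightarrow> r v \<in> V' \<and> (v, r v) \<in> E\<^sup>*" "\<And>v. v \<in> V' \<Longrightarrow> r v = v"
    and step: "\<And>v w. (v, w) \<in> E \<Longrightarrow> (r v, r w) \<in> E'\<^sup>*"
  shows "comps V' E' = (\<lambda>S. S \<inter> V') ` comps V E"
    and "S \<in> comps V E \<Longrightarrow> S \<inter> V' \<noteq> {}"
proof -
  have path: "(r v, r w) \<in> E'\<^sup>*" if "(v, w) \<in> E\<^sup>*" for v w
    using that by (induction rule: rtrancl_induct) (auto intro: rtrancl_trans step)
  have tr: "E\<^sup>* `` {v} \<inter> V' = E'\<^sup>* `` {v}" if v: "v \<in> V'" for v
  proof (intro equalityI subsetI)
    fix w assume "w \<in> E\<^sup>* `` {v} \<inter> V'"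
    then show "w \<in> E'\<^sup>* `` {v}" using path[of v w] r(2) v by auto
  next
    fix w assume "w \<in> E'\<^sup>* `` {v}"
    then show "w \<in> E\<^sup>* `` {v} \<inter> V'"
      using rtrancl_closed_set[OF assms(3)] v rtrancl_subset_rtrancl[OF assms(2)] by auto
  qed
  have c: "E\<^sup>* `` {v} \<inter> V' = E'\<^sup>* `` {r v}" if "v \<in> V" for v
    using tr[of "r v"] r(1)[OF that] comps_eq[OF assms(4)] by metis
  show "comps V' E' = (\<lambda>S. S \<inter> V') ` comps V E"
  proof (intro equalityI subsetI)
    fix S assume "S \<in> comps V' E'"
    then obtain v where "v \<in> V'" "S = E'\<^sup>* `` {v}" by (auto simp: comps_def)
    then show "S \<in> (\<lambda>S. S \<inter> V') ` comps V E"
      using tr assms(1) by (auto simp: comps_def image_image)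
  next
    fix S assume "S \<in> (\<lambda>S. S \<inter> V') ` comps V E"
    then show "S \<in> comps V' E'" using c r(1) by (auto simp: comps_def)
  qed
  show "S \<inter> V' \<noteq> {}" if S: "S \<in> comps V E"
    using S r(1) unfolding comps_def by blast
qed

section \<open>Signed permutations and their weights\<close>


text \<open>The hyperoctahedral group on an arbitrary set of points; the signed sets of closers
  below are in general not of the form \<open>pm n\<close>.\<close>

definition sperm :: "int set \<Rightarrow> (int \<Rightarrow> int) set" where
  "sperm V = {\<sigma>. \<sigma> permutes V \<and> (\<forall>i. \<sigma> (- i) = - \<sigma> i)}"

lemma pm_props [simp]: "finite (pm n)" "0 \<notin> pm n" "bar (pm n) = pm n"
  by (auto simp: pm_def)

lemma card_pm [simp]: "card (pm n) = 2 * n"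
proof -
  have "{i \<in> pm n. i > 0} = {1..int n}" by (auto simp: pm_def)
  then show ?thesis using card_bar_closed[of "pm n"] by simp
qed

lemma pm_Suc: "pm (Suc n) = pm n \<union> {int (Suc n), - int (Suc n)}"
  by (auto simp: pm_def)

lemma B_group_eq_sperm: "B_group n = sperm (pm n)"
proof -
  have "\<sigma> (- i) = - \<sigma> i" if "\<sigma> permutes pm n" "i \<notin> pm n" for \<sigma> i
  proof -
    have "- i \<notin> pm n" using that(2) pm_props(3)[of n] by (metis in_bar_iff minus_minus)
    then show ?thesis using that by (simp add: permutes_not_in)
  qed
  then show ?thesis unfolding B_group_def sperm_def by blast
qed

lemma sperm_comp: "\<sigma> \<in> sperm V \<Longrightarrow> \<tau> \<in> sperm V \<Longrightarrow> \<sigma> \<circ> \<tau> \<in> sperm V"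
  unfolding sperm_def by (auto intro: permutes_compose)

lemma sperm_inv: "\<sigma> \<in> sperm V \<Longrightarrow> inv \<sigma> \<in> sperm V"
  unfolding sperm_def by (auto simp: permutes_inv permutes_inv_eq) (metis permutes_inverses(1))

lemma sperm_mono: "\<sigma> \<in> sperm V \<Longrightarrow> V \<subseteq> W \<Longrightarrow> \<sigma> \<in> sperm W"
  unfolding sperm_def by (auto intro: permutes_subset)

lemma finite_sperm: "finite V \<Longrightarrow> finite (sperm V)"
  unfolding sperm_def by (rule finite_subset[OF _ finite_permutations[of V]]) auto

text \<open>The signed transposition. It degenerates to the identity for \<open>j = m\<close> and to
  the sign change of \<open>m\<close> for \<open>j = - m\<close>, so that letting \<open>j\<close>
  run through all 2n+2 points yields coset representatives.\<close>

definition st :: "int \<Rightarrow> int \<Rightarrow> int \<Rightarrow> int" where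
  "st j m v = (if v = j then m else if v = m then j
     else if v = - j then - m else if v = - m then - j else v)"

lemma st_invol: "j \<noteq> 0 \<Longrightarrow> m \<noteq> 0 \<Longrightarrow> st j m (st j m v) = v"
  by (auto simp: st_def)

lemma st_neg: "j \<noteq> 0 \<Longrightarrow> m \<noteq> 0 \<Longrightarrow> st j m (- v) = - st j m v"
  by (auto simp: st_def)

lemma st_self [simp]: "st m m = id"
  by (auto simp: st_def)

lemma st_sperm:
  assumes "j \<in> V" "m \<in> V" "0 \<notin> V" "bar V = V"
  shows "st j m \<in> sperm V"
proof -
  have neg: "- v \<in> V \<longleftrightarrow> v \<in> V" for v using assms(4) by (metis in_bar_iff)
  have "j \<noteq> 0" "m \<noteq> 0" using assms by auto
  moreover from this have "st j m permutes V"
  proof (intro bij_imp_permutes)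
    have maps: "st j m v \<in> V" if "v \<in> V" for v
      using that assms neg unfolding st_def by auto
    show "bij_betw (st j m) V V"
      by (rule bij_betw_byWitness[where f' = "st j m"]) (use \<open>j \<noteq> 0\<close> \<open>m \<noteq> 0\<close> in \<open>auto simp: st_invol maps\<close>)
  next
    fix v assume "v \<notin> V"
    then show "st j m v = v" using assms neg unfolding st_def by auto
  qed
  ultimately show ?thesis unfolding sperm_def by (auto simp: st_neg)
qed

section \<open>Orbits and weights of signed permutations\<close>

definition orbs :: "int set \<Rightarrow> (int \<Rightarrow> int) \<Rightarrow> int set set" where
  "orbs V \<sigma> = orbit \<sigma> ` V"

definition graph_on :: "int set \<Rightarrow> (int \<Rightarrow> int) \<Rightarrow> (int \<times> int) set" where
  "graph_on V \<sigma> = (\<lambda>v. (v, \<sigma> v)) ` V"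

lemma orbit_eq_comp:
  assumes "finite V" "\<sigma> permutes V" "v \<in> V"
  shows "(graph_on V \<sigma>)\<^sup>* `` {v} = orbit \<sigma> v"
proof (intro equalityI subsetI)
  have self: "v \<in> orbit \<sigma> v"
    using assms permutation_permutes permutation_self_in_orbit by metis
  fix w assume "w \<in> (graph_on V \<sigma>)\<^sup>* `` {v}"
  then have "(v, w) \<in> (graph_on V \<sigma>)\<^sup>*" by simp
  then show "w \<in> orbit \<sigma> v"
    by (induction rule: rtrancl_induct) (auto simp: self graph_on_def intro: orbit.step)
next
  fix w assume "w \<in> orbit \<sigma> v"
  then have "(v, w) \<in> (graph_on V \<sigma>)\<^sup>* \<and> w \<in> V"
  proof induction
    case base
    then show ?case using assms by (auto simp: graph_on_def permutes_in_image)
  next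
    case (step y)
    then show ?case using assms
      by (auto simp: graph_on_def permutes_in_image intro: rtrancl_into_rtrancl)
  qed
  then show "w \<in> (graph_on V \<sigma>)\<^sup>* `` {v}" by simp
qed

text \<open>A finite cycle returns to its start, so every directed path can be continued to a path
  back.\<close>

lemma sym_graph_on:
  assumes "finite V" "\<sigma> permutes V"
  shows "sym ((graph_on V \<sigma>)\<^sup>*)"
proof (rule symI)
  fix v w assume vw: "(v, w) \<in> (graph_on V \<sigma>)\<^sup>*"
  show "(w, v) \<in> (graph_on V \<sigma>)\<^sup>*"
  proof (cases "v \<in> V")
    case True
    have sub: "graph_on V \<sigma> \<subseteq> V \<times> V"
      using assms by (auto simp: graph_on_def permutes_in_image)
    have w: "w \<in> V" using rtrancl_closed_set[OF sub vw True] .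
    have "w \<in> orbit \<sigma> v" using orbit_eq_comp[OF assms True] vw by auto
    then have "v \<in> orbit \<sigma> w"
      using assms orbit_swap permutation_permutes permutation_self_in_orbit by metis
    then show ?thesis using orbit_eq_comp[OF assms w] by auto
  next
    case False
    then have "v \<notin> Domain (graph_on V \<sigma>)" by (auto simp: graph_on_def)
    then have "w = v" using vw Not_Domain_rtrancl by metis
    then show ?thesis by simp
  qed
qed

lemma orbs_eq_comps: "finite V \<Longrightarrow> \<sigma> permutes V \<Longrightarrow> orbs V \<sigma> = comps V (graph_on V \<sigma>)"
  unfolding orbs_def comps_def by (rule image_cong) (auto simp: orbit_eq_comp)

lemma bar_partition_orbs:
  assumes "finite V" "0 \<notin> V" "bar V = V" "\<sigma> \<in> sperm V"
  shows "bar_partition V (orbs V \<sigma>)"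
proof -
  have s: "\<sigma> permutes V" "\<And>i. \<sigma> (- i) = - \<sigma> i" using assms(4) by (auto simp: sperm_def)
  have neg: "- v \<in> V \<longleftrightarrow> v \<in> V" for v using assms(3) by (metis in_bar_iff)
  show ?thesis
    unfolding orbs_eq_comps[OF assms(1) s(1)]
  proof (rule bar_partition_comps[OF assms(1-3) _ sym_graph_on[OF assms(1) s(1)]])
    show "graph_on V \<sigma> \<subseteq> V \<times> V" using s by (auto simp: graph_on_def permutes_in_image)
    show "(- v, - w) \<in> graph_on V \<sigma>" if "(v, w) \<in> graph_on V \<sigma>" for v w
      using that s(2) neg by (auto simp: graph_on_def image_iff)
  qed
qed

text \<open>\<open>phi\<close> for an arbitrary set of points: half the number of signed points
  minus the number of cycles is the sum of the two partition norms.\<close>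

definition wt :: "real \<Rightarrow> real \<Rightarrow> int set \<Rightarrow> (int \<Rightarrow> int) \<Rightarrow> real" where
  "wt qp qm V \<sigma> = qp ^ (card V div 2 - ctot (orbs V \<sigma>)) * qm ^ cneg (orbs V \<sigma>)"

lemma wt_inv: "finite V \<Longrightarrow> \<sigma> permutes V \<Longrightarrow> wt qp qm V (inv \<sigma>) = wt qp qm V \<sigma>"
proof -
  assume "finite V" "\<sigma> permutes V"
  then have "permutation \<sigma>" using permutation_permutes by blast
  then have "orbs V (inv \<sigma>) = orbs V \<sigma>" by (simp add: orbs_def orbit_inv_eq)
  then show ?thesis by (simp add: wt_def)
qed

lemma wt_empty: "wt qp qm {} \<sigma> = 1"
  by (simp add: wt_def cneg_def orbs_def)

definition stw :: "real \<Rightarrow> real \<Rightarrow> int \<Rightarrow> int \<Rightarrow> real" where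
  "stw qp qm j m = (if j = m then 1 else if j = - m then qm else qp)"

text \<open>Composing with \<^term>\<open>st j m\<close> inserts \<open>m\<close> behind \<open>j\<close> into the cycle of \<open>j\<close>.\<close>

lemma wt_insert:
  assumes V: "finite V" "0 \<notin> V" "bar V = V" and m: "m \<noteq> 0" "m \<notin> V"
    and \<sigma>: "\<sigma> \<in> sperm V" and j: "j \<in> V \<union> {m, - m}"
  shows "wt qp qm (V \<union> {m, - m}) (\<sigma> \<circ> st j m) = stw qp qm j m * wt qp qm V \<sigma>"
proof -
  let ?W = "V \<union> {m, - m}" and ?\<rho> = "\<sigma> \<circ> st j m"
  have neg: "- v \<in> V \<longleftrightarrow> v \<in> V" for v using V(3) by (metis in_bar_iff)
  have m': "- m \<notin> V" using neg m(2) by blast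
  have W: "finite ?W" "0 \<notin> ?W" using V m by auto
  have W3: "bar ?W = ?W" unfolding bar_Un V(3) by (auto simp: bar_def)
  note W = W W3
  have j0: "j \<noteq> 0" using j V(2) m by auto
  have s: "\<sigma> permutes V" "\<And>i. \<sigma> (- i) = - \<sigma> i" using \<sigma> by (auto simp: sperm_def)
  have \<rho>: "?\<rho> \<in> sperm ?W"
    using sperm_comp[OF sperm_mono[OF \<sigma>, of ?W] st_sperm[of j ?W m]] W j by auto
  then have r: "?\<rho> permutes ?W" by (simp add: sperm_def)
  have sm: "\<sigma> m = m" "\<sigma> (- m) = - m" using s m m' by (auto simp: permutes_not_in)
  have cW: "card ?W = card V + 2" using V(1) m m' by (simp add: card_insert_if)
  have bV: "bar_partition V (orbs V \<sigma>)" using bar_partition_orbs[OF V \<sigma>] .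
  have le: "ctot (orbs V \<sigma>) \<le> card V div 2" using bar_partition_sum_norm(2)[OF bV] .
  have sub: "S \<subseteq> V" if "S \<in> orbs V \<sigma>" for S
    using that bV by (auto simp: bar_partition_def partition_on_def)
  have fin: "finite (orbs V \<sigma>)" using V(1) by (simp add: orbs_def)
  have nin: "{m, - m} \<notin> (\<lambda>S. S \<union> bar S) ` orbs V \<sigma>"
  proof
    assume "{m, - m} \<in> (\<lambda>S. S \<union> bar S) ` orbs V \<sigma>"
    then obtain S where S: "S \<in> orbs V \<sigma>" "{m, - m} = S \<union> bar S" by blast
    have "m \<in> S \<union> bar S" unfolding S(2)[symmetric] by simp
    then show False using sub[OF S(1)] m(2) m' by auto
  qed
  show ?thesis
  proof (cases "j \<in> V")
    case True
    \<comment> \<open>The new point \<open>m\<close> is retracted onto its predecessor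
      \<open>j\<close>, and \<open>- m\<close> onto \<open>- j\<close>; contracting these edges
      recovers the cycles of \<sigma>.\<close>
    let ?r = "\<lambda>v. if v = m then j else if v = - m then - j else v"
    have jm: "j \<noteq> m" "j \<noteq> - m" "- j \<noteq> m" using True m m' by auto
    have \<rho>v: "?\<rho> v = (if v = j then m else if v = m then \<sigma> j
        else if v = - j then - m else if v = - m then - \<sigma> j else \<sigma> v)" for v
      using sm s(2) by (auto simp: st_def)
    let ?E = "graph_on ?W ?\<rho>" and ?E' = "graph_on V \<sigma>"
    have edge: "(v, ?\<rho> v) \<in> ?E" if "v \<in> ?W" for v using that unfolding graph_on_def by blast
    have symE: "sym (?E\<^sup>*)" using sym_graph_on[OF W(1) r] .
    have ej: "(j, m) \<in> ?E" "(- j, - m) \<in> ?E" "(m, \<sigma> j) \<in> ?E" "(- m, - \<sigma> j) \<in> ?E"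
      using edge[of j] edge[of "- j"] edge[of m] edge[of "- m"] True neg jm m j0 unfolding \<rho>v by auto
    have comp: "orbs V \<sigma> = (\<lambda>S. S \<inter> V) ` orbs ?W ?\<rho>" "\<And>S. S \<in> orbs ?W ?\<rho> \<Longrightarrow> S \<inter> V \<noteq> {}"
    proof -
      have a1: "V \<subseteq> ?W" by auto
      have a2: "?E' \<subseteq> ?E\<^sup>*"
      proof
        fix p assume "p \<in> ?E'"
        then obtain v where v: "v \<in> V" "p = (v, \<sigma> v)" by (auto simp: graph_on_def)
        have "v \<noteq> m" "v \<noteq> - m" using v m m' by auto
        consider "v = j" | "v = - j" "v \<noteq> j" | "v \<noteq> j" "v \<noteq> - j" by blast
        then show "p \<in> ?E\<^sup>*"
        proof cases
          case 1 then show ?thesis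
            using v rtrancl_into_rtrancl[OF r_into_rtrancl[OF ej(1)] ej(3)] by simp
        next
          case 2 then show ?thesis
            using v s(2) rtrancl_into_rtrancl[OF r_into_rtrancl[OF ej(2)] ej(4)] by simp
        next
          case 3
          then have "?\<rho> v = \<sigma> v" unfolding \<rho>v using \<open>v \<noteq> m\<close> \<open>v \<noteq> - m\<close> by simp
          then show ?thesis using edge[of v] v by auto
        qed
      qed
      have a3: "?E' \<subseteq> V \<times> V" using s by (auto simp: graph_on_def permutes_in_image)
      have a4: "?r v \<in> V \<and> (v, ?r v) \<in> ?E\<^sup>*" if "v \<in> ?W" for v
        using that True neg ej symD[OF symE] m(1) by auto
      have a5: "?r v = v" if "v \<in> V" for v using that m m' by auto
      have a6: "(?r v, ?r w) \<in> ?E'\<^sup>*" if vw: "(v, w) \<in> ?E" for v w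
      proof -
        have v: "v \<in> ?W" "w = ?\<rho> v" using vw by (auto simp: graph_on_def)
        have e': "(u, \<sigma> u) \<in> ?E'\<^sup>*" "\<sigma> u \<in> V" if "u \<in> V" for u
          using that s by (auto simp: graph_on_def permutes_in_image)
        have ne: "\<sigma> u \<noteq> m" "\<sigma> u \<noteq> - m" if "u \<in> V" for u
          using e'(2)[OF that] m m' by auto
        consider "v = j" | "v = - j" "v \<noteq> j" | "v = m" | "v = - m" "v \<noteq> m"
          | "v \<noteq> j" "v \<noteq> - j" "v \<noteq> m" "v \<noteq> - m" by blast
        then show ?thesis
        proof cases
          case 1 then show ?thesis unfolding v(2) \<rho>v using jm m j0 by auto
        next
          case 2 then show ?thesis unfolding v(2) \<rho>v using jm m j0 by auto
        next
          case 3 then show ?thesis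
            unfolding v(2) \<rho>v using e'[OF True] ne[OF True] jm m j0 by auto
        next
          case 4 then show ?thesis
            unfolding v(2) \<rho>v using e'[of "- j"] ne[of "- j"] True neg s(2) jm m j0 by auto
        next
          case 5
          then have "v \<in> V" using v by auto
          then show ?thesis unfolding v(2) \<rho>v using 5 e'[of v] ne[of v] by auto
        qed
      qed
      show "orbs V \<sigma> = (\<lambda>S. S \<inter> V) ` orbs ?W ?\<rho>" "\<And>S. S \<in> orbs ?W ?\<rho> \<Longrightarrow> S \<inter> V \<noteq> {}"
        unfolding orbs_eq_comps[OF V(1) s(1)] orbs_eq_comps[OF W(1) r]
        using comps_retract[OF a1 a2 a3 symE a4 a5 a6] by blast+
    qed
    note tr = bar_partition_trace[OF bar_partition_orbs[OF W \<rho>] V(3) comp(2), folded comp(1)]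
    show ?thesis using tr le jm cW by (simp add: wt_def stw_def Suc_diff_le)
  next
    case False
    have orb: "orbit ?\<rho> v = orbit \<sigma> v" if "v \<in> V" for v
    proof (rule orbit_cong0[symmetric, OF that])
      show "\<sigma> \<in> V \<rightarrow> V" using s by (auto simp: permutes_in_image)
      fix y assume "y \<in> V"
      then show "\<sigma> y = ?\<rho> y" using False j m m' by (auto simp: st_def)
    qed
    show ?thesis
    proof (cases "j = m")
      case True
      have o: "orbit ?\<rho> m = {m}" "orbit ?\<rho> (- m) = {- m}"
        using sm True by (simp_all add: orbit_eq_singleton_iff)
      \<comment> \<open>Two mirror-image singletons form one positive cycle. The number of cycles
        and half the number of points both grow by one, so the exponent of q_+ does not
        change.\<close>
      have orbs: "orbs ?W ?\<rho> = orbs V \<sigma> \<union> {{m}, {- m}}"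
        unfolding orbs_def image_Un using orb o by auto
      have "{S \<in> orbs ?W ?\<rho>. bar S = S} = {S \<in> orbs V \<sigma>. bar S = S}"
        unfolding orbs using m(1) by (auto simp: set_eq_iff)
      moreover have "(\<lambda>S. S \<union> bar S) ` orbs ?W ?\<rho> = insert {m, - m} ((\<lambda>S. S \<union> bar S) ` orbs V \<sigma>)"
        unfolding orbs image_Un by (auto simp: bar_def)
      moreover have "{m, - m} \<notin> (\<lambda>S. S \<union> bar S) ` orbs V \<sigma>"
        by (rule nin)
      ultimately show ?thesis
        using True fin cW by (simp add: wt_def stw_def ctot_def cneg_def)
    next
      case ne: False
      then have jm: "j = - m" using False j by auto
      have \<rho>m: "?\<rho> m = - m" "?\<rho> (- m) = m"
        using sm jm m(1) by (auto simp: st_def)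
      have o: "orbit ?\<rho> m = {m, - m}"
      proof
        show "orbit ?\<rho> m \<subseteq> {m, - m}"
        proof
          fix y assume "y \<in> orbit ?\<rho> m"
          then show "y \<in> {m, - m}" by induction (use \<rho>m in auto)
        qed
        show "{m, - m} \<subseteq> orbit ?\<rho> m"
          using orbit.base[of ?\<rho> m] orbit.step[OF orbit.base, of ?\<rho> m] \<rho>m by auto
      qed
      have o': "orbit ?\<rho> (- m) = {m, - m}"
      proof -
        have "permutation ?\<rho>" using r W(1) permutation_permutes by blast
        then show ?thesis using o permutation_orbit_step[of ?\<rho> m] unfolding \<rho>m(1) by simp
      qed
      \<comment> \<open>The new orbit is its own mirror image, a negative cycle of length one: the
        exponent of q_+ is unchanged and that of q_- grows by one.\<close>
      have orbs: "orbs ?W ?\<rho> = insert {m, - m} (orbs V \<sigma>)"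
        unfolding orbs_def image_Un using orb o o' by auto
      have "{S \<in> orbs ?W ?\<rho>. bar S = S} = insert {m, - m} {S \<in> orbs V \<sigma>. bar S = S}"
        unfolding orbs by (auto simp: bar_def)
      moreover have "{m, - m} \<notin> {S \<in> orbs V \<sigma>. bar S = S}" using sub m by blast
      moreover have "(\<lambda>S. S \<union> bar S) ` orbs ?W ?\<rho> = insert {m, - m} ((\<lambda>S. S \<union> bar S) ` orbs V \<sigma>)"
        unfolding orbs by (auto simp: bar_def)
      moreover have "{m, - m} \<notin> (\<lambda>S. S \<union> bar S) ` orbs V \<sigma>"
        by (rule nin)
      ultimately show ?thesis
        using jm m(1) fin cW by (simp add: wt_def stw_def ctot_def cneg_def)
    qed
  qed
qed

text \<open>The positive and negative cycles together are the classes
  \<open>S \<union> bar S\<close>, so the two partition norms combine into one sum of length minus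
  one.\<close>

lemma phi_eq_wt:
  assumes "\<sigma> \<in> B_group n"
  shows "phi qp qm n \<sigma> = wt qp qm (pm n) \<sigma>"
proof -
  have bp: "bar_partition (pm n) (orbs (pm n) \<sigma>)"
    using bar_partition_orbs[OF pm_props] assms B_group_eq_sperm by blast
  let ?O = "orbs (pm n) \<sigma>" and ?Q = "(\<lambda>S. S \<union> bar S) ` orbs (pm n) \<sigma>"
  let ?P = "perm_pos_cycles n \<sigma>" and ?N = "perm_neg_cycles n \<sigma>"
  have N: "?N = {S \<in> ?O. bar S = S}"
    unfolding perm_neg_cycles_def orbs_def by auto
  have P: "?P = (\<lambda>S. S \<union> bar S) ` {S \<in> ?O. bar S \<noteq> S}"
  proof -
    have "?P = (\<lambda>S. S \<union> bar S) ` {S \<in> ?O. bar S \<inter> S = {}}"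
      unfolding perm_pos_cycles_def orbs_def by auto
    also have "{S \<in> ?O. bar S \<inter> S = {}} = {S \<in> ?O. bar S \<noteq> S}"
      using bar_partition_Int_bar[OF bp] by blast
    finally show ?thesis .
  qed
  have N': "?N = (\<lambda>S. S \<union> bar S) ` {S \<in> ?O. bar S = S}"
    unfolding N by force
  have un: "?P \<union> ?N = ?Q" unfolding P N' by blast
  \<comment> \<open>A class \<open>S \<union> bar S\<close> that is itself an orbit equals
    \<open>S\<close>, which forces \<open>bar S = S\<close>.\<close>
  have disj: "?P \<inter> ?N = {}"
  proof (rule ccontr)
    assume "?P \<inter> ?N \<noteq> {}"
    then obtain S where S: "S \<in> ?O" "bar S \<noteq> S" "S \<union> bar S \<in> ?O" unfolding P N by auto
    have "partition_on (pm n) ?O" "S \<noteq> {}"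
      using bp S by (auto simp: bar_partition_def partition_on_def)
    then have "S = S \<union> bar S" using partition_on_eqI[of "pm n" ?O S "S \<union> bar S"] S by blast
    then have "bar S \<subseteq> S" by blast
    moreover have "S \<subseteq> bar S" using \<open>bar S \<subseteq> S\<close> by (auto simp: subset_iff)
    ultimately have "bar S = S" by blast
    then show False using S by simp
  qed
  have fin: "finite ?P" "finite ?N" using un bar_partition_finite[OF bp] by (metis finite_Un finite_imageI)+
  have norm: "sum_mset (image_mset f (mset_set A)) - size (image_mset f (mset_set A)) = (\<Sum>C\<in>A. f C - 1)"
    if "finite A" "\<And>C. C \<in> A \<Longrightarrow> 1 \<le> f C" for A and f :: "int set \<Rightarrow> nat"
  proof -
    have "(\<Sum>C\<in>A. f C - 1) + (\<Sum>C\<in>A. 1) = (\<Sum>C\<in>A. f C)"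
      unfolding sum.distrib[symmetric] using that(2) by (intro sum.cong le_add_diff_inverse2) auto
    then show ?thesis by (simp add: sum_unfold_sum_mset[symmetric])
  qed
  have len: "\<And>C. C \<in> ?P \<union> ?N \<Longrightarrow> 1 \<le> card C div 2"
    unfolding un using bar_partition_length(3)[OF bp] by blast
  have "partition_norm (rho_pos n \<sigma>) + partition_norm (rho_neg n \<sigma>)
      = (\<Sum>C\<in>?P. card C div 2 - 1) + (\<Sum>C\<in>?N. card C div 2 - 1)"
    unfolding partition_norm_def rho_pos_def rho_neg_def
    using norm[OF fin(1)] norm[OF fin(2)] len by simp
  also have "\<dots> = (\<Sum>C\<in>?Q. card C div 2 - 1)"
    using sum.union_disjoint[OF fin disj, of "\<lambda>C. card C div 2 - 1"] un by simp
  also have "\<dots> = n - ctot ?O" using bar_partition_sum_norm(1)[OF bp] by simp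
  finally show ?thesis
    unfolding phi_def wt_def by (simp add: rho_neg_def cneg_def N)
qed

section \<open>Tensor powers\<close>


lemma tensor_comb_Cons: "tensor_comb n ((a, x) # L) = (\<lambda>z. a * simple_tensor n x z + tensor_comb n L z)"
  by (simp add: tensor_comb_def fun_eq_iff)

lemma tensor_comb_Nil: "tensor_comb n [] = (\<lambda>z. 0)"
  by (simp add: tensor_comb_def)

lemma tensor_power_simple: "simple_tensor n x \<in> tensor_power n"
proof -
  have "simple_tensor n x = tensor_comb n [(1, x)]" by (simp add: tensor_comb_Cons tensor_comb_Nil)
  then show ?thesis unfolding tensor_power_def by blast
qed

lemma tensor_power_zero: "(\<lambda>z. 0) \<in> tensor_power n"
  unfolding tensor_power_def tensor_comb_Nil[of n, symmetric] by (rule rangeI)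

lemma tensor_power_add:
  assumes "f \<in> tensor_power n" "g \<in> tensor_power n"
  shows "(\<lambda>z. f z + g z) \<in> tensor_power n"
proof -
  obtain L M where "f = tensor_comb n L" "g = tensor_comb n M"
    using assms unfolding tensor_power_def by blast
  then have "(\<lambda>z. f z + g z) = tensor_comb n (L @ M)"
    by (simp add: tensor_comb_def fun_eq_iff)
  then show ?thesis unfolding tensor_power_def by blast
qed

text \<open>Induction over a representing list. The scalar stays inside the premise on simple
  tensors, so additivity and the value at zero carry the induction.\<close>

lemma tensor_power_map:
  assumes "f \<in> tensor_power n"
    and F: "\<And>g h. F (\<lambda>z. g z + h z) = (\<lambda>z. F g z + F h z)" "F (\<lambda>z. 0) = (\<lambda>z. 0)"
    and s: "\<And>a x. F (\<lambda>z. a * simple_tensor n x z) \<in> tensor_power k"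
  shows "F f \<in> tensor_power k"
proof -
  have "F (tensor_comb n L) \<in> tensor_power k" for L
  proof (induction L)
    case Nil then show ?case by (simp add: tensor_comb_Nil F tensor_power_zero)
  next
    case (Cons p L)
    then show ?case by (cases p) (auto simp: tensor_comb_Cons F intro: tensor_power_add s)
  qed
  then show ?thesis using assms(1) unfolding tensor_power_def by blast
qed

lemma tensor_power_scale_simple: "(\<lambda>z. a * simple_tensor n x z) \<in> tensor_power n"
proof -
  have "(\<lambda>z. a * simple_tensor n x z) = tensor_comb n [(a, x)]"
    by (simp add: tensor_comb_Cons tensor_comb_Nil)
  then show ?thesis unfolding tensor_power_def by blast
qed

lemma tensor_power_scale:
  assumes "f \<in> tensor_power n"
  shows "(\<lambda>z. c * f z) \<in> tensor_power n"
  by (rule tensor_power_map[OF assms, of "\<lambda>f z. c * f z"])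
    (simp_all add: distrib_left mult.assoc[symmetric] tensor_power_scale_simple)

lemma tensor_power_diff:
  assumes "f \<in> tensor_power n" "g \<in> tensor_power n"
  shows "(\<lambda>z. f z - g z) \<in> tensor_power n"
  using tensor_power_add[OF assms(1) tensor_power_scale[OF assms(2), of "- 1"]] by simp

lemma tensor_power_sum:
  assumes "\<And>i. i \<in> I \<Longrightarrow> f i \<in> tensor_power n"
  shows "(\<lambda>z. \<Sum>i\<in>I. c i * f i z) \<in> tensor_power n"
  using assms
  by (induction I rule: infinite_finite_induct)
    (simp_all add: tensor_power_zero tensor_power_add tensor_power_scale)

text \<open>Reindexing the product of inner products moves the permutation from the arguments to the
  vectors, where it appears inverted.\<close>

lemma simple_tensor_perm:
  assumes "\<sigma> permutes pm n"
  shows "simple_tensor n x (z \<circ> \<sigma>) = simple_tensor n (x \<circ> inv \<sigma>) z"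
proof -
  have "(\<Prod>i\<in>pm n. cinner (z i) (x (inv \<sigma> i))) = (\<Prod>i\<in>pm n. cinner (z (\<sigma> i)) (x (inv \<sigma> (\<sigma> i))))"
    using prod.permute[OF assms, of "\<lambda>i. cinner (z i) (x (inv \<sigma> i))"] by (simp add: comp_def)
  then show ?thesis by (simp add: simple_tensor_def permutes_inverses[OF assms])
qed

lemma tensor_power_perm:
  assumes "f \<in> tensor_power n" "\<sigma> permutes pm n"
  shows "(\<lambda>z. f (z \<circ> \<sigma>)) \<in> tensor_power n"
  by (rule tensor_power_map[OF assms(1), of "\<lambda>f z. f (z \<circ> \<sigma>)"])
    (auto simp: simple_tensor_perm[OF assms(2)] intro: tensor_power_scale_simple)

section \<open>Contraction and creation of the two outer slots\<close>

definition plug :: "nat \<Rightarrow> 'a cplxn \<Rightarrow> 'a cplxn \<Rightarrow> (int \<Rightarrow> 'a cplxn) \<Rightarrow> int \<Rightarrow> 'a cplxn" where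
  "plug n a b z = z(- int (Suc n) := a, int (Suc n) := b)"

lemma simple_tensor_plug:
  "simple_tensor (Suc n) x (plug n a b z) =
     cinner a (x (- int (Suc n))) * cinner b (x (int (Suc n))) * simple_tensor n x z"
proof -
  have "pm (Suc n) = insert (- int (Suc n)) (insert (int (Suc n)) (pm n))"
    by (auto simp: pm_def)
  moreover have "- int (Suc n) \<notin> insert (int (Suc n)) (pm n)" "int (Suc n) \<notin> pm n" "finite (pm n)"
    by (auto simp: pm_def)
  moreover have "(\<Prod>i\<in>pm n. cinner (z i) (x i)) = (\<Prod>i\<in>pm n. cinner (plug n a b z i) (x i))"
    by (rule prod.cong) (auto simp: pm_def plug_def)
  ultimately show ?thesis by (simp add: simple_tensor_def plug_def)
qed

lemma tensor_power_plug:
  assumes "f \<in> tensor_power (Suc n)"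
  shows "(\<lambda>z. f (plug n a b z)) \<in> tensor_power n"
  by (rule tensor_power_map[OF assms, of "\<lambda>f z. f (plug n a b z)"])
    (auto simp: simple_tensor_plug mult.assoc[symmetric] intro!: tensor_power_scale_simple)

definition create :: "nat \<Rightarrow> 'a::real_inner cplxn \<Rightarrow> 'a cplxn \<Rightarrow> 'a tensor \<Rightarrow> 'a tensor" where
  "create n a b f = (\<lambda>z. cinner (z (- int (Suc n))) a * cinner (z (int (Suc n))) b * f z)"

lemma create_simple: "create n a b (simple_tensor n x) = simple_tensor (Suc n) (plug n a b x)"
  using creation_simple[of "\<lambda>k. simple_tensor n x" n x a b]
  by (simp add: creation_def create_def plug_def)

lemma create_comb:
  "create n a b (tensor_comb n L) = tensor_comb (Suc n) (map (\<lambda>(c, x). (c, plug n a b x)) L)"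
proof (induction L)
  case Nil then show ?case by (simp add: create_def tensor_comb_Nil)
next
  case (Cons p L)
  obtain c x where p: "p = (c, x)" by (cases p)
  have "create n a b (tensor_comb n (p # L)) =
      (\<lambda>z. c * create n a b (simple_tensor n x) z + create n a b (tensor_comb n L) z)"
    unfolding p tensor_comb_Cons by (simp add: create_def fun_eq_iff algebra_simps)
  then show ?case unfolding Cons create_simple by (simp add: p tensor_comb_Cons)
qed

lemma tensor_power_create: "f \<in> tensor_power n \<Longrightarrow> create n a b f \<in> tensor_power (Suc n)"
  unfolding tensor_power_def using create_comb by fastforce

lemma tensor_inner_eval:
  assumes "g \<in> tensor_power n"
  shows "tensor_inner n (tensor_comb n L) g = (\<Sum>(a, x)\<leftarrow>L. cnj a * g x)"
  using assms unfolding tensor_power_def by (auto simp: tensor_inner_comb comb_inner_eval)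

text \<open>The reproducing property: pairing with a simple tensor is evaluation of the form.
  Equality and vanishing of tensors are tested this way later.\<close>

lemma tensor_inner_simple:
  assumes "g \<in> tensor_power n"
  shows "tensor_inner n (simple_tensor n x) g = g x"
  using tensor_inner_eval[OF assms, of "[(1, x)]"] by (simp add: tensor_comb_Cons tensor_comb_Nil)

lemma tensor_inner_commute:
  assumes "f \<in> tensor_power n" "g \<in> tensor_power n"
  shows "tensor_inner n f g = cnj (tensor_inner n g f)"
  using assms comb_inner_commute unfolding tensor_power_def by (auto simp: tensor_inner_comb)

lemma tensor_inner_zero_right: "f \<in> tensor_power n \<Longrightarrow> tensor_inner n f (\<lambda>z. 0) = 0"
  using tensor_inner_eval[OF tensor_power_zero] unfolding tensor_power_def by (auto simp: case_prod_unfold)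

lemma tensor_inner_add_right:
  assumes "f \<in> tensor_power n" "g \<in> tensor_power n" "h \<in> tensor_power n"
  shows "tensor_inner n f (\<lambda>z. g z + h z) = tensor_inner n f g + tensor_inner n f h"
proof -
  obtain L where L: "f = tensor_comb n L" using assms(1) unfolding tensor_power_def by blast
  show ?thesis
    unfolding L tensor_inner_eval[OF assms(2)] tensor_inner_eval[OF assms(3)]
      tensor_inner_eval[OF tensor_power_add[OF assms(2,3)]]
    by (induction L) (auto simp: algebra_simps)
qed

lemma tensor_inner_scale_right:
  assumes "f \<in> tensor_power n" "g \<in> tensor_power n"
  shows "tensor_inner n f (\<lambda>z. c * g z) = c * tensor_inner n f g"
proof -
  obtain L where L: "f = tensor_comb n L" using assms(1) unfolding tensor_power_def by blast
  show ?thesis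
    unfolding L tensor_inner_eval[OF assms(2)] tensor_inner_eval[OF tensor_power_scale[OF assms(2)]]
    by (induction L) (auto simp: algebra_simps)
qed

lemma tensor_inner_sum_right:
  assumes "f \<in> tensor_power n" "\<And>i. i \<in> I \<Longrightarrow> g i \<in> tensor_power n"
  shows "tensor_inner n f (\<lambda>z. \<Sum>i\<in>I. c i * g i z) = (\<Sum>i\<in>I. c i * tensor_inner n f (g i))"
  using assms(2)
proof (induction I rule: infinite_finite_induct)
  case (insert i I)
  have "tensor_inner n f (\<lambda>z. c i * g i z + (\<Sum>i\<in>I. c i * g i z)) =
      c i * tensor_inner n f (g i) + tensor_inner n f (\<lambda>z. \<Sum>i\<in>I. c i * g i z)"
    using insert.prems assms(1)
    by (simp add: tensor_inner_add_right tensor_power_scale tensor_power_sum tensor_inner_scale_right)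
  then show ?case using insert by simp
qed (auto simp: tensor_inner_zero_right assms(1))

lemma tensor_inner_perm:
  assumes "f \<in> tensor_power n" "g \<in> tensor_power n" "\<sigma> permutes pm n"
  shows "tensor_inner n (\<lambda>z. f (z \<circ> \<sigma>)) g = tensor_inner n f (\<lambda>z. g (z \<circ> inv \<sigma>))"
proof -
  obtain L where L: "f = tensor_comb n L" using assms(1) unfolding tensor_power_def by blast
  have "(\<lambda>z. f (z \<circ> \<sigma>)) = tensor_comb n (map (\<lambda>(a, x). (a, x \<circ> inv \<sigma>)) L)"
    unfolding L tensor_comb_def case_prod_unfold simple_tensor_perm[OF assms(3)]
    by (simp add: comp_def)
  then show ?thesis
    unfolding L using tensor_inner_eval[OF assms(2)]
      tensor_inner_eval[OF tensor_power_perm[OF assms(2) permutes_inv[OF assms(3)]]]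
    by (simp add: case_prod_unfold comp_def)
qed

text \<open>On simple tensors both sides evaluate \<open>g\<close> with \<open>a\<close> and
  \<open>b\<close> plugged into the outer slots, so creation and contraction are adjoint for the
  usual inner product.\<close>

lemma tensor_inner_create:
  assumes "f \<in> tensor_power n" "g \<in> tensor_power (Suc n)"
  shows "tensor_inner (Suc n) (create n a b f) g = tensor_inner n f (\<lambda>z. g (plug n a b z))"
proof -
  obtain L where L: "f = tensor_comb n L" using assms(1) unfolding tensor_power_def by blast
  show ?thesis
    unfolding L create_comb tensor_inner_eval[OF assms(2)] tensor_inner_eval[OF tensor_power_plug[OF assms(2)]]
    by (simp add: case_prod_unfold comp_def)
qed

text \<open>Projecting along one vector \<open>v0\<close> leaves fewer vectors, so Gram-Schmidt
  terminates. The system \<open>e\<close> only has to satisfy Parseval's identity on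
  \<open>S\<close>; it replaces an orthonormal basis of the span.\<close>

lemma inner_parseval_finite:
  fixes S :: "'a::real_inner set"
  assumes "finite S"
  shows "\<exists>(d::nat) e. \<forall>v\<in>S. \<forall>w\<in>S. v \<bullet> w = (\<Sum>k<d. (e k \<bullet> v) * (e k \<bullet> w))"
  using assms
proof (induction "card S" arbitrary: S rule: less_induct)
  case less
  show ?case
  proof (cases "S \<subseteq> {0}")
    case True
    then show ?thesis by (intro exI[of _ 0]) auto
  next
    case False
    then obtain v0 where v0: "v0 \<in> S" "v0 \<noteq> 0" by blast
    define p where "p w = w - ((w \<bullet> v0) / (v0 \<bullet> v0)) *\<^sub>R v0" for w
    have "card (p ` (S - {v0})) \<le> card (S - {v0})" using less.prems by (intro card_image_le) auto
    also have "\<dots> < card S" using v0 less.prems by (intro card_Diff1_less)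
    finally obtain d :: nat and e
      where e: "\<forall>v\<in>p ` (S - {v0}). \<forall>w\<in>p ` (S - {v0}). v \<bullet> w = (\<Sum>k<d. (e k \<bullet> v) * (e k \<bullet> w))"
      using less.hyps[of "p ` (S - {v0})"] less.prems by blast
    have vv: "v0 \<bullet> v0 \<noteq> 0" using v0 by simp
    have p0: "p v0 = 0" using vv by (simp add: p_def)
    have adj: "e k \<bullet> p v = p (e k) \<bullet> v" for k v
      by (simp add: p_def inner_diff_left inner_diff_right inner_commute)
    have pp: "v \<bullet> w = p v \<bullet> p w + (v \<bullet> v0) * (w \<bullet> v0) / (v0 \<bullet> v0)" for v w
      using vv by (simp add: p_def inner_diff_left inner_diff_right inner_commute field_simps)
    have e': "p v \<bullet> p w = (\<Sum>k<d. (e k \<bullet> p v) * (e k \<bullet> p w))" if "v \<in> S" "w \<in> S" for v w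
      using that e p0 by (cases "v = v0"; cases "w = v0") auto
    \<comment> \<open>The projection \<open>p\<close> is self-adjoint, so pairing \<open>p v\<close>
      with \<open>e k\<close> is pairing \<open>v\<close> with \<open>p (e k)\<close>. The
      additional vector is the normalised \<open>v0\<close>.\<close>
    define e1 where "e1 k = (if k < d then p (e k) else (1 / norm v0) *\<^sub>R v0)" for k
    have "v \<bullet> w = (\<Sum>k<Suc d. (e1 k \<bullet> v) * (e1 k \<bullet> w))" if "v \<in> S" "w \<in> S" for v w
    proof -
      have "(e1 d \<bullet> v) * (e1 d \<bullet> w) = (v \<bullet> v0) * (w \<bullet> v0) / (v0 \<bullet> v0)"
        by (simp add: e1_def inner_commute power2_norm_eq_inner[symmetric] power2_eq_square)
      moreover have "(\<Sum>k<d. (e1 k \<bullet> v) * (e1 k \<bullet> w)) = p v \<bullet> p w"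
        unfolding e'[OF that] by (rule sum.cong) (auto simp: e1_def adj)
      ultimately show ?thesis using pp[of v w] by simp
    qed
    then show ?thesis by blast
  qed
qed

lemma sum_nonneg_Reals:
  "(\<And>i. i \<in> I \<Longrightarrow> f i \<in> \<real>\<^sub>\<ge>\<^sub>0) \<Longrightarrow> sum f I \<in> (\<real>\<^sub>\<ge>\<^sub>0 :: complex set)"
  by (induction I rule: infinite_finite_induct) auto

text \<open>In coordinates with respect to a Parseval system the form becomes a sum over
  multi-indices \<kappa>, and each summand is the squared modulus of the coordinate
  \<open>T L \<kappa>\<close>.\<close>

lemma tensor_inner_nonneg:
  assumes "f \<in> tensor_power n"
  shows "tensor_inner n f f \<in> \<real>\<^sub>\<ge>\<^sub>0"
proof -
  obtain L where L: "f = tensor_comb n L" using assms(1) unfolding tensor_power_def by blast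
  \<comment> \<open>All real and imaginary parts that occur in \<open>L\<close>, so that one finite
    system expresses every inner product between them.\<close>
  define S where "S = (\<Union>(a, x)\<in>set L. (fst \<circ> x) ` pm n \<union> (snd \<circ> x) ` pm n)"
  have "finite S" unfolding S_def by auto
  from inner_parseval_finite[OF this] obtain d :: nat and e
    where e: "\<And>v w. v \<in> S \<Longrightarrow> w \<in> S \<Longrightarrow> v \<bullet> w = (\<Sum>k<d. (e k \<bullet> v) * (e k \<bullet> w))" by blast
  define ec where "ec k u = Complex (e k \<bullet> fst u) (e k \<bullet> snd u)" for k u
  have ci: "cinner u v = (\<Sum>k<d. cnj (ec k u) * ec k v)"
    if "fst u \<in> S" "snd u \<in> S" "fst v \<in> S" "snd v \<in> S" for u v
    using that
    by (simp add: cinner_def complex_eq_iff e ec_def sum.distrib[symmetric] sum_subtractf[symmetric]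
        algebra_simps)
  define K where "K = PiE (pm n) (\<lambda>_. {..<d})"
  define T where "T M \<kappa> = (\<Sum>(a, x)\<leftarrow>M. a * (\<Prod>i\<in>pm n. ec (\<kappa> i) (x i)))" for M \<kappa>
  have st: "simple_tensor n y x = (\<Sum>\<kappa>\<in>K. cnj (\<Prod>i\<in>pm n. ec (\<kappa> i) (x i)) * (\<Prod>i\<in>pm n. ec (\<kappa> i) (y i)))"
    if "\<And>i. i \<in> pm n \<Longrightarrow> fst (x i) \<in> S \<and> snd (x i) \<in> S \<and> fst (y i) \<in> S \<and> snd (y i) \<in> S" for x y
  proof -
    have "simple_tensor n y x = (\<Prod>i\<in>pm n. \<Sum>k<d. cnj (ec k (x i)) * ec k (y i))"
      unfolding simple_tensor_def using ci that by (intro prod.cong) auto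
    also have "\<dots> = (\<Sum>\<kappa>\<in>K. \<Prod>i\<in>pm n. cnj (ec (\<kappa> i) (x i)) * ec (\<kappa> i) (y i))"
      unfolding K_def by (rule prod_sum_PiE) auto
    finally show ?thesis by (simp add: prod.distrib)
  qed
  have inS: "fst (x i) \<in> S \<and> snd (x i) \<in> S" if "(a, x) \<in> set L" "i \<in> pm n" for a x i
    using that unfolding S_def by force
  have comb: "tensor_comb n M x = (\<Sum>\<kappa>\<in>K. cnj (\<Prod>i\<in>pm n. ec (\<kappa> i) (x i)) * T M \<kappa>)"
    if "set M \<subseteq> set L" "\<And>i. i \<in> pm n \<Longrightarrow> fst (x i) \<in> S \<and> snd (x i) \<in> S" for M x
    using that(1)
  proof (induction M)
    case Nil then show ?case by (simp add: tensor_comb_Nil T_def)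
  next
    case (Cons p M)
    obtain a y where p: "p = (a, y)" by (cases p)
    have "simple_tensor n y x = (\<Sum>\<kappa>\<in>K. cnj (\<Prod>i\<in>pm n. ec (\<kappa> i) (x i)) * (\<Prod>i\<in>pm n. ec (\<kappa> i) (y i)))"
      using st[of x y] inS[of a y] Cons.prems p that(2) by auto
    then show ?case using Cons
      by (simp add: p tensor_comb_Cons T_def sum.distrib[symmetric] sum_distrib_left algebra_simps)
  qed
  have "(\<Sum>(a, x)\<leftarrow>M. cnj a * tensor_comb n L x) = (\<Sum>\<kappa>\<in>K. cnj (T M \<kappa>) * T L \<kappa>)"
    if "set M \<subseteq> set L" for M
    using that
  proof (induction M)
    case Nil then show ?case by (simp add: T_def)
  next
    case (Cons p M)
    obtain a y where p: "p = (a, y)" by (cases p)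
    have "tensor_comb n L y = (\<Sum>\<kappa>\<in>K. cnj (\<Prod>i\<in>pm n. ec (\<kappa> i) (y i)) * T L \<kappa>)"
      using comb[of L y] inS[of a y] Cons.prems p by auto
    then have "cnj a * tensor_comb n L y = (\<Sum>\<kappa>\<in>K. cnj (a * (\<Prod>i\<in>pm n. ec (\<kappa> i) (y i))) * T L \<kappa>)"
      by (simp add: sum_distrib_left mult.assoc)
    moreover have "T (p # M) \<kappa> = a * (\<Prod>i\<in>pm n. ec (\<kappa> i) (y i)) + T M \<kappa>" for \<kappa>
      by (simp add: p T_def)
    ultimately show ?case using Cons
      by (simp add: p sum.distrib[symmetric] distrib_right)
  qed
  then have "tensor_inner n f f = (\<Sum>\<kappa>\<in>K. cnj (T L \<kappa>) * T L \<kappa>)"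
    using tensor_inner_eval[OF assms, of L] L by simp
  moreover have "cnj w * w \<in> \<real>\<^sub>\<ge>\<^sub>0" for w :: complex
    by (simp add: complex_nonneg_Reals_iff)
  ultimately show ?thesis by (simp add: sum_nonneg_Reals)
qed

section \<open>Positivity of the weight\<close>


text \<open>The index \<open>j\<close> is recovered as the preimage of \<open>m\<close>, and
  exchanging \<open>j\<close> with \<open>m\<close> beforehand makes \<open>m\<close> a fixed point.
  This is the coset decomposition with respect to the stabiliser of \<open>m\<close>.\<close>

lemma sperm_insert_bij:
  assumes V: "0 \<notin> V" "bar V = V" and m: "m \<noteq> 0" "m \<notin> V"
  shows "bij_betw (\<lambda>(\<sigma>, j). \<sigma> \<circ> st j m) (sperm V \<times> (V \<union> {m, - m})) (sperm (V \<union> {m, - m}))"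
proof -
  let ?W = "V \<union> {m, - m}"
  have neg: "- v \<in> V \<longleftrightarrow> v \<in> V" for v using V(2) by (metis in_bar_iff)
  have W1: "0 \<notin> ?W" using V(1) m(1) by simp
  have W2: "bar ?W = ?W" unfolding bar_Un V(2) by (auto simp: bar_def)
  note W = W1 W2
  have nz: "j \<noteq> 0" if "j \<in> ?W" for j using that W(1) by blast
  have fixm: "\<sigma> m = m" "\<sigma> (- m) = - m" if "\<sigma> \<in> sperm V" for \<sigma>
  proof -
    show "\<sigma> m = m" using that m(2) by (auto simp: sperm_def permutes_not_in)
    then show "\<sigma> (- m) = - m" using that by (simp add: sperm_def)
  qed
  have stj: "st j m j = m" "st j m m = j" for j by (auto simp: st_def)
  show ?thesis
  proof (rule bij_betw_byWitness[where f' = "\<lambda>\<rho>. (\<rho> \<circ> st (inv \<rho> m) m, inv \<rho> m)"])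
    show "\<forall>p\<in>sperm V \<times> ?W. (\<lambda>\<rho>. (\<rho> \<circ> st (inv \<rho> m) m, inv \<rho> m)) ((\<lambda>(\<sigma>, j). \<sigma> \<circ> st j m) p) = p"
    proof
      fix p assume "p \<in> sperm V \<times> ?W"
      then obtain \<sigma> j where p: "p = (\<sigma>, j)" and s: "\<sigma> \<in> sperm V" and j: "j \<in> ?W" by blast
      have "\<sigma> \<circ> st j m \<in> sperm ?W"
        using sperm_comp[OF sperm_mono[OF s, of ?W] st_sperm[of j ?W m]] W j by auto
      then have inj: "(\<sigma> \<circ> st j m) permutes ?W" by (simp add: sperm_def)
      have "(\<sigma> \<circ> st j m) j = m" using fixm[OF s] stj by simp
      then have i: "inv (\<sigma> \<circ> st j m) m = j" using permutes_inv_eq[OF inj] by simp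
      have "\<sigma> \<circ> st j m \<circ> st j m = \<sigma>" using nz[OF j] m(1) by (simp add: fun_eq_iff st_invol)
      then show "(\<lambda>\<rho>. (\<rho> \<circ> st (inv \<rho> m) m, inv \<rho> m)) ((\<lambda>(\<sigma>, j). \<sigma> \<circ> st j m) p) = p"
        by (simp add: p i)
    qed
    have inv_in: "\<rho> \<circ> st (inv \<rho> m) m \<in> sperm V" "inv \<rho> m \<in> ?W" if r: "\<rho> \<in> sperm ?W" for \<rho>
    proof -
      have p: "\<rho> permutes ?W" using r by (simp add: sperm_def)
      show j: "inv \<rho> m \<in> ?W" using permutes_in_image[OF permutes_inv[OF p], of m] by simp
      let ?s = "\<rho> \<circ> st (inv \<rho> m) m"
      have s: "?s \<in> sperm ?W" using sperm_comp[OF r st_sperm[of "inv \<rho> m" ?W m]] W j by auto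
      have m1: "?s m = m" using stj permutes_inverses(1)[OF p] by simp
      then have m2: "?s (- m) = - m" using s by (simp add: sperm_def)
      have "?s permutes V"
      proof (rule permutes_superset)
        show "?s permutes ?W" using s by (simp add: sperm_def)
        show "?s x = x" if "x \<in> ?W - V" for x using that m1 m2 by blast
      qed
      then show "?s \<in> sperm V" using s by (simp add: sperm_def)
    qed
    show "\<forall>\<rho>\<in>sperm ?W. (\<lambda>(\<sigma>, j). \<sigma> \<circ> st j m) (\<rho> \<circ> st (inv \<rho> m) m, inv \<rho> m) = \<rho>"
      using nz inv_in(2) m(1) by (auto simp: fun_eq_iff st_invol)
    show "(\<lambda>(\<sigma>, j). \<sigma> \<circ> st j m) ` (sperm V \<times> ?W) \<subseteq> sperm ?W"
    proof clarify
      fix \<sigma> j assume s: "\<sigma> \<in> sperm V" and j: "j \<in> ?W"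
      show "\<sigma> \<circ> st j m \<in> sperm ?W"
        using sperm_comp[OF sperm_mono[OF s, of ?W] st_sperm[of j ?W m]] W j by auto
    qed
    show "(\<lambda>\<rho>. (\<rho> \<circ> st (inv \<rho> m) m, inv \<rho> m)) ` sperm ?W \<subseteq> sperm V \<times> ?W"
      using inv_in by auto
  qed
qed

text \<open>Averaging against a real character is a projection up to a positive factor: the average
  \<open>g\<close> is invariant up to \<zeta>, hence <g, g> = c <f, g> with c the sum of the squares
  of \<zeta>.\<close>

lemma sum_tensor_subgroup_nonneg:
  fixes f :: "'a::real_inner tensor"
  assumes f: "f \<in> tensor_power n"
    and H: "H \<subseteq> sperm (pm n)" "id \<in> H" "\<And>\<rho> \<tau>. \<rho> \<in> H \<Longrightarrow> \<tau> \<in> H \<Longrightarrow> \<rho> \<circ> \<tau> \<in> H" "\<And>\<rho>. \<rho> \<in> H \<Longrightarrow> inv \<rho> \<in> H"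
    and \<zeta>: "\<And>\<rho> \<tau>. \<rho> \<in> H \<Longrightarrow> \<tau> \<in> H \<Longrightarrow> \<zeta> (\<rho> \<circ> \<tau>) = \<zeta> \<rho> * \<zeta> \<tau>" "\<zeta> id = (1::real)"
  shows "(\<Sum>\<rho>\<in>H. complex_of_real (\<zeta> \<rho>) * tensor_inner n f (\<lambda>z. f (z \<circ> \<rho>))) \<in> \<real>\<^sub>\<ge>\<^sub>0"
proof -
  have p: "\<rho> permutes pm n" if "\<rho> \<in> H" for \<rho> using that H(1) by (auto simp: sperm_def)
  have fin: "finite H" using H(1) finite_sperm[of "pm n"] finite_subset by simp
  define g where "g z = (\<Sum>\<rho>\<in>H. complex_of_real (\<zeta> \<rho>) * f (z \<circ> \<rho>))" for z
  have fp: "(\<lambda>z. f (z \<circ> \<rho>)) \<in> tensor_power n" if "\<rho> \<in> H" for \<rho>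
    using tensor_power_perm[OF f p[OF that]] .
  have g: "g \<in> tensor_power n" unfolding g_def by (intro tensor_power_sum fp)
  let ?X = "\<Sum>\<rho>\<in>H. complex_of_real (\<zeta> \<rho>) * tensor_inner n f (\<lambda>z. f (z \<circ> \<rho>))"
  have X: "tensor_inner n f g = ?X"
    unfolding g_def by (intro tensor_inner_sum_right f fp)
  have bij: "bij_betw (\<lambda>\<tau>. \<rho> \<circ> \<tau>) H H" if "\<rho> \<in> H" for \<rho>
    by (rule bij_betw_byWitness[where f' = "\<lambda>\<tau>. inv \<rho> \<circ> \<tau>"])
      (use that H p permutes_inv_o[OF p[OF that]] in \<open>auto simp: o_assoc\<close>)
  have inv\<zeta>: "\<zeta> (inv \<rho>) * \<zeta> \<rho> = 1" if "\<rho> \<in> H" for \<rho>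
    using \<zeta>(1)[OF H(4)[OF that] that] \<zeta>(2) permutes_inv_o(2)[OF p[OF that]] by simp
  have gp: "g (z \<circ> inv \<rho>) = \<zeta> \<rho> * g z" if r: "\<rho> \<in> H" for \<rho> z
  proof -
    have "g z = (\<Sum>\<tau>\<in>H. complex_of_real (\<zeta> (inv \<rho> \<circ> \<tau>)) * f (z \<circ> (inv \<rho> \<circ> \<tau>)))"
      unfolding g_def using sum.reindex_bij_betw[OF bij[OF H(4)[OF r]], symmetric] .
    also have "\<dots> = (\<Sum>\<tau>\<in>H. complex_of_real (\<zeta> (inv \<rho>)) * (\<zeta> \<tau> * f (z \<circ> inv \<rho> \<circ> \<tau>)))"
      using \<zeta>(1)[OF H(4)[OF r]] by (intro sum.cong) (auto simp: o_assoc)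
    also have "\<dots> = \<zeta> (inv \<rho>) * g (z \<circ> inv \<rho>)"
      unfolding g_def sum_distrib_left ..
    finally have "\<zeta> \<rho> * g z = complex_of_real (\<zeta> (inv \<rho>) * \<zeta> \<rho>) * g (z \<circ> inv \<rho>)" by simp
    then show ?thesis using inv\<zeta>[OF r] by simp
  qed
  have gg: "tensor_inner n (\<lambda>z. f (z \<circ> \<rho>)) g = \<zeta> \<rho> * tensor_inner n f g" if "\<rho> \<in> H" for \<rho>
    unfolding tensor_inner_perm[OF f g p[OF that]] gp[OF that]
    by (rule tensor_inner_scale_right[OF f g])
  have "tensor_inner n g f' = (\<Sum>\<rho>\<in>H. complex_of_real (\<zeta> \<rho>) * tensor_inner n (\<lambda>z. f (z \<circ> \<rho>)) f')"
    if f': "f' \<in> tensor_power n" for f'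
  proof -
    have "tensor_inner n g f' = cnj (tensor_inner n f' g)" by (rule tensor_inner_commute[OF g f'])
    also have "tensor_inner n f' g = (\<Sum>\<rho>\<in>H. complex_of_real (\<zeta> \<rho>) * tensor_inner n f' (\<lambda>z. f (z \<circ> \<rho>)))"
      unfolding g_def by (intro tensor_inner_sum_right f' fp)
    finally have "tensor_inner n g f' = (\<Sum>\<rho>\<in>H. complex_of_real (\<zeta> \<rho>) * cnj (tensor_inner n f' (\<lambda>z. f (z \<circ> \<rho>))))"
      by simp
    then show ?thesis using tensor_inner_commute[OF fp f'] by simp
  qed
  from this[OF g] have "tensor_inner n g g = (\<Sum>\<rho>\<in>H. complex_of_real (\<zeta> \<rho> * \<zeta> \<rho>) * ?X)"
    using gg X by (simp add: mult.assoc)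
  also have "\<dots> = complex_of_real (\<Sum>\<rho>\<in>H. \<zeta> \<rho> * \<zeta> \<rho>) * ?X"
    by (simp add: sum_distrib_right)
  finally have eq: "tensor_inner n g g = complex_of_real (\<Sum>\<rho>\<in>H. \<zeta> \<rho> * \<zeta> \<rho>) * ?X" .
  \<comment> \<open>The identity alone makes the sum of squares positive, so it can be divided
    out.\<close>
  have "\<zeta> id * \<zeta> id \<le> (\<Sum>\<rho>\<in>H. \<zeta> \<rho> * \<zeta> \<rho>)"
    by (rule member_le_sum[OF H(2) _ fin]) auto
  then obtain c where c: "c = (\<Sum>\<rho>\<in>H. \<zeta> \<rho> * \<zeta> \<rho>)" "0 < c" using \<zeta>(2) by simp
  have "?X = complex_of_real (1 / c) * tensor_inner n g g"
    unfolding eq c(1)[symmetric] using c(2) by simp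
  then show ?thesis
    using c(2) tensor_inner_nonneg[OF g] 
    by (simp only: nonneg_Reals_mult_I nonneg_Reals_of_real_iff divide_nonneg_pos zero_le_one)
qed

section \<open>Characters of the stabilisers of colourings\<close>

definition absp :: "nat \<Rightarrow> (int \<Rightarrow> int) \<Rightarrow> int \<Rightarrow> int" where
  "absp n \<rho> i = (if i \<in> {1..int n} then \<bar>\<rho> i\<bar> else i)"

lemma sperm_pm_abs:
  assumes "\<rho> \<in> sperm (pm n)" "i \<in> {1..int n}"
  shows "\<bar>\<rho> i\<bar> \<in> {1..int n}"
proof -
  have "i \<in> pm n" using assms(2) by (simp add: pm_def)
  then have "\<rho> i \<in> pm n" using assms(1) by (auto simp: sperm_def permutes_in_image)
  then show ?thesis by (auto simp: pm_def)
qed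

lemma sperm_abs_abs: "\<rho> \<in> sperm V \<Longrightarrow> \<bar>\<rho> \<bar>i\<bar>\<bar> = \<bar>\<rho> i\<bar>"
  by (cases "i \<ge> 0") (auto simp: sperm_def abs_if)

lemma absp_comp:
  assumes "\<rho> \<in> sperm (pm n)" "\<tau> \<in> sperm (pm n)"
  shows "absp n (\<rho> \<circ> \<tau>) = absp n \<rho> \<circ> absp n \<tau>"
  using sperm_pm_abs[OF assms(2)] sperm_abs_abs[OF assms(1)] by (auto simp: absp_def fun_eq_iff)

lemma absp_permutes:
  assumes "\<rho> \<in> sperm (pm n)"
  shows "absp n \<rho> permutes {1..int n}"
proof (rule bij_imp_permutes)
  have i: "inv \<rho> \<in> sperm (pm n)" using assms by (rule sperm_inv)
  have p: "\<rho> permutes pm n" using assms by (simp add: sperm_def)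
  have id: "absp n id = id" by (auto simp: absp_def fun_eq_iff)
  have into: "absp n \<tau> v \<in> {1..int n}" if "\<tau> \<in> sperm (pm n)" "v \<in> {1..int n}" for \<tau> v
    using sperm_pm_abs[OF that] that(2) by (simp add: absp_def)
  have 1: "absp n \<rho> (absp n (inv \<rho>) v) = v" "absp n (inv \<rho>) (absp n \<rho> v) = v" for v
    using absp_comp[OF assms i] absp_comp[OF i assms] permutes_inv_o[OF p] id
    by (metis comp_apply id_apply)+
  show "bij_betw (absp n \<rho>) {1..int n} {1..int n}"
    by (rule bij_betw_byWitness[where f' = "absp n (inv \<rho>)"])
      (use 1 into[OF assms] into[OF i] in blast)+
qed (auto simp: absp_def)

lemma sperm_nonzero: "\<rho> \<in> sperm (pm n) \<Longrightarrow> i \<in> {1..int n} \<Longrightarrow> \<rho> i \<noteq> 0"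
  using sperm_pm_abs by force

definition flip_char :: "nat \<Rightarrow> (int \<Rightarrow> real) \<Rightarrow> (int \<Rightarrow> int) \<Rightarrow> (int \<Rightarrow> int) \<Rightarrow> real" where
  "flip_char n s d \<rho> = (\<Prod>i\<in>{1..int n}. if \<rho> i < 0 then s (d i) else 1)"

definition stab :: "nat \<Rightarrow> (int \<Rightarrow> int) \<Rightarrow> (int \<Rightarrow> int) set" where
  "stab n d = {\<rho> \<in> sperm (pm n). \<forall>i\<in>{1..int n}. d \<bar>\<rho> i\<bar> = d i}"

text \<open>\<open>absp\<close> is the projection of the hyperoctahedral group onto the symmetric
  group of absolute values; its sign is the character responsible for negative q_+.\<close>

definition sign_char :: "real \<Rightarrow> nat \<Rightarrow> (int \<Rightarrow> int) \<Rightarrow> real" where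
  "sign_char \<epsilon> n \<rho> = (if \<epsilon> = 1 then 1 else of_int (sign (absp n \<rho>)))"

lemma stab_comp:
  assumes "\<rho> \<in> stab n d" "\<tau> \<in> stab n d"
  shows "\<rho> \<circ> \<tau> \<in> stab n d"
proof -
  have s: "\<rho> \<in> sperm (pm n)" "\<tau> \<in> sperm (pm n)" using assms by (auto simp: stab_def)
  have "d \<bar>\<rho> (\<tau> i)\<bar> = d i" if i: "i \<in> {1..int n}" for i
  proof -
    have "d \<bar>\<rho> (\<tau> i)\<bar> = d \<bar>\<rho> \<bar>\<tau> i\<bar>\<bar>" using sperm_abs_abs[OF s(1)] by simp
    also have "\<dots> = d \<bar>\<tau> i\<bar>" using assms(1) sperm_pm_abs[OF s(2) i] by (auto simp: stab_def)
    finally show ?thesis using assms(2) i by (auto simp: stab_def)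
  qed
  then show ?thesis using sperm_comp[OF s] by (simp add: stab_def)
qed

lemma stab_inv:
  assumes "\<rho> \<in> stab n d"
  shows "inv \<rho> \<in> stab n d"
proof -
  have s: "\<rho> \<in> sperm (pm n)" "\<rho> permutes pm n" using assms by (auto simp: stab_def sperm_def)
  have i': "inv \<rho> \<in> sperm (pm n)" using sperm_inv[OF s(1)] .
  have "d \<bar>inv \<rho> i\<bar> = d i" if i: "i \<in> {1..int n}" for i
  proof -
    have "d \<bar>\<rho> \<bar>inv \<rho> i\<bar>\<bar> = d \<bar>inv \<rho> i\<bar>" using assms sperm_pm_abs[OF i' i] by (auto simp: stab_def)
    moreover have "\<bar>\<rho> \<bar>inv \<rho> i\<bar>\<bar> = i"
      using sperm_abs_abs[OF s(1)] permutes_inverses(1)[OF s(2)] i by simp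
    ultimately show ?thesis by simp
  qed
  then show ?thesis using i' by (simp add: stab_def)
qed

lemma stab_id: "id \<in> stab n d"
  by (auto simp: stab_def sperm_def permutes_id)

text \<open>The sign change of a composition at \<open>i\<close> is that of \<tau> at
  \<open>i\<close> times that of \<rho> at the absolute value of \<tau> i. The second factor is
  reindexed by \<open>absp n \<tau>\<close>, and both refer to the same colour because \<tau>
  stabilises \<open>d\<close>.\<close>

lemma flip_char_comp:
  assumes "\<rho> \<in> stab n d" "\<tau> \<in> stab n d" and s: "\<And>k. s k * s k = 1"
  shows "flip_char n s d (\<rho> \<circ> \<tau>) = flip_char n s d \<rho> * flip_char n s d \<tau>"
proof -
  have sp: "\<rho> \<in> sperm (pm n)" "\<tau> \<in> sperm (pm n)" using assms by (auto simp: stab_def)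
  let ?g = "\<lambda>i. if \<rho> i < 0 then s (d i) else 1"
  have "flip_char n s d \<rho> = (\<Prod>i\<in>{1..int n}. ?g (absp n \<tau> i))"
    unfolding flip_char_def using prod.permute[OF absp_permutes[OF sp(2)], of ?g] by (simp add: comp_def)
  then have "flip_char n s d \<rho> * flip_char n s d \<tau> =
      (\<Prod>i\<in>{1..int n}. ?g (absp n \<tau> i) * (if \<tau> i < 0 then s (d i) else 1))"
    unfolding flip_char_def by (simp add: prod.distrib)
  also have "\<dots> = flip_char n s d (\<rho> \<circ> \<tau>)"
    unfolding flip_char_def
  proof (rule prod.cong[OF refl])
    fix i assume i: "i \<in> {1..int n}"
    have a: "absp n \<tau> i = \<bar>\<tau> i\<bar>" "d \<bar>\<tau> i\<bar> = d i" using i assms(2) by (auto simp: absp_def stab_def)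
    have nz: "\<rho> \<bar>\<tau> i\<bar> \<noteq> 0" using sperm_nonzero[OF sp(1) sperm_pm_abs[OF sp(2) i]] .
    have neg: "\<rho> (- \<tau> i) = - \<rho> (\<tau> i)" using sp(1) by (simp add: sperm_def)
    show "?g (absp n \<tau> i) * (if \<tau> i < 0 then s (d i) else 1) = (if (\<rho> \<circ> \<tau>) i < 0 then s (d i) else 1)"
      unfolding a using nz neg s a(2) by (auto simp: abs_if)
  qed
  finally show ?thesis by simp
qed

lemma sign_char_comp:
  assumes "\<rho> \<in> sperm (pm n)" "\<tau> \<in> sperm (pm n)"
  shows "sign_char \<epsilon> n (\<rho> \<circ> \<tau>) = sign_char \<epsilon> n \<rho> * sign_char \<epsilon> n \<tau>"
proof -
  have "permutation (absp n \<rho>)" "permutation (absp n \<tau>)"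
    using absp_permutes assms permutation_permutes by blast+
  then show ?thesis unfolding sign_char_def absp_comp[OF assms] by (simp add: sign_compose)
qed

lemma char_id: "flip_char n s d id = 1" "sign_char \<epsilon> n id = 1"
proof -
  have "absp n id = id" by (auto simp: absp_def fun_eq_iff)
  then show "flip_char n s d id = 1" "sign_char \<epsilon> n id = 1"
    by (auto simp: flip_char_def sign_char_def intro!: prod.neutral)
qed

text \<open>
  Points are coloured independently, \<open>m\<close> receiving a colour \<open>k \<in> C m\<close> with weight \<open>w m k\<close>, and
  colours carry signs \<open>s k\<close>. The last assumption says that \<open>m\<close> gets the colour of a smaller point
  with weight $|q_+|$.
\<close>

locale colouring =
  fixes C :: "int \<Rightarrow> int set" and w :: "int \<Rightarrow> int \<Rightarrow> real" and s :: "int \<Rightarrow> real" and \<epsilon> qp qm :: real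
  assumes fin: "finite (C m)" and w_nonneg: "k \<in> C m \<Longrightarrow> 0 \<le> w m k"
    and s_sq: "s k * s k = 1" and \<epsilon>: "\<epsilon> \<in> {1, - 1}"
    and w1: "1 \<le> m \<Longrightarrow> (\<Sum>k\<in>C m. w m k) = 1"
    and wqm: "1 \<le> m \<Longrightarrow> (\<Sum>k\<in>C m. w m k * s k) = qm"
    and wqp: "1 \<le> i \<Longrightarrow> i < m \<Longrightarrow> k \<in> C i \<Longrightarrow> \<epsilon> * (if k \<in> C m then w m k else 0) = qp"
begin

definition colours :: "nat \<Rightarrow> (int \<Rightarrow> int) set" where
  "colours n = PiE {1..int n} C"

definition cw :: "nat \<Rightarrow> (int \<Rightarrow> int) \<Rightarrow> real" where
  "cw n d = (\<Prod>i\<in>{1..int n}. w i (d i))"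

text \<open>As a function of \<rho> this is the character \<open>flip_char\<close> of the stabiliser
  of \<open>d\<close>, extended by zero and scaled by the weight of the colouring.\<close>

definition cterm :: "nat \<Rightarrow> (int \<Rightarrow> int) \<Rightarrow> (int \<Rightarrow> int) \<Rightarrow> real" where
  "cterm n \<rho> d = (if \<forall>i\<in>{1..int n}. d \<bar>\<rho> i\<bar> = d i then cw n d * flip_char n s d \<rho> else 0)"

lemma sum_colours_Suc:
  "(\<Sum>d\<in>colours (Suc n). F d) = (\<Sum>d\<in>colours n. \<Sum>k\<in>C (int (Suc n)). F (d(int (Suc n) := k)))"
proof -
  let ?m = "int (Suc n)"
  have i: "{1..?m} = insert ?m {1..int n}" by auto
  have "(\<Sum>d\<in>colours (Suc n). F d) = (\<Sum>(k, d)\<in>C ?m \<times> colours n. F (d(?m := k)))"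
    unfolding colours_def i PiE_insert_eq
    by (subst sum.reindex[OF inj_combinator]) (auto simp: case_prod_unfold comp_def)
  also have "\<dots> = (\<Sum>k\<in>C ?m. \<Sum>d\<in>colours n. F (d(?m := k)))"
    by (simp add: sum.cartesian_product)
  finally show ?thesis using sum.swap by force
qed

lemma prod_Suc: "(\<Prod>i\<in>{1..int (Suc n)}. g i) = g (int (Suc n)) * (\<Prod>i\<in>{1..int n}. g i)"
proof -
  have "{1..int (Suc n)} = insert (int (Suc n)) {1..int n}" by auto
  then show ?thesis by simp
qed

lemma cw_Suc: "cw (Suc n) (d(int (Suc n) := k)) = w (int (Suc n)) k * cw n d"
proof -
  have "(\<Prod>i\<in>{1..int n}. w i ((d(int (Suc n) := k)) i)) = (\<Prod>i\<in>{1..int n}. w i (d i))"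
    by (rule prod.cong) auto
  then show ?thesis unfolding cw_def prod_Suc by simp
qed

text \<open>The cases of \<open>stw\<close> are the three sums of the locale: a new positive fixed
  point may have any colour (total weight 1), a negative one contributes the sign of its colour
  (mean q_-), and a point inserted behind \<open>j\<close> has to copy the colour of
  \<open>j\<close> (weight |q_+|). The power of \<epsilon> is what the sign of the permutation will
  supply.\<close>

lemma sum_cterm_insert:
  assumes \<sigma>: "\<sigma> \<in> sperm (pm n)" and j: "j \<in> pm (Suc n)"
  defines "m \<equiv> int (Suc n)"
  shows "\<epsilon> ^ (if j = m \<or> j = - m then 0 else 1) * (\<Sum>d\<in>colours (Suc n). cterm (Suc n) (\<sigma> \<circ> st j m) d)
    = stw qp qm j m * (\<Sum>d\<in>colours n. cterm n \<sigma> d)"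
proof -
  let ?\<rho> = "\<sigma> \<circ> st j m" and ?e = "\<epsilon> ^ (if j = m \<or> j = - m then 0 else 1)"
  have m: "m \<ge> 1" "m \<noteq> 0" "m \<notin> pm n" "- m \<notin> pm n" by (auto simp: m_def pm_def)
  have neg: "\<sigma> (- i) = - \<sigma> i" for i using \<sigma> by (simp add: sperm_def)
  have sm: "\<sigma> m = m" "\<sigma> (- m) = - m" using \<sigma> m by (auto simp: sperm_def permutes_not_in)
  have I: "{1..int (Suc n)} = insert m {1..int n}" by (auto simp: m_def)
  have nm: "i \<noteq> m" if "i \<in> {1..int n}" for i using that by (auto simp: m_def)
  have sn: "\<bar>\<sigma> i\<bar> \<noteq> m" if "i \<in> {1..int n}" for i using nm[OF sperm_pm_abs[OF \<sigma> that]] .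
  have fin_n: "finite {1..int n}" by simp
  have pS: "(\<Prod>i\<in>{1..int (Suc n)}. g i) = g m * (\<Prod>i\<in>{1..int n}. g i)" for g :: "int \<Rightarrow> real"
    unfolding m_def by (rule prod_Suc)
  have "?e * (\<Sum>k\<in>C m. cterm (Suc n) ?\<rho> (d(m := k))) = stw qp qm j m * cterm n \<sigma> d"
    if d: "d \<in> colours n" for d
  proof (cases "j = m \<or> j = - m")
    case True
    have \<rho>i: "?\<rho> i = \<sigma> i" if "i \<in> {1..int n}" for i using that True by (auto simp: st_def m_def)
    have \<rho>m: "?\<rho> m = (if j = m then m else - m)" using True sm m by (auto simp: st_def)
    have st: "(\<forall>i\<in>{1..int (Suc n)}. (d(m := k)) \<bar>?\<rho> i\<bar> = (d(m := k)) i) \<longleftrightarrow> (\<forall>i\<in>{1..int n}. d \<bar>\<sigma> i\<bar> = d i)" for k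
      unfolding I using \<rho>i \<rho>m sn nm m by auto
    have fl: "flip_char (Suc n) s (d(m := k)) ?\<rho> = (if j = m then 1 else s k) * flip_char n s d \<sigma>" for k
    proof -
      have "(\<Prod>i\<in>{1..int n}. if ?\<rho> i < 0 then s ((d(m := k)) i) else 1) = flip_char n s d \<sigma>"
        unfolding flip_char_def using \<rho>i nm by (intro prod.cong) auto
      then show ?thesis
        unfolding flip_char_def pS using \<rho>m m by auto
    qed
    have ct: "cterm (Suc n) ?\<rho> (d(m := k)) = (w m k * (if j = m then 1 else s k)) * cterm n \<sigma> d" for k
      unfolding cterm_def st fl using cw_Suc[of n d k] by (simp add: m_def)
    have "(\<Sum>k\<in>C m. w m k * (if j = m then 1 else s k)) = stw qp qm j m"
      using True m w1[OF m(1)] wqm[OF m(1)] by (auto simp: stw_def)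
    then show ?thesis using True unfolding ct sum_distrib_right[symmetric] by simp
  next
    case False
    define i0 where "i0 = \<bar>j\<bar>"
    have i0: "i0 \<in> {1..int n}" using False j by (auto simp: i0_def pm_def m_def)
    have ji: "j = i0 \<or> j = - i0" by (auto simp: i0_def)
    have \<rho>i: "?\<rho> i = \<sigma> i" if "i \<in> {1..int n}" "i \<noteq> i0" for i
      using that False nm[OF that(1)] m(1) by (auto simp: st_def i0_def)
    have \<rho>0: "?\<rho> i0 = (if j = i0 then m else - m)" using ji sm i0 nm[OF i0] by (auto simp: st_def)
    have \<rho>m: "?\<rho> m = \<sigma> j" using False by (auto simp: st_def)
    have abs\<sigma>: "\<bar>\<sigma> j\<bar> = \<bar>\<sigma> i0\<bar>" using ji neg by auto
    have dm: "(d(m := k)) \<bar>\<sigma> i\<bar> = d \<bar>\<sigma> i\<bar>" "(d(m := k)) i = d i" if "i \<in> {1..int n}" for k i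
      using that nm sn by auto
    \<comment> \<open>The point |j| is now mapped to \<open>m\<close> up to sign, which forces the
      colour of \<open>m\<close> to be that of |j|.\<close>
    have st: "(\<forall>i\<in>{1..int (Suc n)}. (d(m := k)) \<bar>?\<rho> i\<bar> = (d(m := k)) i) \<longleftrightarrow>
        k = d i0 \<and> (\<forall>i\<in>{1..int n}. d \<bar>\<sigma> i\<bar> = d i)" (is "?L \<longleftrightarrow> ?R") for k
    proof
      assume L: ?L
      have "(d(m := k)) \<bar>?\<rho> i0\<bar> = (d(m := k)) i0" using L i0 unfolding I by blast
      then have k: "k = d i0" using \<rho>0 nm[OF i0] m by (auto split: if_splits)
      have "(d(m := k)) \<bar>?\<rho> m\<bar> = (d(m := k)) m" using L unfolding I by blast
      then have "d \<bar>\<sigma> i0\<bar> = k" unfolding \<rho>m abs\<sigma> using dm(1)[OF i0] by simp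
      moreover have "d \<bar>\<sigma> i\<bar> = d i" if "i \<in> {1..int n}" "i \<noteq> i0" for i
      proof -
        have "(d(m := k)) \<bar>?\<rho> i\<bar> = (d(m := k)) i" using L that unfolding I by blast
        then show ?thesis unfolding \<rho>i[OF that] dm[OF that(1)] .
      qed
      ultimately show ?R using k by metis
    next
      assume R: ?R
      have "(d(m := k)) \<bar>?\<rho> i\<bar> = (d(m := k)) i" if "i \<in> {1..int n}" for i
      proof (cases "i = i0")
        case True
        have "\<bar>?\<rho> i0\<bar> = m" using \<rho>0 m by auto
        then show ?thesis using R True nm[OF i0] by simp
      next
        case False
        then show ?thesis unfolding \<rho>i[OF that False] dm[OF that] using R that by blast
      qed
      moreover have "(d(m := k)) \<bar>?\<rho> m\<bar> = (d(m := k)) m"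
        unfolding \<rho>m abs\<sigma> dm(1)[OF i0] using R i0 by auto
      ultimately show ?L unfolding I by blast
    qed
    have fl: "flip_char (Suc n) s (d(m := k)) ?\<rho> = flip_char n s d \<sigma>" if k: "k = d i0" for k
    proof -
      have ins: "{1..int n} = insert i0 ({1..int n} - {i0})" using i0 by auto
      have *: "(\<Prod>i\<in>{1..int n} - {i0}. if ?\<rho> i < 0 then s ((d(m := k)) i) else 1) =
          (\<Prod>i\<in>{1..int n} - {i0}. if \<sigma> i < 0 then s (d i) else 1)"
        using \<rho>i nm by (intro prod.cong) auto
      have "flip_char (Suc n) s (d(m := k)) ?\<rho> = (if \<sigma> j < 0 then s k else 1) *
          ((if ?\<rho> i0 < 0 then s (d i0) else 1) * (\<Prod>i\<in>{1..int n} - {i0}. if \<sigma> i < 0 then s (d i) else 1))"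
        unfolding flip_char_def pS
        using \<rho>m prod.remove[OF fin_n i0, of "\<lambda>i. if ?\<rho> i < 0 then s ((d(m := k)) i) else 1"] * nm[OF i0] by simp
      \<comment> \<open>For \<open>j = - i0\<close> both \<open>m\<close> and \<open>i0\<close>
        acquire an extra sign change. They have the same colour, so the two additional signs
        cancel.\<close>
      also have "(if \<sigma> j < 0 then s k else 1) * ((if ?\<rho> i0 < 0 then s (d i0) else 1) * X) =
          (if \<sigma> i0 < 0 then s (d i0) else 1) * X" for X
        using ji k neg \<rho>0 m(1) i0 sperm_nonzero[OF \<sigma> i0] s_sq[of "d i0"]
        by (auto simp: mult.assoc[symmetric])
      also have "(if \<sigma> i0 < 0 then s (d i0) else 1) * (\<Prod>i\<in>{1..int n} - {i0}. if \<sigma> i < 0 then s (d i) else 1)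
          = flip_char n s d \<sigma>"
        unfolding flip_char_def by (rule prod.remove[OF fin_n i0, symmetric])
      finally show ?thesis .
    qed
    have ct: "cterm (Suc n) ?\<rho> (d(m := k)) = (if k = d i0 then w m k * cterm n \<sigma> d else 0)" for k
      unfolding cterm_def st using fl cw_Suc[of n d k] by (auto simp: m_def)
    have di: "d i0 \<in> C i0" using d i0 by (auto simp: colours_def)
    have "\<epsilon> * (\<Sum>k\<in>C m. cterm (Suc n) ?\<rho> (d(m := k))) =
        (\<epsilon> * (if d i0 \<in> C m then w m (d i0) else 0)) * cterm n \<sigma> d"
      unfolding ct using fin[of m] by simp
    also have "\<epsilon> * (if d i0 \<in> C m then w m (d i0) else 0) = qp"
      using wqp[of i0 m "d i0"] di i0 by (auto simp: m_def)
    finally show ?thesis using False by (simp add: stw_def del: o_apply fun_upd_apply)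
  qed
  then show ?thesis
    unfolding sum_colours_Suc sum_distrib_left m_def by (intro sum.cong) auto
qed

text \<open>\<open>st j m\<close> projects to the transposition of |j| and m, and to the identity
  when these agree.\<close>

lemma sign_char_insert:
  assumes \<sigma>: "\<sigma> \<in> sperm (pm n)" and j: "j \<in> pm (Suc n)"
  defines "m \<equiv> int (Suc n)"
  shows "sign_char \<epsilon> (Suc n) (\<sigma> \<circ> st j m) = sign_char \<epsilon> n \<sigma> * \<epsilon> ^ (if j = m \<or> j = - m then 0 else 1)"
proof -
  have m: "m \<ge> 1" "m \<noteq> 0" "m \<notin> pm n" by (auto simp: m_def pm_def)
  have sub: "pm n \<subseteq> pm (Suc n)" by (auto simp: pm_def)
  have \<sigma>': "\<sigma> \<in> sperm (pm (Suc n))" using sperm_mono[OF \<sigma> sub] .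
  have mpm: "m \<in> pm (Suc n)" by (auto simp: m_def pm_def)
  have sts: "st j m \<in> sperm (pm (Suc n))" using st_sperm[OF j mpm] by simp
  have "\<sigma> m = m" using \<sigma> m by (auto simp: sperm_def permutes_not_in)
  have a\<sigma>: "absp (Suc n) \<sigma> = absp n \<sigma>"
  proof
    fix i show "absp (Suc n) \<sigma> i = absp n \<sigma> i"
    proof (cases "i = m")
      case True
      then show ?thesis using \<open>\<sigma> m = m\<close> m(1) unfolding absp_def by simp
    next
      case False
      then have "i \<in> {1..int (Suc n)} \<longleftrightarrow> i \<in> {1..int n}" by (auto simp: m_def)
      then show ?thesis unfolding absp_def by presburger
    qed
  qed
  have j0: "j \<noteq> 0" using j by (auto simp: pm_def)
  have "absp (Suc n) (st j m) = Transposition.transpose \<bar>j\<bar> m"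
    using j j0 m by (auto simp: absp_def fun_eq_iff st_def Transposition.transpose_def pm_def m_def)
  then have "sign_char \<epsilon> (Suc n) (st j m) = \<epsilon> ^ (if j = m \<or> j = - m then 0 else 1)"
    using \<epsilon> m by (auto simp: sign_char_def sign_swap_id)
  moreover have "sign_char \<epsilon> (Suc n) \<sigma> = sign_char \<epsilon> n \<sigma>" unfolding sign_char_def a\<sigma> ..
  ultimately show ?thesis using sign_char_comp[OF \<sigma>' sts] by simp
qed

text \<open>Inserting the largest point multiplies both sides by \<open>stw\<close>. The weight is
  thus an expectation, over random colourings, of characters extended by zero.\<close>

lemma wt_eq_sum_cterm:
  "\<rho> \<in> sperm (pm n) \<Longrightarrow> wt qp qm (pm n) \<rho> = sign_char \<epsilon> n \<rho> * (\<Sum>d\<in>colours n. cterm n \<rho> d)"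
proof (induction n arbitrary: \<rho>)
  case 0
  have p0: "pm 0 = {}" by (auto simp: pm_def)
  then have "\<rho> = id" using 0 by (simp add: sperm_def)
  then show ?case
    by (simp add: p0 wt_empty colours_def cterm_def cw_def char_id[unfolded id_def] id_def)
next
  case (Suc n)
  let ?m = "int (Suc n)"
  have m: "?m \<noteq> 0" "?m \<notin> pm n" by (auto simp: pm_def)
  have "\<rho> \<in> (\<lambda>(\<sigma>, j). \<sigma> \<circ> st j ?m) ` (sperm (pm n) \<times> (pm n \<union> {?m, - ?m}))"
    using Suc.prems sperm_insert_bij[of "pm n" ?m, OF _ _ m] unfolding pm_Suc bij_betw_def by auto
  then obtain \<sigma> j where \<rho>: "\<rho> = \<sigma> \<circ> st j ?m" and \<sigma>: "\<sigma> \<in> sperm (pm n)" and j: "j \<in> pm n \<union> {?m, - ?m}"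
    by auto
  have j': "j \<in> pm (Suc n)" using j unfolding pm_Suc .
  have "wt qp qm (pm (Suc n)) \<rho> = stw qp qm j ?m * wt qp qm (pm n) \<sigma>"
    unfolding \<rho> pm_Suc by (rule wt_insert[OF pm_props m \<sigma> j])
  also have "\<dots> = sign_char \<epsilon> n \<sigma> * (stw qp qm j ?m * (\<Sum>d\<in>colours n. cterm n \<sigma> d))"
    unfolding Suc.IH[OF \<sigma>] by simp
  also have "\<dots> = sign_char \<epsilon> (Suc n) \<rho> * (\<Sum>d\<in>colours (Suc n). cterm (Suc n) \<rho> d)"
    unfolding sum_cterm_insert[OF \<sigma> j', symmetric] \<rho> sign_char_insert[OF \<sigma> j'] by simp
  finally show ?case .
qed

text \<open>After the sums are exchanged, each colouring contributes a nonnegative multiple of a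
  character sum over a subgroup.\<close>

lemma wt_form_nonneg:
  fixes f :: "'a::real_inner tensor"
  assumes f: "f \<in> tensor_power n"
  shows "(\<Sum>\<rho>\<in>sperm (pm n). complex_of_real (wt qp qm (pm n) \<rho>) * tensor_inner n f (\<lambda>z. f (z \<circ> \<rho>))) \<in> \<real>\<^sub>\<ge>\<^sub>0"
proof -
  let ?T = "\<lambda>\<rho>. tensor_inner n f (\<lambda>z. f (z \<circ> \<rho>))"
  let ?\<zeta> = "\<lambda>d \<rho>. flip_char n s d \<rho> * sign_char \<epsilon> n \<rho>"
  have fin_s: "finite (sperm (pm n))" by (simp add: finite_sperm)
  have "(\<Sum>\<rho>\<in>sperm (pm n). complex_of_real (wt qp qm (pm n) \<rho>) * ?T \<rho>) =
      (\<Sum>\<rho>\<in>sperm (pm n). \<Sum>d\<in>colours n. complex_of_real (sign_char \<epsilon> n \<rho> * cterm n \<rho> d) * ?T \<rho>)"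
    by (rule sum.cong) (auto simp: wt_eq_sum_cterm sum_distrib_left sum_distrib_right mult.assoc)
  also have "\<dots> = (\<Sum>d\<in>colours n. \<Sum>\<rho>\<in>sperm (pm n). complex_of_real (sign_char \<epsilon> n \<rho> * cterm n \<rho> d) * ?T \<rho>)"
    by (rule sum.swap)
  also have "\<dots> = (\<Sum>d\<in>colours n. complex_of_real (cw n d) * (\<Sum>\<rho>\<in>stab n d. complex_of_real (?\<zeta> d \<rho>) * ?T \<rho>))"
  proof (rule sum.cong[OF refl])
    fix d assume "d \<in> colours n"
    have "(\<Sum>\<rho>\<in>sperm (pm n). complex_of_real (sign_char \<epsilon> n \<rho> * cterm n \<rho> d) * ?T \<rho>) =
        (\<Sum>\<rho>\<in>stab n d. complex_of_real (sign_char \<epsilon> n \<rho> * cterm n \<rho> d) * ?T \<rho>)"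
      using fin_s by (intro sum.mono_neutral_right) (auto simp: stab_def cterm_def)
    also have "\<dots> = (\<Sum>\<rho>\<in>stab n d. complex_of_real (cw n d) * (complex_of_real (?\<zeta> d \<rho>) * ?T \<rho>))"
      by (rule sum.cong) (auto simp: stab_def cterm_def)
    finally show "(\<Sum>\<rho>\<in>sperm (pm n). complex_of_real (sign_char \<epsilon> n \<rho> * cterm n \<rho> d) * ?T \<rho>) =
        complex_of_real (cw n d) * (\<Sum>\<rho>\<in>stab n d. complex_of_real (?\<zeta> d \<rho>) * ?T \<rho>)"
      by (simp add: sum_distrib_left)
  qed
  also have "\<dots> \<in> \<real>\<^sub>\<ge>\<^sub>0"
  proof (rule sum_nonneg_Reals, rule nonneg_Reals_mult_I)
    fix d assume d: "d \<in> colours n"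
    then have "0 \<le> cw n d"
      unfolding cw_def colours_def by (intro prod_nonneg) (auto intro: w_nonneg)
    then show "complex_of_real (cw n d) \<in> \<real>\<^sub>\<ge>\<^sub>0" by simp
    show "(\<Sum>\<rho>\<in>stab n d. complex_of_real (?\<zeta> d \<rho>) * ?T \<rho>) \<in> \<real>\<^sub>\<ge>\<^sub>0"
    proof (rule sum_tensor_subgroup_nonneg[OF f])
      show "stab n d \<subseteq> sperm (pm n)" by (auto simp: stab_def)
      show "?\<zeta> d (\<rho> \<circ> \<tau>) = ?\<zeta> d \<rho> * ?\<zeta> d \<tau>" if "\<rho> \<in> stab n d" "\<tau> \<in> stab n d" for \<rho> \<tau>
        using flip_char_comp[OF that s_sq] sign_char_comp[of \<rho> n \<tau> \<epsilon>] that by (simp add: stab_def)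
    qed (auto simp: stab_comp stab_inv stab_id char_id)
  qed
  finally show ?thesis .
qed

end

lemma wt_form_nonneg_parameters:
  fixes f :: "'a::real_inner tensor"
  assumes "(\<exists>(M::nat) (N::nat) (\<epsilon>::real). M + N \<noteq> 0 \<and> \<epsilon> \<in> {1, - 1} \<and>
        qp = \<epsilon> / (real M + real N) \<and> qm = (real M - real N) / (real M + real N)) \<or>
     (qp = 0 \<and> - 1 \<le> qm \<and> qm \<le> 1)"
    and f: "f \<in> tensor_power n"
  shows "(\<Sum>\<rho>\<in>sperm (pm n). complex_of_real (wt qp qm (pm n) \<rho>) * tensor_inner n f (\<lambda>z. f (z \<circ> \<rho>))) \<in> \<real>\<^sub>\<ge>\<^sub>0"
  using assms(1)
proof
  assume "\<exists>(M::nat) (N::nat) (\<epsilon>::real). M + N \<noteq> 0 \<and> \<epsilon> \<in> {1, - 1} \<and>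
        qp = \<epsilon> / (real M + real N) \<and> qm = (real M - real N) / (real M + real N)"
  then obtain M N :: nat and \<epsilon> :: real where MN: "M + N \<noteq> 0" "\<epsilon> \<in> {1, - 1}"
    "qp = \<epsilon> / (real M + real N)" "qm = (real M - real N) / (real M + real N)" by blast
  define s :: "int \<Rightarrow> real" where "s k = (if k \<le> int M then 1 else - 1)" for k
  have "(\<Sum>k\<in>{1..int (M + N)}. s k) = (\<Sum>k\<in>{1..int M}. s k) + (\<Sum>k\<in>{int M + 1..int (M + N)}. s k)"
  proof -
    have "{1..int (M + N)} = {1..int M} \<union> {int M + 1..int (M + N)}" by auto
    moreover have "{1..int M} \<inter> {int M + 1..int (M + N)} = {}" by auto
    ultimately show ?thesis by (simp add: sum.union_disjoint)
  qed
  also have "\<dots> = (\<Sum>k\<in>{1..int M}. 1) + (\<Sum>k\<in>{int M + 1..int (M + N)}. - 1)"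
    by (intro arg_cong2[where f = "(+)"] sum.cong) (auto simp: s_def)
  also have "\<dots> = real M - real N" by simp
  finally have ss: "(\<Sum>k\<in>{1..int (M + N)}. s k) = real M - real N" .
  have pos: "real M + real N \<noteq> 0" using MN(1) by linarith
  interpret colouring "\<lambda>_. {1..int (M + N)}" "\<lambda>_ _. 1 / (real M + real N)" s \<epsilon> qp qm
  proof
    show "s k * s k = 1" for k by (simp add: s_def)
    show "(\<Sum>k\<in>{1..int (M + N)}. 1 / (real M + real N) * s k) = qm"
      unfolding sum_distrib_left[symmetric] ss MN(4) by simp
    show "(\<Sum>k\<in>{1..int (M + N)}. 1 / (real M + real N)) = 1" using pos by simp
  qed (use MN in auto)
  show ?thesis by (rule wt_form_nonneg[OF f])
next
  assume q: "qp = 0 \<and> - 1 \<le> qm \<and> qm \<le> 1"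
  define s :: "int \<Rightarrow> real" where "s k = (if k > 0 then 1 else - 1)" for k
  \<comment> \<open>The private colours \<open>m\<close> and \<open>- m\<close> are never shared by
    different points, which gives q_+ = 0. The weights (1 \<plusminus> q_-)/2 have mean sign q_-,
    and the bounds on q_- make them nonnegative.\<close>
  interpret colouring "\<lambda>m. {m, - m}" "\<lambda>_ k. (1 + s k * qm) / 2" s 1 qp qm
  proof
    show "s k * s k = 1" for k by (simp add: s_def)
    show "0 \<le> (1 + s k * qm) / 2" for k using q by (auto simp: s_def)
    show "(\<Sum>k\<in>{m, - m}. (1 + s k * qm) / 2) = 1" if "1 \<le> m" for m :: int
      using that by (simp add: s_def field_simps)
    show "(\<Sum>k\<in>{m, - m}. (1 + s k * qm) / 2 * s k) = qm" if "1 \<le> m" for m :: int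
      using that by (simp add: s_def field_simps)
  qed (use q in auto)
  show ?thesis by (rule wt_form_nonneg[OF f])
qed

section \<open>The Fock space quotient\<close>


definition admissible :: "real \<Rightarrow> real \<Rightarrow> bool" where
  "admissible qp qm \<longleftrightarrow> (\<exists>(M::nat) (N::nat) (\<epsilon>::real). M + N \<noteq> 0 \<and> \<epsilon> \<in> {1, - 1} \<and>
        qp = \<epsilon> / (real M + real N) \<and> qm = (real M - real N) / (real M + real N)) \<or>
     (qp = 0 \<and> - 1 \<le> qm \<and> qm \<le> 1)"

lemma sperm_pm_permutes: "\<sigma> \<in> sperm (pm n) \<Longrightarrow> \<sigma> permutes pm n"
  by (simp add: sperm_def)

lemma bij_betw_inv_sperm: "bij_betw inv (sperm (pm n)) (sperm (pm n))"
  by (rule bij_betw_byWitness[where f' = inv])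
    (auto simp: sperm_inv permutes_inv_inv[OF sperm_pm_permutes])

lemma wt_inv_pm: "\<sigma> \<in> sperm (pm n) \<Longrightarrow> wt qp qm (pm n) (inv \<sigma>) = wt qp qm (pm n) \<sigma>"
  by (simp add: wt_inv sperm_pm_permutes)

text \<open>Inversion preserves the orbits and hence the weight; reindexing by it turns the inverse
  in \<open>tensor_act\<close> into plain precomposition.\<close>

lemma P_op_eq:
  "P_op qp qm n f = (\<lambda>z. \<Sum>\<sigma>\<in>sperm (pm n). complex_of_real (wt qp qm (pm n) \<sigma>) * f (z \<circ> \<sigma>))"
proof
  fix z
  have "P_op qp qm n f z = (\<Sum>\<sigma>\<in>sperm (pm n). complex_of_real (wt qp qm (pm n) (inv \<sigma>)) * f (z \<circ> inv \<sigma>))"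
    unfolding P_op_def B_group_eq_sperm
    by (rule sum.cong) (auto simp: phi_eq_wt B_group_eq_sperm wt_inv_pm tensor_act_def)
  then show "P_op qp qm n f z = (\<Sum>\<sigma>\<in>sperm (pm n). complex_of_real (wt qp qm (pm n) \<sigma>) * f (z \<circ> \<sigma>))"
    using sum.reindex_bij_betw[OF bij_betw_inv_sperm, of "\<lambda>\<sigma>. complex_of_real (wt qp qm (pm n) \<sigma>) * f (z \<circ> \<sigma>)"]
    by simp
qed

lemma P_op_add: "P_op qp qm n (\<lambda>z. f z + g z) = (\<lambda>z. P_op qp qm n f z + P_op qp qm n g z)"
  by (simp add: P_op_eq sum.distrib distrib_left)

lemma P_op_diff: "P_op qp qm n (\<lambda>z. f z - g z) = (\<lambda>z. P_op qp qm n f z - P_op qp qm n g z)"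
  by (simp add: P_op_eq sum_subtractf right_diff_distrib)

lemma P_op_scale: "P_op qp qm n (\<lambda>z. c * f z) = (\<lambda>z. c * P_op qp qm n f z)"
  by (simp add: P_op_eq sum_distrib_left algebra_simps)

lemma P_op_zero: "P_op qp qm n (\<lambda>z. 0) = (\<lambda>z. 0)"
  by (simp add: P_op_eq)

lemma tensor_power_perm':
  "f \<in> tensor_power n \<Longrightarrow> \<sigma> \<in> sperm (pm n) \<Longrightarrow> (\<lambda>z. f (z \<circ> \<sigma>)) \<in> tensor_power n"
  by (rule tensor_power_perm) (auto simp: sperm_pm_permutes)

lemma tensor_power_P: "f \<in> tensor_power n \<Longrightarrow> P_op qp qm n f \<in> tensor_power n"
  unfolding P_op_eq by (intro tensor_power_sum tensor_power_perm')

lemma tensor_inner_P: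
  assumes "f \<in> tensor_power n" "g \<in> tensor_power n"
  shows "tensor_inner n f (P_op qp qm n g) =
    (\<Sum>\<sigma>\<in>sperm (pm n). complex_of_real (wt qp qm (pm n) \<sigma>) * tensor_inner n f (\<lambda>z. g (z \<circ> \<sigma>)))"
  unfolding P_op_eq by (intro tensor_inner_sum_right tensor_power_perm' assms)

text \<open>Slot permutations are unitary, and the weights are real and invariant under
  inversion.\<close>

lemma P_op_self_adjoint:
  assumes f: "f \<in> tensor_power n" and g: "g \<in> tensor_power n"
  shows "tensor_inner n (P_op qp qm n f) g = tensor_inner n f (P_op qp qm n g)"
proof -
  have "tensor_inner n (P_op qp qm n f) g = cnj (tensor_inner n g (P_op qp qm n f))"
    by (rule tensor_inner_commute[OF tensor_power_P[OF f] g])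
  also have "\<dots> = (\<Sum>\<sigma>\<in>sperm (pm n). complex_of_real (wt qp qm (pm n) \<sigma>) * cnj (tensor_inner n g (\<lambda>z. f (z \<circ> \<sigma>))))"
    unfolding tensor_inner_P[OF g f] by simp
  also have "\<dots> = (\<Sum>\<sigma>\<in>sperm (pm n). complex_of_real (wt qp qm (pm n) (inv \<sigma>)) * tensor_inner n f (\<lambda>z. g (z \<circ> inv \<sigma>)))"
  proof (rule sum.cong[OF refl])
    fix \<sigma> assume s: "\<sigma> \<in> sperm (pm n)"
    have "cnj (tensor_inner n g (\<lambda>z. f (z \<circ> \<sigma>))) = tensor_inner n (\<lambda>z. f (z \<circ> \<sigma>)) g"
      using tensor_inner_commute[OF tensor_power_perm'[OF f s] g] by simp
    then show "complex_of_real (wt qp qm (pm n) \<sigma>) * cnj (tensor_inner n g (\<lambda>z. f (z \<circ> \<sigma>))) =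
        complex_of_real (wt qp qm (pm n) (inv \<sigma>)) * tensor_inner n f (\<lambda>z. g (z \<circ> inv \<sigma>))"
      using tensor_inner_perm[OF f g sperm_pm_permutes[OF s]] s by (simp add: wt_inv_pm)
  qed
  also have "\<dots> = tensor_inner n f (P_op qp qm n g)"
    unfolding tensor_inner_P[OF f g]
    by (rule sum.reindex_bij_betw[OF bij_betw_inv_sperm, of "\<lambda>\<sigma>. complex_of_real (wt qp qm (pm n) \<sigma>) * tensor_inner n f (\<lambda>z. g (z \<circ> \<sigma>))"])
  finally show ?thesis .
qed

lemma P_op_nonneg:
  assumes "admissible qp qm" "f \<in> tensor_power n"
  shows "tensor_inner n f (P_op qp qm n f) \<in> \<real>\<^sub>\<ge>\<^sub>0"
  unfolding tensor_inner_P[OF assms(2,2)]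
  using wt_form_nonneg_parameters[OF assms(1)[unfolded admissible_def] assms(2)] .

lemma tensor_eq_zeroI:
  assumes "f \<in> tensor_power n" "\<And>g. g \<in> tensor_power n \<Longrightarrow> tensor_inner n g f = 0"
  shows "f = (\<lambda>z. 0)"
  using assms tensor_inner_simple[OF assms(1)] tensor_power_simple by metis

text \<open>By Cauchy--Schwarz, tested on \<open>g + c f\<close> for complex \<open>c\<close>.\<close>

lemma P_op_null:
  assumes adm: "admissible qp qm" and f: "f \<in> tensor_power n"
    and null: "tensor_inner n f (P_op qp qm n f) = 0"
  shows "P_op qp qm n f = (\<lambda>z. 0)"
proof (rule tensor_eq_zeroI[OF tensor_power_P[OF f]])
  fix g :: "'a tensor" assume g: "g \<in> tensor_power n"
  let ?P = "P_op qp qm n" and ?i = "tensor_inner n"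
  define a where "a = ?i g (?P f)"
  define b where "b = Re (?i g (?P g))"
  have fg: "?i f (?P g) = cnj a"
    unfolding a_def P_op_self_adjoint[OF f g, symmetric]
    by (rule tensor_inner_commute[OF tensor_power_P[OF f] g])
  have ineq: "0 \<le> b - 2 * t * (cmod a)\<^sup>2" for t
  proof -
    \<comment> \<open>With this choice the cross term c a is the real number -t |a|^2, while the
      term quadratic in \<open>c\<close> vanishes because <f, P f> = 0. The resulting bound is
      linear in \<open>t\<close>.\<close>
    define c where "c = - complex_of_real t * cnj a"
    define v where "v = (\<lambda>z. g z + c * f z)"
    have cf: "(\<lambda>z. c * f z) \<in> tensor_power n" using tensor_power_scale[OF f] .
    have v: "v \<in> tensor_power n" unfolding v_def by (rule tensor_power_add[OF g cf])
    have Pv: "?P v = (\<lambda>z. ?P g z + c * ?P f z)" unfolding v_def P_op_add P_op_scale ..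
    have lin: "?i u (?P v) = ?i u (?P g) + c * ?i u (?P f)" if "u \<in> tensor_power n" for u
      unfolding Pv using that f g
      by (simp add: tensor_inner_add_right tensor_inner_scale_right tensor_power_scale tensor_power_P)
    have "?i v (?P v) = cnj (?i (?P v) v)" by (rule tensor_inner_commute[OF v tensor_power_P[OF v]])
    also have "?i (?P v) v = ?i (?P v) g + c * ?i (?P v) f"
      unfolding v_def[symmetric]
      using tensor_inner_add_right[OF tensor_power_P[OF v] g cf] tensor_inner_scale_right[OF tensor_power_P[OF v] f]
      by (simp add: v_def)
    also have "cnj \<dots> = ?i g (?P v) + cnj c * ?i f (?P v)"
      using tensor_inner_commute[OF g tensor_power_P[OF v]] tensor_inner_commute[OF f tensor_power_P[OF v]] by simp
    also have "\<dots> = ?i g (?P g) + (c * a + cnj (c * a))"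
      unfolding lin[OF f] lin[OF g] null fg by (simp add: a_def algebra_simps)
    finally have "Re (?i v (?P v)) = b + 2 * Re (c * a)" by (simp add: b_def)
    also have "c * a = complex_of_real (- t * (cmod a)\<^sup>2)"
      using complex_norm_square[of a] by (simp add: c_def mult_ac)
    finally show ?thesis using P_op_nonneg[OF adm v] by (simp add: complex_nonneg_Reals_iff)
  qed
  have "a = 0"
  proof (rule ccontr)
    assume "a \<noteq> 0"
    then have "0 < (cmod a)\<^sup>2" by simp
    \<comment> \<open>This value of \<open>t\<close> makes the linear expression equal to
      -1.\<close>
    then show False using ineq[of "(b + 1) / (2 * (cmod a)\<^sup>2)"] by (simp add: field_simps)
  qed
  then show "?i g (?P f) = 0" by (simp add: a_def)
qed

section \<open>The explicit annihilation operator\<close>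

definition ann_op :: "real \<Rightarrow> real \<Rightarrow> nat \<Rightarrow> 'a cplxn \<Rightarrow> 'a cplxn \<Rightarrow> 'a tensor \<Rightarrow> 'a tensor" where
  "ann_op qp qm n a b f = (\<lambda>z. \<Sum>j\<in>pm (Suc n).
     complex_of_real (stw qp qm j (int (Suc n))) * f (plug n a b z \<circ> st j (int (Suc n))))"

lemma pm_Suc_mem: "int (Suc n) \<in> pm (Suc n)" "pm n \<subseteq> pm (Suc n)"
  by (auto simp: pm_def)

lemma st_sperm_pm: "j \<in> pm (Suc n) \<Longrightarrow> st j (int (Suc n)) \<in> sperm (pm (Suc n))"
  using st_sperm pm_Suc_mem pm_props by metis

lemma tensor_power_ann: "f \<in> tensor_power (Suc n) \<Longrightarrow> ann_op qp qm n a b f \<in> tensor_power n"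
  unfolding ann_op_def by (intro tensor_power_sum tensor_power_plug[OF tensor_power_perm'] st_sperm_pm)

text \<open>This is P^(n+1) = P^(n) R^(n+1) after contraction: each permutation is some \<sigma>
  composed with \<open>st j m\<close>, and \<sigma> fixes the outer slots, hence commutes with
  plugging vectors into them.\<close>

lemma P_op_plug:
  "P_op qp qm (Suc n) f (plug n a b z) = P_op qp qm n (ann_op qp qm n a b f) z"
proof -
  let ?m = "int (Suc n)"
  have m: "?m \<noteq> 0" "?m \<notin> pm n" "- ?m \<notin> pm n" by (auto simp: pm_def)
  have bij: "bij_betw (\<lambda>(\<sigma>, j). \<sigma> \<circ> st j ?m) (sperm (pm n) \<times> pm (Suc n)) (sperm (pm (Suc n)))"
    using sperm_insert_bij[OF pm_props(2,3) m(1,2)] unfolding pm_Suc .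
  have pl: "plug n a b z \<circ> \<sigma> = plug n a b (z \<circ> \<sigma>)" if "\<sigma> \<in> sperm (pm n)" for \<sigma>
  proof
    fix i
    have p: "\<sigma> permutes pm n" using that by (rule sperm_pm_permutes)
    have fx: "\<sigma> ?m = ?m" "\<sigma> (- ?m) = - ?m" using p m by (auto simp: permutes_not_in)
    have "\<sigma> i = ?m \<longleftrightarrow> i = ?m" "\<sigma> i = - ?m \<longleftrightarrow> i = - ?m"
      using fx permutes_inj[OF p] by (metis injD)+
    then show "(plug n a b z \<circ> \<sigma>) i = plug n a b (z \<circ> \<sigma>) i" by (simp add: plug_def)
  qed
  have "P_op qp qm (Suc n) f (plug n a b z) = (\<Sum>(\<sigma>, j)\<in>sperm (pm n) \<times> pm (Suc n).
      complex_of_real (wt qp qm (pm (Suc n)) (\<sigma> \<circ> st j ?m)) * f (plug n a b z \<circ> (\<sigma> \<circ> st j ?m)))"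
    unfolding P_op_eq
    using sum.reindex_bij_betw[OF bij, of "\<lambda>\<rho>. complex_of_real (wt qp qm (pm (Suc n)) \<rho>) * f (plug n a b z \<circ> \<rho>)"]
    by (simp add: case_prod_unfold)
  also have "\<dots> = (\<Sum>\<sigma>\<in>sperm (pm n). \<Sum>j\<in>pm (Suc n).
      complex_of_real (wt qp qm (pm (Suc n)) (\<sigma> \<circ> st j ?m)) * f (plug n a b z \<circ> (\<sigma> \<circ> st j ?m)))"
    by (simp add: sum.cartesian_product)
  also have "\<dots> = (\<Sum>\<sigma>\<in>sperm (pm n). \<Sum>j\<in>pm (Suc n). complex_of_real (wt qp qm (pm n) \<sigma>) *
      (complex_of_real (stw qp qm j ?m) * f (plug n a b (z \<circ> \<sigma>) \<circ> st j ?m)))"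
  proof (intro sum.cong refl)
    fix \<sigma> j assume s: "\<sigma> \<in> sperm (pm n)" and j: "j \<in> pm (Suc n)"
    have "wt qp qm (pm (Suc n)) (\<sigma> \<circ> st j ?m) = stw qp qm j ?m * wt qp qm (pm n) \<sigma>"
      using wt_insert[OF pm_props m(1,2) s] j unfolding pm_Suc by blast
    then show "complex_of_real (wt qp qm (pm (Suc n)) (\<sigma> \<circ> st j ?m)) * f (plug n a b z \<circ> (\<sigma> \<circ> st j ?m)) =
        complex_of_real (wt qp qm (pm n) \<sigma>) *
        (complex_of_real (stw qp qm j ?m) * f (plug n a b (z \<circ> \<sigma>) \<circ> st j ?m))"
      using pl[OF s] by (simp add: o_assoc)
  qed
  also have "\<dots> = P_op qp qm n (ann_op qp qm n a b f) z"
    unfolding P_op_eq ann_op_def by (simp add: sum_distrib_left)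
  finally show ?thesis .
qed

text \<open>Self-adjointness moves P^(n+1) onto \<open>f\<close>, the adjoint of creation contracts
  the outer slots, \<open>P_op_plug\<close> leaves P^(n), and this is moved back.\<close>

lemma ann_op_adjoint:
  assumes f: "f \<in> tensor_power (Suc n)" and h: "h \<in> tensor_power n"
  shows "tensor_inner n (ann_op qp qm n a b f) (P_op qp qm n h) =
    tensor_inner (Suc n) f (P_op qp qm (Suc n) (create n a b h))"
proof -
  have c: "create n a b h \<in> tensor_power (Suc n)" using tensor_power_create[OF h] .
  have an: "ann_op qp qm n a b f \<in> tensor_power n" using tensor_power_ann[OF f] .
  have "tensor_inner (Suc n) f (P_op qp qm (Suc n) (create n a b h)) =
      tensor_inner (Suc n) (P_op qp qm (Suc n) f) (create n a b h)"
    by (rule P_op_self_adjoint[OF f c, symmetric])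
  also have "\<dots> = cnj (tensor_inner (Suc n) (create n a b h) (P_op qp qm (Suc n) f))"
    by (rule tensor_inner_commute[OF tensor_power_P[OF f] c])
  also have "\<dots> = cnj (tensor_inner n h (P_op qp qm n (ann_op qp qm n a b f)))"
    unfolding tensor_inner_create[OF h tensor_power_P[OF f]] P_op_plug ..
  also have "\<dots> = tensor_inner n (P_op qp qm n (ann_op qp qm n a b f)) h"
    by (rule tensor_inner_commute[OF tensor_power_P[OF an] h, symmetric])
  also have "\<dots> = tensor_inner n (ann_op qp qm n a b f) (P_op qp qm n h)"
    by (rule P_op_self_adjoint[OF an h])
  finally show ?thesis by simp
qed

section \<open>Fock space vectors and null vectors\<close>

definition annihilation :: "real \<Rightarrow> real \<Rightarrow> 'a cplxn \<Rightarrow> 'a cplxn \<Rightarrow> 'a fvec \<Rightarrow> 'a fvec" where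
  "annihilation qp qm a b F = (\<lambda>n. ann_op qp qm n a b (F (Suc n)))"

lemma fock_tensor: "F \<in> fock \<Longrightarrow> F n \<in> tensor_power n"
  by (simp add: fock_def)

lemma fock_bound: "F \<in> fock \<Longrightarrow> \<exists>N. \<forall>n\<ge>N. F n = (\<lambda>z. 0)"
proof -
  assume "F \<in> fock"
  then have "finite {n. F n \<noteq> (\<lambda>z. 0)}" by (simp add: fock_def)
  then obtain N where "\<forall>n\<in>{n. F n \<noteq> (\<lambda>z. 0)}. n < N" using finite_nat_set_iff_bounded by blast
  then show ?thesis by (metis (mono_tags, lifting) leD mem_Collect_eq)
qed

lemma fockI:
  assumes "\<And>n. F n \<in> tensor_power n" "\<And>n. n \<ge> N \<Longrightarrow> F n = (\<lambda>z. 0)"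
  shows "F \<in> fock"
proof -
  have "{n. F n \<noteq> (\<lambda>z. 0)} \<subseteq> {..<N}" using assms(2) by (metis (mono_tags, lifting) lessThan_iff linorder_not_less mem_Collect_eq subsetI)
  then show ?thesis unfolding fock_def using assms(1) finite_subset by blast
qed

text \<open>The defining sum runs over the support of the second argument. A fixed range
  \<open>{..<N}\<close> adds vanishing terms only and lets sums for different vectors be
  compared.\<close>

lemma fock_inner_eq:
  assumes "F \<in> fock" "\<And>n. n \<ge> N \<Longrightarrow> G n = (\<lambda>z. 0)"
  shows "fock_inner qp qm F G = (\<Sum>n<N. tensor_inner n (F n) (P_op qp qm n (G n)))"
  unfolding fock_inner_def
proof (rule sum.mono_neutral_left)
  show "{n. G n \<noteq> (\<lambda>z. 0)} \<subseteq> {..<N}"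
    using assms(2) by (metis (mono_tags, lifting) lessThan_iff linorder_not_less mem_Collect_eq subsetI)
qed (auto simp: P_op_zero tensor_inner_zero_right fock_tensor[OF assms(1)])

lemma fock_vacuum: "vacuum \<in> fock"
proof (rule fockI[where N = 1])
  fix n
  have "simple_tensor 0 x = (\<lambda>z. 1)" for x :: "int \<Rightarrow> 'a cplxn"
    by (simp add: simple_tensor_def pm_def)
  then have "(\<lambda>z. 1) \<in> (tensor_power 0 :: 'a tensor set)" using tensor_power_simple by metis
  then show "vacuum n \<in> (tensor_power n :: 'a tensor set)"
    by (cases "n = 0") (auto simp: vacuum_def tensor_power_zero)
qed (simp add: vacuum_def)

lemma fock_fock_add: "F \<in> fock \<Longrightarrow> G \<in> fock \<Longrightarrow> fock_add F G \<in> fock"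
proof -
  assume a: "F \<in> fock" "G \<in> fock"
  obtain N M where NM: "\<forall>n\<ge>N. F n = (\<lambda>z. 0)" "\<forall>n\<ge>M. G n = (\<lambda>z. 0)" using a fock_bound by metis
  show ?thesis
    by (rule fockI[where N = "max N M"])
      (use NM a in \<open>auto simp: fock_add_def intro: tensor_power_add fock_tensor\<close>)
qed

lemma fock_fock_diff: "F \<in> fock \<Longrightarrow> G \<in> fock \<Longrightarrow> fock_diff F G \<in> fock"
proof -
  assume a: "F \<in> fock" "G \<in> fock"
  obtain N M where NM: "\<forall>n\<ge>N. F n = (\<lambda>z. 0)" "\<forall>n\<ge>M. G n = (\<lambda>z. 0)" using a fock_bound by metis
  show ?thesis
    by (rule fockI[where N = "max N M"])
      (use NM a in \<open>auto simp: fock_diff_def intro: tensor_power_diff fock_tensor\<close>)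
qed

lemma creation_Suc: "creation a b F (Suc n) = create n a b (F n)"
  by (simp add: creation_def create_def)

lemma creation_0: "creation a b F 0 = (\<lambda>z. 0)"
  by (simp add: creation_def)

lemma fock_creation: "F \<in> fock \<Longrightarrow> creation a b F \<in> fock"
proof -
  assume a: "F \<in> fock"
  obtain N where N: "\<forall>n\<ge>N. F n = (\<lambda>z. 0)" using a fock_bound by metis
  show ?thesis
  proof (rule fockI[where N = "Suc N"])
    show "creation a b F n \<in> tensor_power n" for n
      by (cases n) (auto simp: creation_Suc creation_0 tensor_power_zero intro: tensor_power_create fock_tensor a)
    show "creation a b F n = (\<lambda>z. 0)" if "n \<ge> Suc N" for n
    proof -
      obtain k where k: "n = Suc k" "k \<ge> N" using \<open>n \<ge> Suc N\<close> by (cases n) auto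
      then have "F k = (\<lambda>z. 0)" using N by blast
      then show ?thesis unfolding k(1) creation_Suc by (simp add: create_def)
    qed
  qed
qed

lemma fock_annihilation: "F \<in> fock \<Longrightarrow> annihilation qp qm a b F \<in> fock"
proof -
  assume a: "F \<in> fock"
  obtain N where N: "\<forall>n\<ge>N. F n = (\<lambda>z. 0)" using a fock_bound by metis
  show ?thesis
    by (rule fockI[where N = N])
      (use N a in \<open>auto simp: annihilation_def ann_op_def[of _ _ _ _ _ "\<lambda>z. 0"] intro: tensor_power_ann fock_tensor\<close>)
qed

text \<open>The seminorm is a finite sum of nonnegative terms, so each of them vanishes and
  \<open>P_op_null\<close> puts every degree into the kernel of P. In this form the relation is
  visibly linear and an equivalence.\<close>

lemma null_rel_iff:
  assumes "admissible qp qm"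
  shows "(F, G) \<in> null_rel qp qm \<longleftrightarrow> F \<in> fock \<and> G \<in> fock \<and> (\<forall>n. P_op qp qm n (F n) = P_op qp qm n (G n))"
proof -
  have "fock_inner qp qm D D = 0 \<longleftrightarrow> (\<forall>n. P_op qp qm n (D n) = (\<lambda>z. 0))" if D: "D \<in> fock" for D :: "'a fvec"
  proof -
    obtain N where N: "\<And>n. n \<ge> N \<Longrightarrow> D n = (\<lambda>z. 0)" using fock_bound[OF D] by metis
    let ?t = "\<lambda>n. tensor_inner n (D n) (P_op qp qm n (D n))"
    have nn: "?t n \<in> \<real>\<^sub>\<ge>\<^sub>0" for n using P_op_nonneg[OF assms fock_tensor[OF D]] .
    then have nn': "0 \<le> Re (?t n)" "Im (?t n) = 0" for n by (simp_all add: complex_nonneg_Reals_iff)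
    have eq: "fock_inner qp qm D D = (\<Sum>n<N. ?t n)" by (rule fock_inner_eq[OF D N])
    show ?thesis
    proof
      assume "fock_inner qp qm D D = 0"
      then have "(\<Sum>n<N. Re (?t n)) = 0" unfolding eq by (metis Re_sum zero_complex.sel(1))
      then have "\<forall>n<N. Re (?t n) = 0" using nn'(1) by (subst (asm) sum_nonneg_eq_0_iff) auto
      then have "?t n = 0" if "n < N" for n using that nn'(2) by (simp add: complex_eq_iff)
      then have "P_op qp qm n (D n) = (\<lambda>z. 0)" if "n < N" for n
        using that P_op_null[OF assms fock_tensor[OF D]] by blast
      moreover have "P_op qp qm n (D n) = (\<lambda>z. 0)" if "n \<ge> N" for n
        using N[OF that] by (simp add: P_op_zero)
      ultimately show "\<forall>n. P_op qp qm n (D n) = (\<lambda>z. 0)" by (metis linorder_not_less)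
    next
      assume "\<forall>n. P_op qp qm n (D n) = (\<lambda>z. 0)"
      then show "fock_inner qp qm D D = 0"
        unfolding fock_inner_def by (simp add: tensor_inner_zero_right fock_tensor[OF D])
    qed
  qed
  moreover have "P_op qp qm n (fock_diff F G n) = (\<lambda>z. 0) \<longleftrightarrow> P_op qp qm n (F n) = P_op qp qm n (G n)" for n
    unfolding fock_diff_def P_op_diff by (auto simp: fun_eq_iff)
  ultimately show ?thesis
    unfolding null_rel_def using fock_fock_diff by auto
qed

section \<open>Operators on classes\<close>

definition cls :: "real \<Rightarrow> real \<Rightarrow> 'a::real_inner fvec \<Rightarrow> 'a fvec set" where
  "cls qp qm F = null_rel qp qm `` {F}"

lemma mem_cls:
  assumes "admissible qp qm" "F \<in> fock"
  shows "G \<in> cls qp qm F \<longleftrightarrow> G \<in> fock \<and> (\<forall>n. P_op qp qm n (G n) = P_op qp qm n (F n))"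
  unfolding cls_def using null_rel_iff[OF assms(1)] assms(2) by auto

lemma cls_eqI:
  assumes "admissible qp qm" "F \<in> fock" "G \<in> fock" "\<And>n. P_op qp qm n (G n) = P_op qp qm n (F n)"
  shows "cls qp qm F = cls qp qm G"
  by (simp add: set_eq_iff mem_cls[OF assms(1,2)] mem_cls[OF assms(1,3)] assms(4))

lemma fock_quot_iff: "A \<in> fock_quot qp qm \<longleftrightarrow> (\<exists>F\<in>fock. A = cls qp qm F)"
  unfolding fock_quot_def quotient_def cls_def by auto

text \<open>By self-adjointness P can be put on either argument, so the form depends only on the
  images of its arguments under P.\<close>

lemma fock_inner_cong:
  assumes "F \<in> fock" "F' \<in> fock" "G \<in> fock" "G' \<in> fock"
    and "\<And>n. P_op qp qm n (F' n) = P_op qp qm n (F n)" "\<And>n. P_op qp qm n (G' n) = P_op qp qm n (G n)"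
  shows "fock_inner qp qm F' G' = fock_inner qp qm F G"
proof -
  obtain N1 N2 where N: "\<forall>n\<ge>N1. G n = (\<lambda>z. 0)" "\<forall>n\<ge>N2. G' n = (\<lambda>z. 0)"
    using assms fock_bound by metis
  let ?N = "max N1 N2"
  have "tensor_inner n (F' n) (P_op qp qm n (G' n)) = tensor_inner n (F n) (P_op qp qm n (G n))" for n
    unfolding assms(6)
    using P_op_self_adjoint[OF fock_tensor[OF assms(1)] fock_tensor[OF assms(3)], where qp = qp and qm = qm and n = n]
      P_op_self_adjoint[OF fock_tensor[OF assms(2)] fock_tensor[OF assms(3)], where qp = qp and qm = qm and n = n] assms(5) by simp
  then show ?thesis
    using fock_inner_eq[OF assms(2), of ?N G'] fock_inner_eq[OF assms(1), of ?N G] N by simp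
qed

lemma quot_inner_cls:
  assumes adm: "admissible qp qm" and F: "F \<in> fock" and G: "G \<in> fock"
  shows "quot_inner qp qm (cls qp qm F) (cls qp qm G) = fock_inner qp qm F G"
  unfolding quot_inner_def
proof (rule the_equality)
  show "\<exists>F'\<in>cls qp qm F. \<exists>G'\<in>cls qp qm G. fock_inner qp qm F G = fock_inner qp qm F' G'"
    using mem_cls[OF adm F] mem_cls[OF adm G] F G by blast
next
  fix c assume "\<exists>F'\<in>cls qp qm F. \<exists>G'\<in>cls qp qm G. c = fock_inner qp qm F' G'"
  then obtain F' G' where "F' \<in> cls qp qm F" "G' \<in> cls qp qm G" "c = fock_inner qp qm F' G'" by blast
  then show "c = fock_inner qp qm F G"
    using mem_cls[OF adm F] mem_cls[OF adm G] fock_inner_cong[OF F _ G] by metis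
qed

text \<open>Operations on classes are saturated images of sets of representatives. When these are
  mutually equivalent, the saturation is a single class.\<close>

lemma Image_cls:
  assumes adm: "admissible qp qm" and F: "F \<in> fock" "F \<in> S"
    and S: "\<And>G. G \<in> S \<Longrightarrow> G \<in> fock \<and> (\<forall>n. P_op qp qm n (G n) = P_op qp qm n (F n))"
  shows "null_rel qp qm `` S = cls qp qm F"
proof -
  have eq: "cls qp qm G = cls qp qm F" if "G \<in> S" for G
    using cls_eqI[OF adm, of G F] S[OF that] F(1) by metis
  have "null_rel qp qm `` S = (\<Union>G\<in>S. cls qp qm G)" unfolding cls_def by blast
  also have "\<dots> = (\<Union>G\<in>S. cls qp qm F)" by (rule SUP_cong[OF refl eq])
  also have "\<dots> = cls qp qm F" using F(2) by (simp add: ex_in_conv[symmetric] del: ex_in_conv) blast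
  finally show ?thesis .
qed

lemma quot_add_cls:
  assumes adm: "admissible qp qm" and F: "F \<in> fock" and G: "G \<in> fock"
  shows "quot_add qp qm (cls qp qm F) (cls qp qm G) = cls qp qm (fock_add F G)"
  unfolding quot_add_def
proof (rule Image_cls[OF adm])
  show "fock_add F G \<in> fock" using fock_fock_add[OF F G] .
  show "fock_add F G \<in> {fock_add F' G' |F' G'. F' \<in> cls qp qm F \<and> G' \<in> cls qp qm G}"
    using mem_cls[OF adm F] mem_cls[OF adm G] F G by blast
next
  fix H assume "H \<in> {fock_add F' G' |F' G'. F' \<in> cls qp qm F \<and> G' \<in> cls qp qm G}"
  then obtain F' G' where H: "H = fock_add F' G'" and F': "F' \<in> cls qp qm F" and G': "G' \<in> cls qp qm G" by blast
  have "P_op qp qm n (H n) = P_op qp qm n (fock_add F G n)" for n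
    unfolding H fock_add_def P_op_add using F' G' mem_cls[OF adm F] mem_cls[OF adm G] by simp
  then show "H \<in> fock \<and> (\<forall>n. P_op qp qm n (H n) = P_op qp qm n (fock_add F G n))"
    using H F' G' mem_cls[OF adm F] mem_cls[OF adm G] fock_fock_add by blast
qed

text \<open>Pairing \<open>h\<close> with P of a created tensor is pairing the annihilated
  \<open>h\<close> with P f, so only P f matters.\<close>

lemma P_op_create_cong:
  assumes f: "f \<in> tensor_power n" and g: "g \<in> tensor_power n" and eq: "P_op qp qm n f = P_op qp qm n g"
  shows "P_op qp qm (Suc n) (create n a b f) = P_op qp qm (Suc n) (create n a b g)"
proof -
  have c: "create n a b f \<in> tensor_power (Suc n)" "create n a b g \<in> tensor_power (Suc n)"
    using f g by (auto intro: tensor_power_create)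
  have "tensor_inner (Suc n) h (P_op qp qm (Suc n) (create n a b f)) =
      tensor_inner (Suc n) h (P_op qp qm (Suc n) (create n a b g))" if "h \<in> tensor_power (Suc n)" for h
    unfolding ann_op_adjoint[OF that f, symmetric] ann_op_adjoint[OF that g, symmetric] eq ..
  then have "tensor_inner (Suc n) (simple_tensor (Suc n) z) (P_op qp qm (Suc n) (create n a b f)) =
      tensor_inner (Suc n) (simple_tensor (Suc n) z) (P_op qp qm (Suc n) (create n a b g))" for z
    using tensor_power_simple by blast
  then show ?thesis
    by (simp add: tensor_inner_simple[OF tensor_power_P[OF c(1)]] tensor_inner_simple[OF tensor_power_P[OF c(2)]] fun_eq_iff)
qed

lemma b_star_cls:
  assumes adm: "admissible qp qm" and F: "F \<in> fock"
  shows "b_star qp qm a b (cls qp qm F) = cls qp qm (creation a b F)"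
  unfolding b_star_def
proof (rule Image_cls[OF adm])
  show "creation a b F \<in> fock" using fock_creation[OF F] .
  show "creation a b F \<in> creation a b ` cls qp qm F"
    using mem_cls[OF adm F] F by blast
next
  fix H assume "H \<in> creation a b ` cls qp qm F"
  then obtain F' where H: "H = creation a b F'" and F': "F' \<in> cls qp qm F" by blast
  then have F'': "F' \<in> fock" "\<And>n. P_op qp qm n (F' n) = P_op qp qm n (F n)" using mem_cls[OF adm F] by auto
  have "P_op qp qm n (H n) = P_op qp qm n (creation a b F n)" for n
  proof (cases n)
    case (Suc k)
    show ?thesis unfolding Suc H creation_Suc
      by (rule P_op_create_cong) (use fock_tensor F F'' in auto)
  qed (simp add: H creation_0)
  then show "H \<in> fock \<and> (\<forall>n. P_op qp qm n (H n) = P_op qp qm n (creation a b F n))"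
    using H F''(1) fock_creation by blast
qed

lemma fock_inner_annihilation:
  assumes F: "F \<in> fock" and G: "G \<in> fock"
  shows "fock_inner qp qm (annihilation qp qm a b F) G = fock_inner qp qm F (creation a b G)"
proof -
  obtain N where N: "\<And>n. n \<ge> N \<Longrightarrow> G n = (\<lambda>z. 0)" using fock_bound[OF G] by metis
  have "creation a b G n = (\<lambda>z. 0)" if "n \<ge> Suc N" for n
  proof -
    obtain k where "n = Suc k" "k \<ge> N" using \<open>n \<ge> Suc N\<close> by (cases n) auto
    then show ?thesis using N by (simp add: creation_Suc create_def)
  qed
  then have "fock_inner qp qm F (creation a b G) =
      (\<Sum>n<Suc N. tensor_inner n (F n) (P_op qp qm n (creation a b G n)))"
    by (rule fock_inner_eq[OF F])
  also have "\<dots> = (\<Sum>n<N. tensor_inner (Suc n) (F (Suc n)) (P_op qp qm (Suc n) (creation a b G (Suc n))))"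
    unfolding sum.lessThan_Suc_shift
    by (simp add: creation_0 P_op_zero tensor_inner_zero_right fock_tensor[OF F])
  also have "\<dots> = (\<Sum>n<N. tensor_inner n (annihilation qp qm a b F n) (P_op qp qm n (G n)))"
    unfolding creation_Suc annihilation_def
    by (simp add: ann_op_adjoint fock_tensor[OF F] fock_tensor[OF G])
  also have "\<dots> = fock_inner qp qm (annihilation qp qm a b F) G"
    by (rule fock_inner_eq[OF fock_annihilation[OF F] N, symmetric])
  finally show ?thesis by simp
qed

text \<open>Tested on a simple tensor placed in degree n, the form returns the conjugate of the
  value of P F at that argument. This is the uniqueness behind the definite description in
  \<open>quot_adjoint\<close>.\<close>

lemma fock_inner_eqI:
  assumes B: "B \<in> fock" and A: "A \<in> fock"
    and eq: "\<And>C. C \<in> fock \<Longrightarrow> fock_inner qp qm B C = fock_inner qp qm A C"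
  shows "P_op qp qm n (B n) = P_op qp qm n (A n)"
proof
  fix z :: "int \<Rightarrow> 'a cplxn"
  define C where "C = (\<lambda>k. if k = n then simple_tensor n z else (\<lambda>z. 0))"
  have C: "C \<in> fock"
    by (rule fockI[where N = "Suc n"]) (auto simp: C_def tensor_power_simple tensor_power_zero)
  have ev: "fock_inner qp qm F C = cnj (P_op qp qm n (F n) z)" if F: "F \<in> fock" for F
  proof -
    have "fock_inner qp qm F C = (\<Sum>k<Suc n. tensor_inner k (F k) (P_op qp qm k (C k)))"
      by (rule fock_inner_eq[OF F]) (auto simp: C_def)
    also have "\<dots> = tensor_inner n (F n) (P_op qp qm n (simple_tensor n z))"
      using fock_tensor[OF F] by (simp add: C_def P_op_zero tensor_inner_zero_right)
    also have "\<dots> = tensor_inner n (P_op qp qm n (F n)) (simple_tensor n z)"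
      by (rule P_op_self_adjoint[symmetric]) (auto intro: fock_tensor F tensor_power_simple)
    also have "\<dots> = cnj (tensor_inner n (simple_tensor n z) (P_op qp qm n (F n)))"
      by (rule tensor_inner_commute) (auto intro: fock_tensor F tensor_power_simple tensor_power_P)
    finally show ?thesis
      by (simp add: tensor_inner_simple tensor_power_P fock_tensor[OF F])
  qed
  show "P_op qp qm n (B n) z = P_op qp qm n (A n) z"
    using eq[OF C] ev[OF A] ev[OF B] by simp
qed

lemma b_op_cls:
  assumes adm: "admissible qp qm" and F: "F \<in> fock"
  shows "b_op qp qm a b (cls qp qm F) = cls qp qm (annihilation qp qm a b F)"
  unfolding b_op_def quot_adjoint_def
proof (rule the_equality)
  let ?A = "annihilation qp qm a b F"
  have A: "?A \<in> fock" using fock_annihilation[OF F] .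
  have adj: "quot_inner qp qm (cls qp qm F) (b_star qp qm a b (cls qp qm C)) = fock_inner qp qm ?A C"
    if "C \<in> fock" for C
    using that F by (simp add: b_star_cls[OF adm] quot_inner_cls[OF adm] fock_creation fock_inner_annihilation)
  show "cls qp qm ?A \<in> fock_quot qp qm \<and> (\<forall>C\<in>fock_quot qp qm.
      quot_inner qp qm (cls qp qm ?A) C = quot_inner qp qm (cls qp qm F) (b_star qp qm a b C))"
    using A adj quot_inner_cls[OF adm A] by (auto simp: fock_quot_iff)
  fix B assume B: "B \<in> fock_quot qp qm \<and> (\<forall>C\<in>fock_quot qp qm.
      quot_inner qp qm B C = quot_inner qp qm (cls qp qm F) (b_star qp qm a b C))"
  then obtain B' where B': "B' \<in> fock" "B = cls qp qm B'" by (auto simp: fock_quot_iff)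
  have "fock_inner qp qm B' C = fock_inner qp qm ?A C" if C: "C \<in> fock" for C
  proof -
    have "cls qp qm C \<in> fock_quot qp qm" using C by (auto simp: fock_quot_iff)
    then show ?thesis using B adj[OF C] quot_inner_cls[OF adm B'(1) C] B'(2) by auto
  qed
  then show "B = cls qp qm ?A"
    unfolding B'(2) by (intro cls_eqI[OF adm B'(1) A]) (metis fock_inner_eqI B'(1) A)
qed

section \<open>Gaussian operators on classes and the vacuum state\<close>

definition gauss_step :: "real \<Rightarrow> real \<Rightarrow> 'a::real_inner \<Rightarrow> 'a fvec \<Rightarrow> 'a fvec" where
  "gauss_step qp qm x F = fock_add (annihilation qp qm (of_H\<^sub>R x) (of_H\<^sub>R x) F) (creation (of_H\<^sub>R x) (of_H\<^sub>R x) F)"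

lemma fock_gauss_step: "F \<in> fock \<Longrightarrow> gauss_step qp qm x F \<in> fock"
  unfolding gauss_step_def by (intro fock_fock_add fock_annihilation fock_creation)

lemma G_op_cls:
  assumes adm: "admissible qp qm" and F: "F \<in> fock"
  shows "G_op qp qm x (cls qp qm F) = cls qp qm (gauss_step qp qm x F)"
  unfolding G_op_def gauss_step_def b_op_cls[OF assms] b_star_cls[OF assms]
  by (rule quot_add_cls[OF adm fock_annihilation[OF F] fock_creation[OF F]])

text \<open>The first entry of the list acts first, so composing over the reversed list is a
  \<open>fold\<close> over the list. The vacuum pairs with degree 0 only, where P is the identity
  and \<open>simple_tensor 0 z\<close> is the constant 1 for every \<open>z\<close>.\<close>

lemma vacuum_state_G_ops:
  assumes adm: "admissible qp qm"
  shows "vacuum_state qp qm (foldr (\<circ>) (map (\<lambda>i. G_op qp qm (x i)) (rev is)) id) =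
    fold (\<lambda>i. gauss_step qp qm (x i)) is vacuum 0 z"
proof -
  have comp: "foldr (\<circ>) (map f js) id A = foldr f js A" for f and A :: "'a fvec set" and js :: "'b list"
    by (induction js) auto
  have f: "fold (\<lambda>i. gauss_step qp qm (x i)) is F \<in> fock \<and>
      fold (\<lambda>i. G_op qp qm (x i)) is (cls qp qm F) = cls qp qm (fold (\<lambda>i. gauss_step qp qm (x i)) is F)"
    if "F \<in> fock" for F
    using that by (induction "is" arbitrary: F) (auto simp: G_op_cls[OF adm] fock_gauss_step)
  let ?\<Psi> = "fold (\<lambda>i. gauss_step qp qm (x i)) is vacuum"
  have \<Psi>: "?\<Psi> \<in> fock" using f[OF fock_vacuum] by blast
  have T: "foldr (\<circ>) (map (\<lambda>i. G_op qp qm (x i)) (rev is)) id A = fold (\<lambda>i. G_op qp qm (x i)) is A" for A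
    unfolding comp by (simp only: foldr_conv_fold rev_rev_ident)
  have "vacuum_state qp qm (foldr (\<circ>) (map (\<lambda>i. G_op qp qm (x i)) (rev is)) id) = fock_inner qp qm vacuum ?\<Psi>"
    unfolding vacuum_state_def Let_def T cls_def[symmetric]
    using f[OF fock_vacuum] quot_inner_cls[OF adm fock_vacuum \<Psi>] by simp
  also obtain N where N: "\<And>n. n \<ge> N \<Longrightarrow> ?\<Psi> n = (\<lambda>z. 0)" using fock_bound[OF \<Psi>] by metis
  have "fock_inner qp qm vacuum ?\<Psi> = (\<Sum>n<Suc N. tensor_inner n (vacuum n) (P_op qp qm n (?\<Psi> n)))"
    by (rule fock_inner_eq[OF fock_vacuum]) (use N in auto)
  also have "\<dots> = tensor_inner 0 (vacuum 0) (P_op qp qm 0 (?\<Psi> 0))"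
  proof -
    have "tensor_inner n (vacuum n) g = 0" if "n > 0" "g \<in> tensor_power n" for n and g :: "'a tensor"
      using that tensor_inner_eval[OF that(2), of "[]"] by (simp add: vacuum_def tensor_comb_Nil)
    then show ?thesis
      unfolding sum.lessThan_Suc_shift by (simp add: tensor_power_P fock_tensor[OF \<Psi>])
  qed
  also have "vacuum 0 = simple_tensor 0 z" by (simp add: vacuum_def simple_tensor_def pm_def fun_eq_iff)
  also have "tensor_inner 0 (simple_tensor 0 z) (P_op qp qm 0 (?\<Psi> 0)) = P_op qp qm 0 (?\<Psi> 0) z"
    by (rule tensor_inner_simple) (intro tensor_power_P fock_tensor \<Psi>)
  also have "\<dots> = ?\<Psi> 0 z"
  proof -
    have "pm 0 = {}" by (auto simp: pm_def)
    then have "sperm (pm 0) = {id}" by (auto simp: sperm_def)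
    then show ?thesis unfolding P_op_eq using \<open>pm 0 = {}\<close> by (simp add: wt_empty)
  qed
  finally show ?thesis .
qed

section \<open>Gaussian operators on symmetric simple tensors\<close>


text \<open>Creation and annihilation by \<open>of_H\<^sub>R x\<close> in both slots preserve the
  span of these tensors, so a state is described by real vectors indexed by positive
  integers.\<close>

definition symT :: "nat \<Rightarrow> (nat \<Rightarrow> 'a::real_inner) \<Rightarrow> 'a tensor" where
  "symT n v = simple_tensor n (\<lambda>i. of_H\<^sub>R (v (nat \<bar>i\<bar>)))"

lemma cinner_of_HR: "cinner (of_H\<^sub>R x) (of_H\<^sub>R y) = complex_of_real (x \<bullet> y)"
  by (simp add: cinner_def of_H\<^sub>R_def complex_eq_iff)

lemma simple_tensor_cong:
  "(\<And>i. i \<in> pm n \<Longrightarrow> x i = y i) \<Longrightarrow> simple_tensor n x = simple_tensor n y"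
  unfolding simple_tensor_def by (intro ext prod.cong) auto

lemma sum_pm_abs: "(\<Sum>j\<in>pm n. g (nat \<bar>j\<bar>)) = 2 * (\<Sum>i\<in>{1..n}. g i)" for g :: "nat \<Rightarrow> complex"
proof -
  have "(\<lambda>i. - int i) ` {1..n} = uminus ` int ` {1..n}" by (simp add: image_image)
  then have pm: "pm n = int ` {1..n} \<union> (\<lambda>i. - int i) ` {1..n}"
    unfolding image_int_atLeastAtMost by (auto simp: pm_def)
  have "(\<Sum>j\<in>pm n. g (nat \<bar>j\<bar>)) = (\<Sum>j\<in>int ` {1..n}. g (nat \<bar>j\<bar>)) + (\<Sum>j\<in>(\<lambda>i. - int i) ` {1..n}. g (nat \<bar>j\<bar>))"
    unfolding pm by (rule sum.union_disjoint) auto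
  also have "\<dots> = (\<Sum>i\<in>{1..n}. g i) + (\<Sum>i\<in>{1..n}. g i)"
    by (subst (1 2) sum.reindex) (auto simp: inj_on_def)
  finally show ?thesis by simp
qed

text \<open>\<open>st j m\<close> brings the vector of slot |j| to both outer slots, whose
  contraction with \<open>x\<close> gives a square, and moves the outer vector into the slots
  \<plusminus>j. The indices \<open>j\<close> and \<open>- j\<close> give the same tensor, whence
  the factors 2 q_+ and 1 + q_-.\<close>

lemma ann_op_symT:
  fixes v :: "nat \<Rightarrow> 'a::real_inner" and x :: 'a
  shows "ann_op qp qm n (of_H\<^sub>R x) (of_H\<^sub>R x) (symT (Suc n) v) z =
    complex_of_real ((1 + qm) * (x \<bullet> v (Suc n))\<^sup>2) * symT n v z +
    (\<Sum>i\<in>{1..n}. complex_of_real (2 * qp * (x \<bullet> v i)\<^sup>2) * symT n (v(i := v (Suc n))) z)"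
proof -
  let ?m = "int (Suc n)" and ?a = "of_H\<^sub>R x" and ?u = "\<lambda>i. of_H\<^sub>R (v (nat \<bar>i\<bar>))"
  have m: "?m \<noteq> 0" "?m \<notin> pm n" "- ?m \<notin> pm n" by (auto simp: pm_def)
  have t: "symT (Suc n) v (plug n ?a ?a z \<circ> st j ?m) =
      complex_of_real ((x \<bullet> v (nat \<bar>j\<bar>))\<^sup>2) * simple_tensor n (?u \<circ> st j ?m) z" if j: "j \<in> pm (Suc n)" for j
  proof -
    have s: "st j ?m permutes pm (Suc n)" using st_sperm_pm[OF j] by (rule sperm_pm_permutes)
    have j0: "j \<noteq> 0" using j pm_props(2) by metis
    have "st j ?m \<circ> st j ?m = id" using j0 m(1) by (auto simp: fun_eq_iff st_invol)
    then have "inv (st j ?m) = st j ?m" by (rule inv_unique_comp[rotated]) fact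
    then have "symT (Suc n) v (plug n ?a ?a z \<circ> st j ?m) = simple_tensor (Suc n) (?u \<circ> st j ?m) (plug n ?a ?a z)"
      unfolding symT_def simple_tensor_perm[OF s] by simp
    also have "\<dots> = cinner ?a (?u (st j ?m (- ?m))) * cinner ?a (?u (st j ?m ?m)) * simple_tensor n (?u \<circ> st j ?m) z"
      unfolding simple_tensor_plug by simp
    also have "st j ?m ?m = j" by (auto simp: st_def)
    also have "st j ?m (- ?m) = - j" using st_neg[OF j0 m(1), of ?m] \<open>st j ?m ?m = j\<close> by simp
    finally show ?thesis by (simp add: cinner_of_HR power2_eq_square del: o_apply)
  qed
  have t1: "simple_tensor n (?u \<circ> st j ?m) = symT n v" if "j = ?m \<or> j = - ?m" for j
    unfolding symT_def using that m by (intro simple_tensor_cong) (auto simp: st_def)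
  have t2: "simple_tensor n (?u \<circ> st j ?m) = symT n (v(nat \<bar>j\<bar> := v (Suc n)))" if "j \<in> pm n" for j
    unfolding symT_def
  proof (rule simple_tensor_cong)
    fix i assume i: "i \<in> pm n"
    have "i \<noteq> ?m" "i \<noteq> - ?m" using i m by auto
    moreover have "nat \<bar>i\<bar> = nat \<bar>j\<bar> \<longleftrightarrow> i = j \<or> i = - j" by linarith
    ultimately show "(?u \<circ> st j ?m) i = of_H\<^sub>R ((v(nat \<bar>j\<bar> := v (Suc n))) (nat \<bar>i\<bar>))"
      by (simp add: st_def nat_add_distrib)
  qed
  let ?g = "\<lambda>j. complex_of_real (stw qp qm j ?m) * symT (Suc n) v (plug n ?a ?a z \<circ> st j ?m)"
  have "ann_op qp qm n ?a ?a (symT (Suc n) v) z = sum ?g (pm n) + (?g ?m + ?g (- ?m))"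
  proof -
    have "sum ?g (pm (Suc n)) = sum ?g (pm n) + sum ?g {?m, - ?m}"
      unfolding pm_Suc by (rule sum.union_disjoint) (use m in auto)
    then show ?thesis unfolding ann_op_def by simp
  qed
  also have "sum ?g (pm n) = (\<Sum>j\<in>pm n. (\<lambda>i. complex_of_real (qp * (x \<bullet> v i)\<^sup>2) * symT n (v(i := v (Suc n))) z) (nat \<bar>j\<bar>))"
  proof (rule sum.cong[OF refl])
    fix j assume j: "j \<in> pm n"
    then have "j \<noteq> ?m" "j \<noteq> - ?m" "j \<in> pm (Suc n)" using m by (auto simp: pm_Suc)
    then show "?g j = (\<lambda>i. complex_of_real (qp * (x \<bullet> v i)\<^sup>2) * symT n (v(i := v (Suc n))) z) (nat \<bar>j\<bar>)"
      using t[of j] t2[OF j] by (simp add: stw_def)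
  qed
  also have "\<dots> = 2 * (\<Sum>i\<in>{1..n}. complex_of_real (qp * (x \<bullet> v i)\<^sup>2) * symT n (v(i := v (Suc n))) z)"
    by (rule sum_pm_abs)
  also have "?g ?m + ?g (- ?m) = complex_of_real ((1 + qm) * (x \<bullet> v (Suc n))\<^sup>2) * symT n v z"
  proof -
    have "?m \<in> pm (Suc n)" "- ?m \<in> pm (Suc n)" by (auto simp: pm_Suc)
    moreover have "nat \<bar>?m\<bar> = Suc n" "nat \<bar>- ?m\<bar> = Suc n" by auto
    ultimately show ?thesis using t[of ?m] t[of "- ?m"] t1[of ?m] t1[of "- ?m"] m(1)
      by (simp add: stw_def distrib_right del: of_nat_Suc)
  qed
  finally show ?thesis by (simp add: sum_distrib_left mult.assoc del: fun_upd_apply)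
qed

lemma create_symT:
  "create n (of_H\<^sub>R x) (of_H\<^sub>R x) (symT n v) = symT (Suc n) (v(Suc n := x))"
proof -
  have "create n (of_H\<^sub>R x) (of_H\<^sub>R x) (symT n v) =
      simple_tensor (Suc n) (plug n (of_H\<^sub>R x) (of_H\<^sub>R x) (\<lambda>i. of_H\<^sub>R (v (nat \<bar>i\<bar>))))"
    unfolding symT_def create_simple ..
  also have "\<dots> = symT (Suc n) (v(Suc n := x))"
    unfolding symT_def
  proof (rule simple_tensor_cong)
    fix i :: int
    have "nat \<bar>i\<bar> = Suc n \<longleftrightarrow> i = int (Suc n) \<or> i = - int (Suc n)" by linarith
    then show "plug n (of_H\<^sub>R x) (of_H\<^sub>R x) (\<lambda>i. of_H\<^sub>R (v (nat \<bar>i\<bar>))) i = of_H\<^sub>R ((v(Suc n := x)) (nat \<bar>i\<bar>))"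
      by (auto simp: plug_def)
  qed
  finally show ?thesis .
qed

text \<open>
  \<open>U\<close> lists the remaining points, \<open>D\<close> is the stack of open left legs (top first); \<open>y\<close> is updated because
  a path of alternating pairs is contracted to its end point.
\<close>

fun stack_sum :: "real \<Rightarrow> real \<Rightarrow> int list \<Rightarrow> int list \<Rightarrow> (int \<Rightarrow> 'a::real_inner) \<Rightarrow> real" where
  "stack_sum qp qm [] D y = (if D = [] then 1 else 0)"
| "stack_sum qp qm (t # U) [] y = stack_sum qp qm U [t] y"
| "stack_sum qp qm (t # U) (d # D) y = stack_sum qp qm U (t # d # D) y +
     ((1 + qm) * (y t \<bullet> y d)\<^sup>2 * stack_sum qp qm U D y +
      (\<Sum>i\<in>set D. 2 * qp * (y t \<bullet> y i)\<^sup>2 * stack_sum qp qm U D (y(i := y d))))"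

text \<open>Slots are counted from 1 with the bottom of the stack innermost, hence
  \<open>rev D ! (i - 1)\<close>. The top occupies the outer slots, the ones that creation adds and
  annihilation contracts.\<close>

definition stack_vec :: "int list \<Rightarrow> (int \<Rightarrow> 'a::real_inner) \<Rightarrow> 'a fvec" where
  "stack_vec D y = (\<lambda>k. if k = length D then symT k (\<lambda>i. y (rev D ! (i - 1))) else (\<lambda>z. 0))"

lemma symT_cong: "(\<And>i. 1 \<le> i \<Longrightarrow> i \<le> n \<Longrightarrow> v i = v' i) \<Longrightarrow> symT n v = symT n v'"
  unfolding symT_def by (rule simple_tensor_cong) (auto simp: pm_def)

lemma ann_op_zero: "ann_op qp qm n a b (\<lambda>z. 0) = (\<lambda>z. 0)"
  by (simp add: ann_op_def)

lemma creation_stack_vec: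
  "creation (of_H\<^sub>R x) (of_H\<^sub>R x) (stack_vec D y) = stack_vec (t # D) y" if "y t = x"
proof
  fix k
  show "creation (of_H\<^sub>R x) (of_H\<^sub>R x) (stack_vec D y) k = stack_vec (t # D) y k"
  proof (cases k)
    case (Suc n)
    show ?thesis
    proof (cases "n = length D")
      case True
      have "symT (Suc n) ((\<lambda>i. y (rev D ! (i - 1)))(Suc n := x)) = symT (Suc n) (\<lambda>i. y (rev (t # D) ! (i - 1)))"
      proof (rule symT_cong)
        fix i assume i: "1 \<le> i" "i \<le> Suc n"
        have "i - 1 < length D" if "i \<noteq> Suc n" using i that True by linarith
        with i show "((\<lambda>i. y (rev D ! (i - 1)))(Suc n := x)) i = y (rev (t # D) ! (i - 1))"
          using True that by (cases "i = Suc n") (simp_all add: nth_append)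
      qed
      note eq = this
      have "stack_vec D y n = symT n (\<lambda>i. y (rev D ! (i - 1)))"
        "stack_vec (t # D) y (Suc n) = symT (Suc n) (\<lambda>i. y (rev (t # D) ! (i - 1)))"
        unfolding stack_vec_def using True by auto
      then show ?thesis
        unfolding Suc creation_Suc by (simp only: create_symT eq)
    next
      case False
      then show ?thesis unfolding Suc creation_Suc by (simp add: stack_vec_def create_def)
    qed
  qed (simp add: creation_0 stack_vec_def)
qed

text \<open>Distinct entries make slots and stack entries correspond bijectively, so replacing the
  content of a slot is an update of \<open>y\<close> at a single entry.\<close>

lemma annihilation_stack_vec:
  fixes y :: "int \<Rightarrow> 'a::real_inner"
  assumes "distinct (d # D)"
  shows "annihilation qp qm (of_H\<^sub>R x) (of_H\<^sub>R x) (stack_vec (d # D) y) = (\<lambda>k z.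
    complex_of_real ((1 + qm) * (x \<bullet> y d)\<^sup>2) * stack_vec D y k z +
    (\<Sum>i\<in>set D. complex_of_real (2 * qp * (x \<bullet> y i)\<^sup>2) * stack_vec D (y(i := y d)) k z))"
proof (intro ext)
  fix k z
  show "annihilation qp qm (of_H\<^sub>R x) (of_H\<^sub>R x) (stack_vec (d # D) y) k z =
    complex_of_real ((1 + qm) * (x \<bullet> y d)\<^sup>2) * stack_vec D y k z +
    (\<Sum>i\<in>set D. complex_of_real (2 * qp * (x \<bullet> y i)\<^sup>2) * stack_vec D (y(i := y d)) k z)"
  proof (cases "k = length D")
    case True
    let ?v = "\<lambda>i. y (rev (d # D) ! (i - 1))"
    have vt: "?v (Suc k) = y d" using True by (simp add: nth_append)
    have vi: "?v i = y (rev D ! (i - 1))" if "i \<in> {1..k}" for i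
      using that True by (auto simp: nth_append)
    have bij: "bij_betw (\<lambda>i. rev D ! (i - 1)) {1..k} (set D)"
    proof -
      have b1: "bij_betw (\<lambda>i. i - 1) {1..k} {..<k}"
        by (rule bij_betw_byWitness[where f' = Suc]) auto
      have "bij_betw ((!) (rev D)) {..<k} (set D)"
        using assms True bij_betw_nth[of "rev D" "{..<k}" "set D"] by simp
      from bij_betw_trans[OF b1 this] show ?thesis by (simp add: comp_def)
    qed
    have upd: "symT k (?v(i := ?v (Suc k))) = symT k (\<lambda>l. (y(rev D ! (i - 1) := y d)) (rev D ! (l - 1)))"
      if i: "i \<in> {1..k}" for i
    proof (rule symT_cong)
      fix l assume l: "1 \<le> l" "l \<le> k"
      have "rev D ! (l - 1) = rev D ! (i - 1) \<longleftrightarrow> l = i"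
        using inj_on_eq_iff[OF bij_betw_imp_inj_on[OF bij], of l i] l i by simp
      moreover have "?v l = y (rev D ! (l - 1))" using vi[of l] l by simp
      ultimately show "(?v(i := ?v (Suc k))) l = (y(rev D ! (i - 1) := y d)) (rev D ! (l - 1))"
        unfolding fun_upd_apply vt by (simp del: rev.simps)
    qed
    have "annihilation qp qm (of_H\<^sub>R x) (of_H\<^sub>R x) (stack_vec (d # D) y) k z =
        ann_op qp qm k (of_H\<^sub>R x) (of_H\<^sub>R x) (symT (Suc k) ?v) z"
      using True by (simp add: annihilation_def stack_vec_def)
    also have "\<dots> = complex_of_real ((1 + qm) * (x \<bullet> y d)\<^sup>2) * symT k ?v z +
        (\<Sum>i\<in>{1..k}. complex_of_real (2 * qp * (x \<bullet> ?v i)\<^sup>2) * symT k (?v(i := ?v (Suc k))) z)"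
      unfolding ann_op_symT vt ..
    also have "symT k ?v = stack_vec D y k"
      using True vi by (auto simp: stack_vec_def intro!: symT_cong)
    also have "(\<Sum>i\<in>{1..k}. complex_of_real (2 * qp * (x \<bullet> ?v i)\<^sup>2) * symT k (?v(i := ?v (Suc k))) z) =
        (\<Sum>i\<in>{1..k}. (\<lambda>e. complex_of_real (2 * qp * (x \<bullet> y e)\<^sup>2) * stack_vec D (y(e := y d)) k z) (rev D ! (i - 1)))"
    proof (rule sum.cong[OF refl])
      fix i assume i: "i \<in> {1..k}"
      show "complex_of_real (2 * qp * (x \<bullet> ?v i)\<^sup>2) * symT k (?v(i := ?v (Suc k))) z =
          (\<lambda>e. complex_of_real (2 * qp * (x \<bullet> y e)\<^sup>2) * stack_vec D (y(e := y d)) k z) (rev D ! (i - 1))"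
        unfolding upd[OF i] vi[OF i] using True by (simp add: stack_vec_def)
    qed
    also have "\<dots> = (\<Sum>e\<in>set D. complex_of_real (2 * qp * (x \<bullet> y e)\<^sup>2) * stack_vec D (y(e := y d)) k z)"
      by (rule sum.reindex_bij_betw[OF bij])
    finally show ?thesis .
  next
    case False
    then show ?thesis by (simp add: annihilation_def stack_vec_def ann_op_zero)
  qed
qed

lemma annihilation_stack_vec_Nil:
  "annihilation qp qm a b (stack_vec [] y) = (\<lambda>k z. 0)"
  by (simp add: annihilation_def stack_vec_def ann_op_zero fun_eq_iff)

section \<open>Linearity of iterated Gaussian steps\<close>

definition fv_comb :: "'i set \<Rightarrow> ('i \<Rightarrow> complex) \<Rightarrow> ('i \<Rightarrow> 'a fvec) \<Rightarrow> 'a fvec" where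
  "fv_comb I c F = (\<lambda>k z. \<Sum>i\<in>I. c i * F i k z)"

lemma gauss_step_comb: "gauss_step qp qm x (fv_comb I c F) = fv_comb I c (\<lambda>i. gauss_step qp qm x (F i))"
proof (intro ext)
  fix k z
  have "ann_op qp qm n a b (\<lambda>z. \<Sum>i\<in>I. c i * F i (Suc n) z) z = (\<Sum>i\<in>I. c i * ann_op qp qm n a b (F i (Suc n)) z)" for n a b
    unfolding ann_op_def sum_distrib_left by (subst sum.swap) (simp add: mult.left_commute)
  moreover have "creation a b (\<lambda>k z. \<Sum>i\<in>I. c i * F i k z) k z = (\<Sum>i\<in>I. c i * creation a b (F i) k z)" for a b
    by (cases k) (simp_all add: creation_def sum_distrib_left mult.left_commute mult.assoc)
  ultimately show "gauss_step qp qm x (fv_comb I c F) k z = fv_comb I c (\<lambda>i. gauss_step qp qm x (F i)) k z"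
    by (simp add: gauss_step_def fock_add_def fv_comb_def annihilation_def sum.distrib distrib_left)
qed

lemma fold_gauss_step_comb:
  "fold (\<lambda>t. gauss_step qp qm (y t)) U (fv_comb I c F) = fv_comb I c (\<lambda>i. fold (\<lambda>t. gauss_step qp qm (y t)) U (F i))"
  by (induction U arbitrary: F) (simp_all add: gauss_step_comb)

lemma fold_gauss_step_add:
  "fold (\<lambda>t. gauss_step qp qm (y t)) U (\<lambda>k z. F k z + G k z) k z =
    fold (\<lambda>t. gauss_step qp qm (y t)) U F k z + fold (\<lambda>t. gauss_step qp qm (y t)) U G k z"
  using fold_gauss_step_comb[of qp qm y U UNIV "\<lambda>_. 1" "\<lambda>b. if b then F else G"]
  by (simp add: fv_comb_def UNIV_bool add.commute)

lemma fold_gauss_step_scale: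
  "fold (\<lambda>t. gauss_step qp qm (y t)) U (\<lambda>k z. c * F k z) k z = c * fold (\<lambda>t. gauss_step qp qm (y t)) U F k z"
  using fold_gauss_step_comb[of qp qm y U "{()}" "\<lambda>_. c" "\<lambda>_. F"] by (simp add: fv_comb_def)

text \<open>The operators keep their vectors \<open>y0\<close>, while \<open>y\<close> is altered at
  stack entries by contractions. Distinctness keeps the stack apart from the remaining points, on
  which the two functions have to agree.\<close>

lemma fold_gauss_step_stack_vec:
  fixes y y0 :: "int \<Rightarrow> 'a::real_inner"
  assumes "distinct (U @ D)" "\<And>t. t \<in> set U \<Longrightarrow> y0 t = y t"
  shows "fold (\<lambda>t. gauss_step qp qm (y0 t)) U (stack_vec D y) 0 z = complex_of_real (stack_sum qp qm U D y)"
  using assms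
proof (induction U arbitrary: D y)
  case Nil
  then show ?case by (simp add: stack_vec_def symT_def simple_tensor_def pm_def)
next
  case (Cons t U)
  let ?L = "\<lambda>F. fold (\<lambda>t. gauss_step qp qm (y0 t)) U F 0 z"
  let ?x = "of_H\<^sub>R (y0 t)"
  have yt: "y t = y0 t" using Cons.prems by simp
  have push: "?L (stack_vec (t # D) y) = complex_of_real (stack_sum qp qm U (t # D) y)"
    using Cons.IH[of "t # D" y] Cons.prems by simp
  have step: "gauss_step qp qm (y0 t) (stack_vec D y) =
      (\<lambda>k z. annihilation qp qm ?x ?x (stack_vec D y) k z + stack_vec (t # D) y k z)"
    unfolding gauss_step_def creation_stack_vec[of y t, OF yt] by (simp add: fock_add_def)
  show ?case
  proof (cases D)
    case Nil
    have "gauss_step qp qm (y0 t) (stack_vec D y) = stack_vec (t # D) y"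
      unfolding step unfolding Nil annihilation_stack_vec_Nil by simp
    then show ?thesis using push Nil by simp
  next
    case (Cons d D')
    note D = this
    have dist: "distinct (d # D')" "distinct (U @ D')" using Cons.prems D by auto
    have pop: "?L (stack_vec D' y') = complex_of_real (stack_sum qp qm U D' y')"
      if "\<And>t. t \<in> set U \<Longrightarrow> y' t = y t" for y'
      using Cons.IH[of D' y'] dist(2) that Cons.prems(2) by simp
    have pop1: "?L (stack_vec D' y) = complex_of_real (stack_sum qp qm U D' y)" by (rule pop) simp
    have pop2: "?L (stack_vec D' (y(i := y d))) = complex_of_real (stack_sum qp qm U D' (y(i := y d)))"
      if "i \<in> set D'" for i
      by (rule pop) (use that dist in auto)
    have "?L (gauss_step qp qm (y0 t) (stack_vec D y)) =
        complex_of_real ((1 + qm) * (y0 t \<bullet> y d)\<^sup>2) * ?L (stack_vec D' y) +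
        ?L (fv_comb (set D') (\<lambda>i. complex_of_real (2 * qp * (y0 t \<bullet> y i)\<^sup>2)) (\<lambda>i. stack_vec D' (y(i := y d)))) +
        ?L (stack_vec (t # D) y)"
      unfolding step fold_gauss_step_add unfolding D annihilation_stack_vec[OF dist(1)]
        fv_comb_def fold_gauss_step_add fold_gauss_step_scale ..
    also have "?L (fv_comb (set D') (\<lambda>i. complex_of_real (2 * qp * (y0 t \<bullet> y i)\<^sup>2)) (\<lambda>i. stack_vec D' (y(i := y d)))) =
        (\<Sum>i\<in>set D'. complex_of_real (2 * qp * (y0 t \<bullet> y i)\<^sup>2) * complex_of_real (stack_sum qp qm U D' (y(i := y d))))"
      unfolding fold_gauss_step_comb by (simp add: fv_comb_def pop2)
    finally show ?thesis unfolding pop1 push using D yt by simp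
  qed
qed

lemma vacuum_state_stack_sum:
  fixes x :: "nat \<Rightarrow> 'a::real_inner"
  assumes "admissible qp qm"
  shows "vacuum_state qp qm (foldr (\<circ>) (map (\<lambda>i. G_op qp qm (x i)) (rev [1..<N + 1])) id) =
    complex_of_real (stack_sum qp qm (map int [1..<N + 1]) [] (\<lambda>i. x (nat i)))"
proof -
  have vac: "vacuum = stack_vec [] (\<lambda>i. x (nat i))"
    by (auto simp: vacuum_def stack_vec_def symT_def simple_tensor_def pm_def fun_eq_iff)
  have "fold (\<lambda>i. gauss_step qp qm (x i)) [1..<N + 1] F = fold (\<lambda>t. gauss_step qp qm (x (nat t))) (map int [1..<N + 1]) F" for F
    by (simp add: fold_map comp_def)
  then show ?thesis
    unfolding vacuum_state_G_ops[OF assms, where z = "\<lambda>_. 0"] vac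
    using fold_gauss_step_stack_vec[of "map int [1..<N + 1]" "[]" "\<lambda>i. x (nat i)" "\<lambda>i. x (nat i)" qp qm "\<lambda>_. 0"]
    by (simp add: distinct_map del: upt_Suc)
qed

section \<open>Signed matchings and their hats\<close>


definition sy :: "int set \<Rightarrow> int set" where
  "sy A = {i. \<bar>i\<bar> \<in> A}"

text \<open>The condition on absolute values excludes at once fixed points and pairs equal to their
  mirror image. Points outside \<open>A\<close> are fixed so that a matching is determined as a
  function.\<close>

definition matching :: "int set \<Rightarrow> (int \<Rightarrow> int) \<Rightarrow> bool" where
  "matching A f \<longleftrightarrow> (\<forall>i. f (f i) = i) \<and> (\<forall>i. f (- i) = - f i) \<and>
     (\<forall>i. \<bar>i\<bar> \<in> A \<longrightarrow> \<bar>f i\<bar> \<noteq> \<bar>i\<bar>) \<and> (\<forall>i. \<bar>i\<bar> \<notin> A \<longrightarrow> f i = i)"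

text \<open>For pair partitions these are the right legs of positive pairs, and their negatives are
  the left legs of negative pairs, so one set records all legs prescribed for the hat.\<close>

definition closers :: "int set \<Rightarrow> (int \<Rightarrow> int) \<Rightarrow> int set" where
  "closers A f = {t \<in> A. \<bar>f t\<bar> < t}"

definition pos_finite :: "int set \<Rightarrow> bool" where
  "pos_finite A \<longleftrightarrow> finite A \<and> (\<forall>a\<in>A. 0 < a)"

text \<open>The hat seen on the positive half. No pair of it joins points of opposite sign, since
  such a pair would cross its mirror image; singletons cannot occur, because the prescribed legs use
  up all points.\<close>

definition is_hat :: "int set \<Rightarrow> (int \<Rightarrow> int) \<Rightarrow> (int \<Rightarrow> int) \<Rightarrow> bool" where
  "is_hat A f h \<longleftrightarrow> matching A h \<and> (\<forall>a\<in>A. 0 < h a) \<and>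
     (\<forall>a\<in>A. \<forall>b\<in>A. a < b \<longrightarrow> b < h a \<longrightarrow> h b < h a) \<and> closers A h = closers A f"

lemma matchingD:
  assumes "matching A f"
  shows "f (f i) = i" "f (- i) = - f i" "\<bar>i\<bar> \<in> A \<Longrightarrow> \<bar>f i\<bar> \<noteq> \<bar>i\<bar>" "\<bar>i\<bar> \<notin> A \<Longrightarrow> f i = i"
  using assms unfolding matching_def by blast+

lemma matching_abs: "matching A f \<Longrightarrow> \<bar>f \<bar>i\<bar>\<bar> = \<bar>f i\<bar>"
  by (cases "0 \<le> i") (auto simp: matching_def)

lemma matching_in: "matching A f \<Longrightarrow> \<bar>i\<bar> \<in> A \<Longrightarrow> \<bar>f i\<bar> \<in> A"
  by (metis matchingD(1,3,4))

lemma matching_in_pos: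
  "matching A f \<Longrightarrow> pos_finite A \<Longrightarrow> i \<in> A \<Longrightarrow> \<bar>f i\<bar> \<in> A"
  using matching_in[of A f i] by (auto simp: pos_finite_def)

lemma pos_finite_abs: "pos_finite A \<Longrightarrow> i \<in> A \<Longrightarrow> \<bar>i\<bar> = i"
  by (auto simp: pos_finite_def)

lemma matching_cases:
  assumes "matching A f" "pos_finite A" "i \<in> A"
  shows "i \<in> closers A f \<longleftrightarrow> \<not> i < \<bar>f i\<bar>"
  using matchingD(3)[OF assms(1), of i] pos_finite_abs[OF assms(2,3)] assms(3) by (auto simp: closers_def)

text \<open>The two legs of a pair have different absolute values, so exactly one of them
  closes.\<close>

lemma closers_flip:
  assumes "matching A f" "pos_finite A" "\<bar>i\<bar> \<in> A"
  shows "\<bar>f i\<bar> \<in> closers A f \<longleftrightarrow> \<bar>i\<bar> \<notin> closers A f"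
proof -
  have a: "\<bar>f \<bar>i\<bar>\<bar> = \<bar>f i\<bar>" "\<bar>f \<bar>f i\<bar>\<bar> = \<bar>i\<bar>"
    using matching_abs[OF assms(1)] matchingD(1)[OF assms(1)] by auto
  have "\<bar>f i\<bar> \<in> A" using matching_in[OF assms(1,3)] .
  moreover have "\<bar>f i\<bar> \<noteq> \<bar>i\<bar>" using matchingD(3)[OF assms(1,3)] .
  ultimately show ?thesis using a assms(3) unfolding closers_def by auto
qed

lemma pos_finite_sy:
  assumes "pos_finite A"
  shows "finite (sy A)" "0 \<notin> sy A" "bar (sy A) = sy A"
proof -
  have "sy A \<subseteq> A \<union> uminus ` A" by (auto simp: sy_def abs_if image_iff split: if_splits) (metis minus_minus)+
  then show "finite (sy A)" using assms finite_subset unfolding pos_finite_def by blast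
  show "0 \<notin> sy A" using assms by (auto simp: sy_def pos_finite_def)
  show "bar (sy A) = sy A" by (auto simp: sy_def)
qed

lemma pos_finite_subset: "pos_finite A \<Longrightarrow> B \<subseteq> A \<Longrightarrow> pos_finite B"
  unfolding pos_finite_def using finite_subset by blast

lemma pos_finite_closers: "pos_finite A \<Longrightarrow> pos_finite (closers A f)"
  by (rule pos_finite_subset) (auto simp: closers_def)

lemma finite_matchings: "pos_finite A \<Longrightarrow> finite {f. matching A f}"
proof -
  assume p: "pos_finite A"
  have "{f. matching A f} \<subseteq> sperm (sy A)"
  proof
    fix f assume "f \<in> {f. matching A f}"
    then have m: "matching A f" by simp
    have "f permutes sy A"
    proof (rule bij_imp_permutes)
      show "bij_betw f (sy A) (sy A)"
        by (rule bij_betw_byWitness[where f' = f]) (auto simp: matchingD(1)[OF m] sy_def matching_in[OF m])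
    qed (use matchingD(4)[OF m] in \<open>auto simp: sy_def\<close>)
    then show "f \<in> sperm (sy A)" using matchingD(2)[OF m] by (simp add: sperm_def)
  qed
  then show ?thesis using finite_sperm pos_finite_sy(1)[OF p] finite_subset by blast
qed

text \<open>The signed permutation of the closers whose cycles are the cycles of pairs.\<close>

definition hat_perm :: "int set \<Rightarrow> (int \<Rightarrow> int) \<Rightarrow> (int \<Rightarrow> int) \<Rightarrow> int \<Rightarrow> int" where
  "hat_perm R f h i = (if \<bar>i\<bar> \<in> R then h (f i) else i)"

text \<open>\<open>f\<close> leads from closers to openers and \<open>h\<close> back to closers, as
  both matchings have the same closers; the inverse applies \<open>h\<close> and then
  \<open>f\<close>.\<close>

lemma hat_perm_sperm:
  assumes p: "pos_finite A" and f: "matching A f" and h: "matching A h" and R: "closers A h = closers A f"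
  shows "hat_perm (closers A f) f h \<in> sperm (sy (closers A f))"
proof -
  let ?R = "closers A f"
  have RA: "?R \<subseteq> A" by (auto simp: closers_def)
  have in1: "\<bar>h (f i)\<bar> \<in> ?R" if "\<bar>i\<bar> \<in> ?R" for i
  proof -
    have "\<bar>i\<bar> \<in> A" using that RA by blast
    then have "\<bar>f i\<bar> \<in> A" "\<bar>f i\<bar> \<notin> ?R" using matching_in[OF f] closers_flip[OF f p] that by auto
    then show ?thesis using closers_flip[OF h p] R by auto
  qed
  have in2: "\<bar>f (h i)\<bar> \<in> ?R" if "\<bar>i\<bar> \<in> ?R" for i
  proof -
    have "\<bar>i\<bar> \<in> A" using that RA by blast
    then have "\<bar>h i\<bar> \<in> A" "\<bar>h i\<bar> \<notin> ?R" using matching_in[OF h] closers_flip[OF h p] that R by auto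
    then show ?thesis using closers_flip[OF f p] by auto
  qed
  have "hat_perm ?R f h permutes sy ?R"
  proof (rule bij_imp_permutes)
    show "bij_betw (hat_perm ?R f h) (sy ?R) (sy ?R)"
      by (rule bij_betw_byWitness[where f' = "\<lambda>i. f (h i)"])
        (auto simp: hat_perm_def sy_def in1 in2 matchingD(1)[OF f] matchingD(1)[OF h])
  qed (auto simp: hat_perm_def sy_def)
  then show ?thesis
    unfolding sperm_def by (auto simp: hat_perm_def matchingD(2)[OF f] matchingD(2)[OF h])
qed

text \<open>Otherwise \<open>h2 t\<close> lies inside the pair of \<open>t\<close> under
  \<open>h1\<close>, so by nesting its partner under \<open>h1\<close> is a closer smaller than
  \<open>t\<close>. There both hats agree, hence \<open>h2\<close> would match \<open>h2 t\<close>
  with that closer as well as with \<open>t\<close>.\<close>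

lemma hat_not_less:
  assumes p: "pos_finite A" and h1: "is_hat A f h1" and h2: "is_hat A f h2" and t: "t \<in> closers A f"
    and ih: "\<And>c. c \<in> closers A f \<Longrightarrow> c < t \<Longrightarrow> h1 c = h2 c"
  shows "\<not> h1 t < h2 t"
proof
  assume less: "h1 t < h2 t"
  have m1: "matching A h1" and m2: "matching A h2" and R: "closers A h1 = closers A f" "closers A h2 = closers A f"
    and pos: "\<And>a. a \<in> A \<Longrightarrow> 0 < h1 a" "\<And>a. a \<in> A \<Longrightarrow> 0 < h2 a"
    and nc: "\<And>a b. a \<in> A \<Longrightarrow> b \<in> A \<Longrightarrow> a < b \<Longrightarrow> b < h1 a \<Longrightarrow> h1 b < h1 a"
    using h1 h2 unfolding is_hat_def by blast+
  have tA: "t \<in> A" using t by (simp add: closers_def)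
  have A1: "h1 a \<in> A" if "a \<in> A" for a using matching_in_pos[OF m1 p that] pos(1)[OF that] by simp
  have A2: "h2 a \<in> A" if "a \<in> A" for a using matching_in_pos[OF m2 p that] pos(2)[OF that] by simp
  let ?o = "h2 t"
  have o: "?o \<in> A" "?o < t" using A2[OF tA] t pos(2)[OF tA] unfolding R(2)[symmetric] by (auto simp: closers_def)
  have lt: "h1 ?o < t"
    using nc[OF A1[OF tA] o(1) less] o(2) matchingD(1)[OF m1, of t] by simp
  have "?o \<notin> closers A f"
    using t closers_flip[OF m2 p, of t] pos_finite_abs[OF p tA] tA pos(2)[OF tA] R(2) by auto
  then have c: "h1 ?o \<in> closers A f"
    using closers_flip[OF m1 p, of ?o] pos_finite_abs[OF p o(1)] o(1) pos(1)[OF o(1)] R(1) by auto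
  have "h1 (h1 ?o) = h2 (h1 ?o)" by (rule ih[OF c lt])
  then have "h2 (h1 ?o) = ?o" using matchingD(1)[OF m1] by simp
  then have "h1 ?o = t" using matchingD(1)[OF m2] by metis
  then show False using lt by simp
qed

text \<open>Closers are treated in increasing order with \<open>hat_not_less\<close> in both
  directions; being involutions, the hats then agree on the openers as well.\<close>

lemma hat_unique:
  assumes p: "pos_finite A" and h1: "is_hat A f h1" and h2: "is_hat A f h2"
  shows "h1 = h2"
proof -
  have m1: "matching A h1" and m2: "matching A h2" and R: "closers A h1 = closers A f" "closers A h2 = closers A f"
    using h1 h2 unfolding is_hat_def by blast+
  have cl: "h1 t = h2 t" if "t \<in> closers A f" for t
    using that
  proof (induction "nat t" arbitrary: t rule: less_induct)
    case less
    have ih: "h1 c = h2 c" if "c \<in> closers A f" "c < t" for c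
      using less.hyps[of c] that less.prems pos_finite_closers[OF p] by (auto simp: pos_finite_def)
    then show ?case
      using hat_not_less[OF p h1 h2 less.prems] hat_not_less[OF p h2 h1 less.prems] by force
  qed
  have cl': "h1 i = h2 i" if "\<bar>i\<bar> \<in> closers A f" for i
    using cl[OF that] matchingD(2)[OF m1, of i] matchingD(2)[OF m2, of i] by (cases "0 \<le> i") auto
  show ?thesis
  proof
    fix i
    consider "\<bar>i\<bar> \<notin> A" | "\<bar>i\<bar> \<in> closers A f" | "\<bar>i\<bar> \<in> A" "\<bar>i\<bar> \<notin> closers A f" by blast
    then show "h1 i = h2 i"
    proof cases
      case 1 then show ?thesis using matchingD(4)[OF m1] matchingD(4)[OF m2] by metis
    next
      case 3
      then have "\<bar>h1 i\<bar> \<in> closers A f" using closers_flip[OF m1 p] R by auto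
      then have "h2 (h1 i) = i" using cl'[of "h1 i"] matchingD(1)[OF m1] by simp
      then show ?thesis using matchingD(1)[OF m2] by metis
    qed (use cl' in blast)
  qed
qed

section \<open>Gluing the first closer onto a smaller matching\<close>

definition add_pair :: "(int \<Rightarrow> int) \<Rightarrow> int \<Rightarrow> int \<Rightarrow> int \<Rightarrow> int" where
  "add_pair f d t i = (if i = d then t else if i = t then d else if i = - d then - t else if i = - t then - d else f i)"

lemma st_conj:
  assumes "inj h" "\<And>i. h (- i) = - h i"
  shows "h (st a b i) = st (h a) (h b) (h i)"
  using assms(1) assms(2)[symmetric] by (auto simp: st_def inj_eq)

text \<open>\<open>E\<close> plays the role of the stack: points already read whose partners come
  later.\<close>

definition openers :: "int set \<Rightarrow> int set \<Rightarrow> (int \<Rightarrow> int) set" where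
  "openers B E = {f. matching B f \<and> E \<inter> closers B f = {}}"

text \<open>
  \<open>t\<close> is the first point after the initial segment \<open>D\<close> and \<open>d\<close> the last point of \<open>D\<close>; when \<open>t\<close> is the
  first closer, \<open>d\<close> and \<open>t\<close> are matched by the hat.
\<close>

locale peak =
  fixes A D :: "int set" and d t :: int
  assumes pos: "pos_finite A" and D: "D \<subseteq> A" and d: "d \<in> D" and tA: "t \<in> A"
    and le_d: "\<And>a. a \<in> D \<Longrightarrow> a \<le> d" and gt: "\<And>a. a \<in> A \<Longrightarrow> a \<notin> D \<Longrightarrow> t \<le> a" and dt: "d < t"
begin

abbreviation "A' \<equiv> A - {d, t}"
abbreviation "D' \<equiv> D - {d}"

text \<open>Conjugating the added pair by the exchange of \<open>s\<close> and \<open>d\<close> lets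
  \<open>t\<close> close \<open>s\<close>, and for |s| different from \<open>d\<close> the point
  \<open>d\<close> inherits the former partner of \<open>s\<close>. Read backwards, the alternating
  path through \<open>d\<close>, \<open>t\<close> and \<open>s\<close> is contracted to its end
  \<open>s\<close>.\<close>

definition glue :: "(int \<Rightarrow> int) \<Rightarrow> int \<Rightarrow> int \<Rightarrow> int" where
  "glue f s = st s d \<circ> add_pair f d t \<circ> st s d"

lemma basic: "0 < d" "0 < t" "d \<in> A" "t \<notin> D" "\<And>a. a \<in> D \<Longrightarrow> a < t" "pos_finite A'" "\<And>a. a \<in> D \<Longrightarrow> 0 < a"
proof -
  show "d \<in> A" using d D by blast
  then show "0 < d" "0 < t" using tA pos by (auto simp: pos_finite_def)
  show "\<And>a. a \<in> D \<Longrightarrow> a < t" using le_d dt by force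
  then show "t \<notin> D" by blast
  show "pos_finite A'" using pos by (rule pos_finite_subset) blast
  show "\<And>a. a \<in> D \<Longrightarrow> 0 < a" using D pos by (auto simp: pos_finite_def)
qed

lemma add_pair_simps: "add_pair f d t d = t" "add_pair f d t t = d" "add_pair f d t (- d) = - t" "add_pair f d t (- t) = - d"
  "\<bar>i\<bar> \<noteq> d \<Longrightarrow> \<bar>i\<bar> \<noteq> t \<Longrightarrow> add_pair f d t i = f i"
  using basic dt by (auto simp: add_pair_def)

lemma matching_add_pair:
  assumes f: "matching A' f"
  shows "matching A (add_pair f d t)"
proof -
  have nin: "\<bar>f i\<bar> \<noteq> d \<and> \<bar>f i\<bar> \<noteq> t" if "\<bar>i\<bar> \<noteq> d" "\<bar>i\<bar> \<noteq> t" for i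
  proof (cases "\<bar>i\<bar> \<in> A'")
    case True then show ?thesis using matching_in[OF f True] by auto
  next
    case False then show ?thesis using matchingD(4)[OF f False] that by simp
  qed
  have c: "\<bar>i\<bar> \<noteq> d \<and> \<bar>i\<bar> \<noteq> t \<or> i = d \<or> i = t \<or> i = - d \<or> i = - t" for i by linarith
  show ?thesis
    unfolding matching_def
  proof (intro conjI allI impI)
    fix i
    show "add_pair f d t (add_pair f d t i) = i"
      using c[of i] nin[of i] matchingD(1)[OF f, of i] by (auto simp: add_pair_simps)
    show "add_pair f d t (- i) = - add_pair f d t i"
      using c[of i] matchingD(2)[OF f, of i] by (auto simp: add_pair_simps)
    show "\<bar>add_pair f d t i\<bar> \<noteq> \<bar>i\<bar>" if "\<bar>i\<bar> \<in> A"
      using c[of i] matchingD(3)[OF f, of i] that basic dt by (auto simp: add_pair_simps)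
    show "add_pair f d t i = i" if "\<bar>i\<bar> \<notin> A"
    proof -
      have "\<bar>i\<bar> \<noteq> d" "\<bar>i\<bar> \<noteq> t" using that basic tA by auto
      then show ?thesis using matchingD(4)[OF f, of i] that by (auto simp: add_pair_simps)
    qed
  qed
qed

lemma st_props:
  assumes s: "s \<in> sy D"
  shows "st s d (st s d i) = i" "st s d (- i) = - st s d i" "\<bar>i\<bar> \<notin> D \<Longrightarrow> st s d i = i"
    "\<bar>i\<bar> \<noteq> d \<Longrightarrow> \<bar>i\<bar> \<noteq> \<bar>s\<bar> \<Longrightarrow> st s d i = i" "\<bar>i\<bar> \<in> A \<longleftrightarrow> \<bar>st s d i\<bar> \<in> A"
    "st s d s = d" "st s d d = s"
proof -
  have s0: "s \<noteq> 0" "d \<noteq> 0" "\<bar>s\<bar> \<in> D"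
    using s basic(1) basic(7)[of "\<bar>s\<bar>"] by (auto simp: sy_def)
  show "st s d (st s d i) = i" "st s d (- i) = - st s d i" using s0 by (auto simp: st_invol st_neg)
  show "\<bar>i\<bar> \<notin> D \<Longrightarrow> st s d i = i"
  proof -
    assume "\<bar>i\<bar> \<notin> D"
    then have "\<bar>i\<bar> \<noteq> \<bar>s\<bar>" "\<bar>i\<bar> \<noteq> d" using s0(3) d by auto
    then show "st s d i = i" using basic(1) by (auto simp: st_def)
  qed
  show "\<bar>i\<bar> \<noteq> d \<Longrightarrow> \<bar>i\<bar> \<noteq> \<bar>s\<bar> \<Longrightarrow> st s d i = i" using basic by (auto simp: st_def)
  have "\<bar>s\<bar> \<in> A" using s0 D by blast
  then show "\<bar>i\<bar> \<in> A \<longleftrightarrow> \<bar>st s d i\<bar> \<in> A" using basic unfolding st_def by auto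
  show "st s d s = d" "st s d d = s" by (auto simp: st_def)
qed

lemma matching_conj:
  assumes s: "s \<in> sy D" and g: "matching A g"
  shows "matching A (st s d \<circ> g \<circ> st s d)"
proof -
  have abs: "\<bar>st s d i\<bar> = \<bar>st s d j\<bar> \<longleftrightarrow> \<bar>i\<bar> = \<bar>j\<bar>" for i j
    using st_props(1,2)[OF s] by (metis abs_eq_iff)
  show ?thesis
    unfolding matching_def comp_def
  proof (intro conjI allI impI)
    fix i
    show "st s d (g (st s d (st s d (g (st s d i))))) = i"
      by (simp add: st_props(1)[OF s] matchingD(1)[OF g])
    show "st s d (g (st s d (- i))) = - st s d (g (st s d i))"
      by (simp add: st_props(2)[OF s] matchingD(2)[OF g])
    show "\<bar>st s d (g (st s d i))\<bar> \<noteq> \<bar>i\<bar>" if "\<bar>i\<bar> \<in> A"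
      using matchingD(3)[OF g, of "st s d i"] that st_props(5)[OF s, of i] abs[of "g (st s d i)" "st s d i"]
      by (simp add: st_props(1)[OF s])
    show "st s d (g (st s d i)) = i" if "\<bar>i\<bar> \<notin> A"
      using matchingD(4)[OF g, of "st s d i"] that st_props(5)[OF s, of i] by (simp add: st_props(1)[OF s])
  qed
qed

text \<open>Two points of \<open>E\<close> cannot be matched, since one of them would be a
  closer.\<close>

lemma opener_partner:
  assumes f: "f \<in> openers B E" and B: "pos_finite B" and E: "E \<subseteq> B" and i: "\<bar>i\<bar> \<in> E"
  shows "\<bar>f i\<bar> \<in> B" "\<bar>f i\<bar> \<notin> E" "\<bar>i\<bar> < \<bar>f i\<bar>"
proof -
  have m: "matching B f" and ne: "\<And>a. a \<in> E \<Longrightarrow> a \<notin> closers B f" using f by (auto simp: openers_def)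
  have iB: "\<bar>i\<bar> \<in> B" using i E by blast
  show "\<bar>f i\<bar> \<in> B" using matching_in[OF m iB] .
  show "\<bar>f i\<bar> \<notin> E" using closers_flip[OF m B iB] ne i by blast
  show "\<bar>i\<bar> < \<bar>f i\<bar>" using matching_cases[OF m B iB] ne[OF i] matching_abs[OF m] by auto
qed

lemma glue_values:
  assumes f: "f \<in> openers A' D'" and s: "s \<in> sy D"
  shows "glue f s t = s" "\<bar>glue f s s\<bar> = t"
    "\<bar>s\<bar> \<noteq> d \<Longrightarrow> \<bar>glue f s d\<bar> = \<bar>f s\<bar>"
    "a \<in> D' \<Longrightarrow> a \<noteq> \<bar>s\<bar> \<Longrightarrow> glue f s a = f a"
    "c \<in> A' \<Longrightarrow> c \<notin> D \<Longrightarrow> \<bar>glue f s c\<bar> = (if \<bar>f c\<bar> = \<bar>s\<bar> then d else \<bar>f c\<bar>)"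
    "\<bar>c\<bar> \<in> A' \<Longrightarrow> \<bar>c\<bar> \<notin> D \<Longrightarrow> glue f s c = st s d (f c)"
proof -
  have m: "matching A' f" using f by (simp add: openers_def)
  have s0: "\<bar>s\<bar> \<in> D" using s by (simp add: sy_def)
  have tt: "st s d t = t" using st_props(3)[OF s, of t] basic by simp
  have far: "\<bar>f i\<bar> \<in> A'" "\<bar>f i\<bar> \<notin> D" if "\<bar>i\<bar> \<in> D'" for i
    using opener_partner[OF f basic(6) _ that] D basic(4) by auto
  show "glue f s t = s" by (simp add: glue_def tt add_pair_simps st_props(1-4,6,7)[OF s])
  show "\<bar>glue f s s\<bar> = t" using basic by (simp add: glue_def tt add_pair_simps st_props(1-4,6,7)[OF s])
  show "\<bar>glue f s d\<bar> = \<bar>f s\<bar>" if "\<bar>s\<bar> \<noteq> d"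
  proof -
    have "\<bar>s\<bar> \<in> D'" "\<bar>s\<bar> \<noteq> t" using that s0 basic by auto
    then show ?thesis
      using far[of s] that by (simp add: glue_def add_pair_simps st_props(1-4,6,7)[OF s])
  qed
  show "glue f s a = f a" if "a \<in> D'" "a \<noteq> \<bar>s\<bar>"
  proof -
    have a: "\<bar>a\<bar> = a" "a \<noteq> d" "a \<noteq> t" using that(1) basic(4) basic(7)[of a] by auto
    then have "st s d a = a" using that by (intro st_props(4)[OF s]) auto
    then show ?thesis using far[of a] a that(1) by (simp add: glue_def add_pair_simps st_props(1-4,6,7)[OF s])
  qed
  show g: "glue f s c = st s d (f c)" if "\<bar>c\<bar> \<in> A'" "\<bar>c\<bar> \<notin> D" for c
    using that by (simp add: glue_def add_pair_simps st_props(1-4,6,7)[OF s])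
  show "\<bar>glue f s c\<bar> = (if \<bar>f c\<bar> = \<bar>s\<bar> then d else \<bar>f c\<bar>)" if c: "c \<in> A'" "c \<notin> D"
  proof -
    have c': "\<bar>c\<bar> = c" using pos_finite_abs[OF basic(6) c(1)] .
    have "\<bar>f c\<bar> \<in> A'" using matching_in[OF m, of c] c c' by simp
    then have "\<bar>f c\<bar> \<noteq> d" by blast
    then have "\<bar>st s d (f c)\<bar> = (if \<bar>f c\<bar> = \<bar>s\<bar> then d else \<bar>f c\<bar>)"
      using basic by (auto simp: st_def)
    then show ?thesis using g[of c] c c' by simp
  qed
qed

text \<open>All points of \<open>D\<close> lie below \<open>t\<close> and below the other points of
  \<open>A\<close>, so redistributing partners within \<open>D\<close> does not change which points
  close; only \<open>t\<close> is added.\<close>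

lemma closers_glue:
  assumes f: "f \<in> openers A' D'" and s: "s \<in> sy D"
  shows "closers A (glue f s) = insert t (closers A' f)" "D \<inter> closers A (glue f s) = {}"
proof -
  have m: "matching A' f" using f by (simp add: openers_def)
  have s0: "\<bar>s\<bar> \<in> D" using s by (simp add: sy_def)
  have gm: "matching A (glue f s)"
    unfolding glue_def by (rule matching_conj[OF s matching_add_pair[OF m]])
  have far: "\<bar>f i\<bar> \<in> A'" "\<bar>f i\<bar> \<notin> D" "\<bar>i\<bar> < \<bar>f i\<bar>" if "\<bar>i\<bar> \<in> D'" for i
    using opener_partner[OF f basic(6) _ that] D basic(4) by auto
  have D1: "a \<notin> closers A (glue f s)" if a: "a \<in> D" for a
  proof -
    have "a < \<bar>glue f s a\<bar>"
    proof (cases "a = \<bar>s\<bar>")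
      case True
      have "\<bar>glue f s \<bar>s\<bar>\<bar> = \<bar>glue f s s\<bar>" by (rule matching_abs[OF gm])
      then show ?thesis using True glue_values(2)[OF f s] basic(5)[OF a] by simp
    next
      case False
      note ne = this
      show ?thesis
      proof (cases "a = d")
        case True
        then have "\<bar>s\<bar> \<in> D'" using s0 ne by auto
        then have "t \<le> \<bar>f s\<bar>" using far[of s] gt[of "\<bar>f s\<bar>"] by auto
        then show ?thesis using True ne glue_values(3)[OF f s] dt by auto
      next
        case False
        then have "glue f s a = f a" using glue_values(4)[OF f s, of a] a ne by simp
        then show ?thesis using far(3)[of a] False a basic(7)[OF a] by auto
      qed
    qed
    then show ?thesis by (simp add: closers_def)
  qed
  then show "D \<inter> closers A (glue f s) = {}" by blast
  have t: "t \<in> closers A (glue f s)"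
    using glue_values(1)[OF f s] basic(5)[OF s0] tA by (simp add: closers_def)
  have D2: "a \<notin> closers A' f" if "a \<in> D" for a
    using f that by (cases "a = d") (auto simp: openers_def closers_def)
  have U: "c \<in> closers A (glue f s) \<longleftrightarrow> c \<in> closers A' f" if c: "c \<in> A'" "c \<notin> D" for c
  proof -
    have "t < c" using gt[of c] c by auto
    then have "\<bar>s\<bar> < c" "d < c" using basic(5)[OF s0] dt by auto
    then show ?thesis using glue_values(5)[OF f s c] c by (auto simp: closers_def)
  qed
  show "closers A (glue f s) = insert t (closers A' f)"
  proof (rule set_eqI)
    fix c
    consider "c = t" | "c \<in> D" "c \<noteq> t" | "c \<in> A'" "c \<notin> D" | "c \<notin> A" "c \<noteq> t" using d by blast
    then show "c \<in> closers A (glue f s) \<longleftrightarrow> c \<in> insert t (closers A' f)"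
    proof cases
      case 1 then show ?thesis using t by simp
    next
      case 2 then show ?thesis using D1 D2 by blast
    next
      case 3 then show ?thesis using U[OF 3] by blast
    next
      case 4 then show ?thesis by (simp add: closers_def)
    qed
  qed
qed

text \<open>The choice \<open>s\<close> is read off as the partner of \<open>t\<close>. Undoing the
  exchange makes \<open>d\<close> and \<open>t\<close> partners again, and this pair is
  dropped.\<close>

definition unglue :: "(int \<Rightarrow> int) \<Rightarrow> int \<Rightarrow> int" where
  "unglue f i = (if \<bar>i\<bar> = d \<or> \<bar>i\<bar> = t then i else (st (f t) d \<circ> f \<circ> st (f t) d) i)"

lemma unglue_props:
  assumes f: "f \<in> openers A D" and t: "t \<in> closers A f"
  shows "f t \<in> sy D" "unglue f \<in> openers A' D'" "glue (unglue f) (f t) = f"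
proof -
  have m: "matching A f" using f by (simp add: openers_def)
  have "\<bar>f t\<bar> < t" "\<bar>f t\<bar> \<in> A" using t matching_in_pos[OF m pos tA] by (auto simp: closers_def)
  \<comment> \<open>\<open>t\<close> is the smallest point outside \<open>D\<close>, so anything
    below it in \<open>A\<close> lies in \<open>D\<close>.\<close>
  then show s: "f t \<in> sy D" using gt[of "\<bar>f t\<bar>"] by (force simp: sy_def)
  let ?s = "f t"
  define g where "g = st ?s d \<circ> f \<circ> st ?s d"
  have s0: "\<bar>?s\<bar> \<in> D" using s by (simp add: sy_def)
  have gm: "matching A g" unfolding g_def by (rule matching_conj[OF s m])
  have tt: "st ?s d t = t" using st_props(3)[OF s, of t] basic by simp
  have gt: "g t = d" unfolding g_def by (simp add: tt st_props(1-4,6,7)[OF s])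
  then have gd: "g d = t" using matchingD(1)[OF gm] by metis
  have gneg: "g (- i) = - g i" for i by (rule matchingD(2)[OF gm])
  have ug: "unglue f i = (if \<bar>i\<bar> = d \<or> \<bar>i\<bar> = t then i else g i)" for i
    by (simp add: unglue_def g_def)
  have c: "\<bar>i\<bar> \<noteq> d \<and> \<bar>i\<bar> \<noteq> t \<or> i = d \<or> i = t \<or> i = - d \<or> i = - t" for i by linarith
  have extu: "add_pair (unglue f) d t = g"
  proof
    fix i show "add_pair (unglue f) d t i = g i"
      using c[of i] by (elim disjE conjE) (simp_all add: add_pair_simps ug gt gd gneg)
  qed
  show "glue (unglue f) ?s = f"
    unfolding glue_def extu g_def by (simp add: fun_eq_iff st_props(1)[OF s])
  have nin: "\<bar>g i\<bar> \<noteq> d \<and> \<bar>g i\<bar> \<noteq> t" if "\<bar>i\<bar> \<noteq> d" "\<bar>i\<bar> \<noteq> t" for i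
  proof -
    have "i = g (g i)" using matchingD(1)[OF gm] by simp
    moreover have "\<bar>g d\<bar> = t" "\<bar>g t\<bar> = d" "\<bar>g (- d)\<bar> = t" "\<bar>g (- t)\<bar> = d"
      using gt gd gneg basic by auto
    ultimately show ?thesis using that c[of "g i"] by metis
  qed
  have um: "matching A' (unglue f)"
    unfolding matching_def
  proof (intro conjI allI impI)
    fix i
    show "unglue f (unglue f i) = i" using nin[of i] matchingD(1)[OF gm, of i] by (auto simp: ug)
    show "unglue f (- i) = - unglue f i" by (simp add: ug gneg)
    show "\<bar>unglue f i\<bar> \<noteq> \<bar>i\<bar>" if "\<bar>i\<bar> \<in> A'" using that matchingD(3)[OF gm, of i] by (auto simp: ug)
    show "unglue f i = i" if "\<bar>i\<bar> \<notin> A'" using that matchingD(4)[OF gm, of i] by (auto simp: ug)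
  qed
  have "a \<notin> closers A' (unglue f)" if a: "a \<in> D'" for a
  proof -
    have a': "\<bar>a\<bar> = a" "a \<noteq> d" "a \<noteq> t" "a \<in> D" using a basic(4) basic(7)[of a] by auto
    have ua: "unglue f a = g a" using a' by (simp add: ug)
    have "a < \<bar>g a\<bar>"
    proof (cases "a = \<bar>?s\<bar>")
      case True
      \<comment> \<open>The exchange hands the partner of \<open>d\<close> to the point |f t|, and
        that partner lies beyond \<open>D\<close>.\<close>
      have fd: "\<bar>f d\<bar> \<notin> D" "d < \<bar>f d\<bar>"
        using opener_partner[OF f pos D, of d] d basic by auto
      have "\<bar>g a\<bar> = \<bar>g ?s\<bar>" using True matching_abs[OF gm] by simp
      also have "g ?s = f d" unfolding g_def using st_props(1-4,6,7)[OF s] fd by simp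
      finally show ?thesis using fd le_d[OF a'(4)] by simp
    next
      case False
      have fa: "\<bar>f a\<bar> \<notin> D" "a < \<bar>f a\<bar>"
        using opener_partner[OF f pos D, of a] a' by auto
      have "st ?s d a = a" using a' False by (intro st_props(4)[OF s]) auto
      then have "g a = f a" unfolding g_def using st_props(3)[OF s fa(1)] by simp
      then show ?thesis using fa by simp
    qed
    then show ?thesis using ua by (simp add: closers_def)
  qed
  then show "unglue f \<in> openers A' D'" using um by (auto simp: openers_def)
qed

text \<open>\<open>t\<close> may close any point of \<open>D\<close> with either sign; what remains
  is a matching of \<open>A'\<close> in which the rest of \<open>D\<close> stays open.\<close>

lemma glue_bij:
  "bij_betw (\<lambda>(f, s). glue f s) (openers A' D' \<times> sy D) {f \<in> openers A D. t \<in> closers A f}"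
proof (rule bij_betw_byWitness[where f' = "\<lambda>f. (unglue f, f t)"])
  show "\<forall>p\<in>openers A' D' \<times> sy D. (\<lambda>f. (unglue f, f t)) ((\<lambda>(f, s). glue f s) p) = p"
  proof
    fix p assume "p \<in> openers A' D' \<times> sy D"
    then obtain f s where p: "p = (f, s)" and f: "f \<in> openers A' D'" and s: "s \<in> sy D" by blast
    have m: "matching A' f" using f by (simp add: openers_def)
    have "unglue (glue f s) i = f i" for i
    proof (cases "\<bar>i\<bar> = d \<or> \<bar>i\<bar> = t")
      case True
      then show ?thesis using matchingD(4)[OF m, of i] by (auto simp: unglue_def)
    next
      case False
      then show ?thesis
        unfolding unglue_def glue_values(1)[OF f s] by (simp add: glue_def st_props(1)[OF s] add_pair_simps)
    qed
    then show "(\<lambda>f. (unglue f, f t)) ((\<lambda>(f, s). glue f s) p) = p"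
      by (simp add: p glue_values(1)[OF f s] fun_eq_iff)
  qed
  show "\<forall>f\<in>{f \<in> openers A D. t \<in> closers A f}. (\<lambda>(f, s). glue f s) (unglue f, f t) = f"
    using unglue_props(3) by auto
  show "(\<lambda>(f, s). glue f s) ` (openers A' D' \<times> sy D) \<subseteq> {f \<in> openers A D. t \<in> closers A f}"
  proof clarify
    fix f s assume f: "f \<in> openers A' D'" and s: "s \<in> sy D"
    have "matching A (glue f s)"
      unfolding glue_def using f by (intro matching_conj[OF s] matching_add_pair) (simp add: openers_def)
    then show "glue f s \<in> openers A D \<and> t \<in> closers A (glue f s)"
      using closers_glue[OF f s] by (auto simp: openers_def)
  qed
  show "(\<lambda>f. (unglue f, f t)) ` {f \<in> openers A D. t \<in> closers A f} \<subseteq> openers A' D' \<times> sy D"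
    using unglue_props(1,2) by auto
qed

text \<open>No point of \<open>A\<close> lies strictly between \<open>d\<close> and
  \<open>t\<close>, so their pair can cross nothing. The result does not depend on \<open>s\<close>,
  because the hat sees only the closers.\<close>

lemma is_hat_glue:
  assumes f: "f \<in> openers A' D'" and s: "s \<in> sy D" and h: "is_hat A' f h"
  shows "is_hat A (glue f s) (add_pair h d t)"
proof -
  have m: "matching A' h" and hp: "\<And>a. a \<in> A' \<Longrightarrow> 0 < h a" and R: "closers A' h = closers A' f"
    and nc: "\<And>a b. a \<in> A' \<Longrightarrow> b \<in> A' \<Longrightarrow> a < b \<Longrightarrow> b < h a \<Longrightarrow> h b < h a"
    using h unfolding is_hat_def by blast+
  have em: "matching A (add_pair h d t)" by (rule matching_add_pair[OF m])
  have e: "add_pair h d t a = h a" if "a \<in> A'" for a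
    using that pos_finite_abs[OF basic(6) that] by (simp add: add_pair_simps)
  have hA: "h a \<in> A'" if "a \<in> A'" for a using matching_in_pos[OF m basic(6) that] hp[OF that] by simp
  have between: "a \<le> d \<or> t \<le> a" if "a \<in> A" for a using that le_d gt by blast
  have c: "closers A (add_pair h d t) = insert t (closers A' h)"
  proof (rule set_eqI)
    fix a
    consider "a = d" | "a = t" | "a \<in> A'" | "a \<notin> A" by blast
    then show "a \<in> closers A (add_pair h d t) \<longleftrightarrow> a \<in> insert t (closers A' h)"
      by cases (use basic dt tA e in \<open>auto simp: closers_def add_pair_simps\<close>)
  qed
  have hp': "0 < add_pair h d t a" if "a \<in> A" for a
    using that e hp basic dt by (cases "a = d"; cases "a = t") (auto simp: add_pair_simps)
  have nc': "add_pair h d t b < add_pair h d t a" if ab: "a \<in> A" "b \<in> A" "a < b" "b < add_pair h d t a" for a b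
  proof -
    have at: "a \<noteq> t" using ab(3,4) dt by (auto simp: add_pair_simps)
    have ad: "a \<noteq> d"
    proof
      assume "a = d"
      then have "d < b" "b < t" using ab by (auto simp: add_pair_simps)
      then show False using between[OF ab(2)] by simp
    qed
    have a: "a \<in> A'" using ab at ad by simp
    have ha: "b < h a" using ab(4) e[OF a] by simp
    consider "b = d" | "b = t" | "b \<in> A'" using ab by blast
    then show ?thesis
    proof cases
      case 1
      then have "t < h a" using ha hA[OF a] between[of "h a"] by auto
      then show ?thesis using 1 e[OF a] by (simp add: add_pair_simps)
    next
      case 2 then show ?thesis using ha e[OF a] dt by (simp add: add_pair_simps)
    next
      case 3 then show ?thesis using nc[OF a 3 ab(3) ha] e a by simp
    qed
  qed
  show ?thesis unfolding is_hat_def using em hp' nc' c R closers_glue(1)[OF f s] by auto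
qed

text \<open>The extended hat is injective and odd and carries the exchange of \<open>s\<close> and
  \<open>d\<close> to that of its values at \<open>s\<close> and \<open>d\<close>, the latter being
  \<open>t\<close>. The new permutation is therefore the old one followed by a signed transposition
  involving the new closer \<open>t\<close>.\<close>

lemma wt_glue:
  assumes f: "f \<in> openers A' D'" and s: "s \<in> sy D" and h: "is_hat A' f h"
  shows "wt qp qm (sy (closers A (glue f s))) (hat_perm (closers A (glue f s)) (glue f s) (add_pair h d t)) =
    stw qp qm s d * wt qp qm (sy (closers A' f)) (hat_perm (closers A' f) f h)"
proof -
  let ?R' = "closers A' f" and ?R = "closers A (glue f s)" and ?h = "add_pair h d t" and ?f = "glue f s"
  let ?\<sigma> = "hat_perm ?R ?f ?h" and ?\<sigma>' = "hat_perm ?R' f h"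
  have fm: "matching A' f" using f by (simp add: openers_def)
  have hm: "matching A' h" and hR: "closers A' h = ?R'" using h unfolding is_hat_def by blast+
  have em: "matching A ?h" by (rule matching_add_pair[OF hm])
  have eR: "closers A ?h = ?R" using is_hat_glue[OF f s h] by (simp add: is_hat_def)
  have gm: "matching A ?f" unfolding glue_def by (rule matching_conj[OF s matching_add_pair[OF fm]])
  have s0: "\<bar>s\<bar> \<in> D" using s by (simp add: sy_def)
  have R: "?R = insert t ?R'" "D \<inter> ?R = {}" by (rule closers_glue[OF f s])+
  have tR': "t \<notin> ?R'" by (simp add: closers_def)
  have pR': "pos_finite ?R'" by (rule pos_finite_closers[OF basic(6)])
  note V = pos_finite_sy[OF pR']
  have syR: "sy ?R = sy ?R' \<union> {t, - t}" using basic(2) unfolding R(1) sy_def by auto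
  have hs: "\<bar>?h s\<bar> \<in> ?R"
    using closers_flip[OF em pos, of s] s0 D R(2) eR by auto
  have hinj: "inj ?h" by (metis matchingD(1)[OF em] injI)
  have conj: "?h (st s d i) = st (?h s) t (?h i)" for i
    using st_conj[OF hinj matchingD(2)[OF em], of s d i] by (simp add: add_pair_simps)
  have \<sigma>': "?\<sigma>' \<in> sperm (sy ?R')" by (rule hat_perm_sperm[OF basic(6) fm hm hR])
  have \<sigma>: "?\<sigma> \<in> sperm (sy ?R)" by (rule hat_perm_sperm[OF pos gm em eR])
  have hs0: "?h s \<noteq> 0" "t \<noteq> 0" using hs pos_finite_closers[OF pos, of ?f] basic by (auto simp: pos_finite_def)
  have odd: "st (?h s) t (- i) = - st (?h s) t i" for i using st_neg[OF hs0] .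
  have \<sigma>eq: "?\<sigma> i = st (?h s) t (?\<sigma>' i)" for i
  proof -
    have "\<bar>i\<bar> = t \<Longrightarrow> i = t \<or> i = - t" by linarith
    then consider "i = t" | "i = - t" | "\<bar>i\<bar> \<in> ?R'" | "\<bar>i\<bar> \<notin> ?R" unfolding R(1) by blast
    then show ?thesis
    proof cases
      case 1
      then show ?thesis
        using tR' basic(2) R(1) glue_values(1)[OF f s] by (simp add: hat_perm_def st_def)
    next
      case 2
      then show ?thesis
        using tR' basic(2) R(1) glue_values(1)[OF f s] matchingD(2)[OF gm, of t] matchingD(2)[OF em, of s] odd[of t]
        by (simp add: hat_perm_def) (simp add: st_def)
    next
      case 3
      then have iA: "\<bar>i\<bar> \<in> A'" by (simp add: closers_def)
      have iR: "\<bar>i\<bar> \<in> ?R" using 3 R(1) by blast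
      have iD: "\<bar>i\<bar> \<notin> D" using iR R(2) by blast
      have "\<bar>f i\<bar> \<in> A'" using matching_in[OF fm iA] .
      then have "?h (f i) = h (f i)" by (simp add: add_pair_simps)
      then show ?thesis
        using 3 iR glue_values(6)[OF f s iA iD] conj[of "f i"] by (simp add: hat_perm_def)
    next
      case 4
      have "\<bar>i\<bar> \<noteq> \<bar>?h s\<bar>" using 4 hs by metis
      moreover have "\<bar>i\<bar> \<noteq> t" "\<bar>i\<bar> \<notin> ?R'" using 4 unfolding R(1) by blast+
      ultimately have "st (?h s) t i = i" using basic(2) unfolding st_def by auto
      then show ?thesis using 4 \<open>\<bar>i\<bar> \<notin> ?R'\<close> by (simp add: hat_perm_def)
    qed
  qed
  have stst: "st (?h s) t (st (?h s) t i) = i" for i using st_invol[OF hs0] .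
  have p: "?\<sigma> permutes sy ?R" "?\<sigma>' permutes sy ?R'" using \<sigma> \<sigma>' by (auto simp: sperm_def)
  \<comment> \<open>\<open>wt_insert\<close> expects the signed transposition to act first. Passing
    to inverses, which have the same weight, puts it there.\<close>
  have inv: "inv ?\<sigma> = inv ?\<sigma>' \<circ> st (?h s) t"
  proof (rule inv_unique_comp)
    show "?\<sigma> \<circ> (inv ?\<sigma>' \<circ> st (?h s) t) = id"
    proof
      fix i
      have "?\<sigma> ((inv ?\<sigma>' \<circ> st (?h s) t) i) = st (?h s) t (?\<sigma>' (inv ?\<sigma>' (st (?h s) t i)))"
        unfolding comp_apply by (rule \<sigma>eq)
      then show "(?\<sigma> \<circ> (inv ?\<sigma>' \<circ> st (?h s) t)) i = id i"
        unfolding permutes_inverses(1)[OF p(2)] stst by simp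
    qed
    show "(inv ?\<sigma>' \<circ> st (?h s) t) \<circ> ?\<sigma> = id"
    proof
      fix i
      show "(inv ?\<sigma>' \<circ> st (?h s) t \<circ> ?\<sigma>) i = id i"
        unfolding comp_apply id_apply \<sigma>eq[of i] stst by (rule permutes_inverses(2)[OF p(2)])
    qed
  qed
  have hs1: "?h s \<in> sy ?R' \<union> {t, - t}" using hs unfolding syR[symmetric] by (simp add: sy_def)
  have "wt qp qm (sy ?R) ?\<sigma> = wt qp qm (sy ?R) (inv ?\<sigma>)"
    using wt_inv[OF _ p(1)] pos_finite_sy(1)[OF pos_finite_closers[OF pos]] by simp
  also have "\<dots> = stw qp qm (?h s) t * wt qp qm (sy ?R') (inv ?\<sigma>')"
    unfolding inv syR
    by (rule wt_insert[OF V hs0(2) _ sperm_inv[OF \<sigma>'] hs1]) (use tR' basic(2) in \<open>simp add: sy_def\<close>)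
  also have "wt qp qm (sy ?R') (inv ?\<sigma>') = wt qp qm (sy ?R') ?\<sigma>'"
    by (rule wt_inv[OF V(1) p(2)])
  also have "stw qp qm (?h s) t = stw qp qm s d"
  proof -
    \<comment> \<open>The extended hat matches \<open>d\<close> with \<open>t\<close>, so the three
      cases of \<open>stw\<close> transfer.\<close>
    have "?h s = t \<longleftrightarrow> s = d" using hinj add_pair_simps(1)[of h] by (metis injD)
    moreover have "?h s = - t \<longleftrightarrow> s = - d" using hinj add_pair_simps(3)[of h] by (metis injD)
    ultimately show ?thesis by (simp add: stw_def)
  qed
  finally show ?thesis .
qed

end

section \<open>The sum over matchings\<close>


text \<open>The largest point has no larger partner and therefore closes. The smallest closer
  \<open>t\<close> has its partner below it, so the set \<open>D\<close> of points before
  \<open>t\<close> is nonempty and its last point serves as \<open>d\<close>.\<close>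

lemma peak_exists:
  assumes p: "pos_finite A" and f: "matching A f" and ne: "A \<noteq> {}"
  shows "\<exists>D d t. peak A D d t \<and> f \<in> openers A D \<and> t \<in> closers A f"
proof -
  have fin: "finite A" using p by (simp add: pos_finite_def)
  have "Max A \<in> A" using fin ne by simp
  moreover have "\<bar>f (Max A)\<bar> \<le> Max A" using matching_in_pos[OF f p \<open>Max A \<in> A\<close>] fin by simp
  ultimately have "Max A \<in> closers A f" using matching_cases[OF f p] by auto
  then have R: "closers A f \<noteq> {}" "finite (closers A f)" using fin by (auto simp: closers_def)
  define t where "t = Min (closers A f)"
  define D where "D = {a \<in> A. a < t}"
  have t: "t \<in> closers A f" unfolding t_def using R by simp
  then have tA: "t \<in> A" "\<bar>f t\<bar> < t" by (auto simp: closers_def)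
  then have "\<bar>f t\<bar> \<in> D" using matching_in_pos[OF f p] by (simp add: D_def)
  then have Dne: "D \<noteq> {}" "finite D" using fin by (auto simp: D_def)
  have "peak A D (Max D) t"
  proof
    show "Max D \<in> D" "Max D < t" using Dne Max_in[of D] by (auto simp: D_def)
    show "a \<le> Max D" if "a \<in> D" for a using that Dne by simp
    show "t \<le> a" if "a \<in> A" "a \<notin> D" for a using that by (simp add: D_def)
  qed (use p tA in \<open>auto simp: D_def\<close>)
  moreover have "f \<in> openers A D"
  proof -
    have "a \<notin> closers A f" if "a \<in> D" for a
      using that Min_le[OF R(2), of a] by (auto simp: D_def t_def)
    then show ?thesis using f by (auto simp: openers_def)
  qed
  ultimately show ?thesis using t by blast
qed

text \<open>Peaks are removed one at a time, and \<open>is_hat_glue\<close> adds the adjacent pair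
  to the hat of the smaller matching.\<close>

lemma hat_exists:
  assumes "pos_finite A" "matching A f"
  shows "\<exists>h. is_hat A f h"
  using assms
proof (induction "card A" arbitrary: A f rule: less_induct)
  case less
  show ?case
  proof (cases "A = {}")
    case True
    then have "is_hat A f id" by (auto simp: is_hat_def matching_def closers_def)
    then show ?thesis by blast
  next
    case False
    then obtain D d t where "peak A D d t" and f: "f \<in> openers A D" and t: "t \<in> closers A f"
      using peak_exists[OF less.prems] by blast
    interpret peak A D d t by fact
    have u: "f t \<in> sy D" "unglue f \<in> openers A' D'" "glue (unglue f) (f t) = f"
      by (rule unglue_props[OF f t])+
    have "finite A" using less.prems by (simp add: pos_finite_def)
    then have "card A' < card A" by (rule psubset_card_mono) (use tA in auto)
    then obtain h where "is_hat A' (unglue f) h"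
      using less.hyps[of A' "unglue f"] basic(6) u(2) by (auto simp: openers_def)
    then show ?thesis using is_hat_glue[OF u(2,1)] u(3) by auto
  qed
qed

definition hatf :: "int set \<Rightarrow> (int \<Rightarrow> int) \<Rightarrow> int \<Rightarrow> int" where
  "hatf A f = (THE h. is_hat A f h)"

lemma hatf_eq: "pos_finite A \<Longrightarrow> is_hat A f h \<Longrightarrow> hatf A f = h"
  unfolding hatf_def using hat_unique by (intro the_equality) auto

lemma is_hat_hatf: "pos_finite A \<Longrightarrow> matching A f \<Longrightarrow> is_hat A f (hatf A f)"
  using hat_exists hatf_eq by metis

definition match_wt :: "real \<Rightarrow> real \<Rightarrow> int set \<Rightarrow> (int \<Rightarrow> int) \<Rightarrow> real" where
  "match_wt qp qm A f = wt qp qm (sy (closers A f)) (hat_perm (closers A f) f (hatf A f))"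

text \<open>A pair and its mirror image contribute equal factors, hence one square for each
  closer.\<close>

definition match_term :: "real \<Rightarrow> real \<Rightarrow> int set \<Rightarrow> (int \<Rightarrow> 'a::real_inner) \<Rightarrow> (int \<Rightarrow> int) \<Rightarrow> real" where
  "match_term qp qm A y f = match_wt qp qm A f * (\<Prod>c\<in>closers A f. (y c \<bullet> y \<bar>f c\<bar>)\<^sup>2)"

lemma finite_openers: "pos_finite A \<Longrightarrow> finite (openers A D)"
  using finite_matchings finite_subset[of "openers A D" "{f. matching A f}"] by (auto simp: openers_def)

context peak
begin

text \<open>Besides the new factor for \<open>t\<close>, the only change in the product is that the
  former partner of \<open>s\<close> is now paired with \<open>d\<close>; reading \<open>y d\<close>
  in place of the vector at |s| accounts for it.\<close>

lemma match_term_glue: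
  assumes f: "f \<in> openers A' D'" and s: "s \<in> sy D"
  shows "match_term qp qm A y (glue f s) =
    stw qp qm s d * (y t \<bullet> y \<bar>s\<bar>)\<^sup>2 * match_term qp qm A' (y(\<bar>s\<bar> := y d)) f"
proof -
  let ?y = "y(\<bar>s\<bar> := y d)"
  have fm: "matching A' f" using f by (simp add: openers_def)
  have s0: "\<bar>s\<bar> \<in> D" using s by (simp add: sy_def)
  have h: "is_hat A' f (hatf A' f)" using is_hat_hatf[OF basic(6) fm] .
  have hg: "hatf A (glue f s) = add_pair (hatf A' f) d t" by (rule hatf_eq[OF pos is_hat_glue[OF f s h]])
  have w: "match_wt qp qm A (glue f s) = stw qp qm s d * match_wt qp qm A' f"
    unfolding match_wt_def hg by (rule wt_glue[OF f s h])
  have R: "closers A (glue f s) = insert t (closers A' f)" by (rule closers_glue(1)[OF f s])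
  have fin: "finite (closers A' f)" using pos_finite_closers[OF basic(6)] by (simp add: pos_finite_def)
  have nt: "t \<notin> closers A' f" by (simp add: closers_def)
  have "(\<Prod>c\<in>closers A' f. (y c \<bullet> y \<bar>glue f s c\<bar>)\<^sup>2) = (\<Prod>c\<in>closers A' f. (?y c \<bullet> ?y \<bar>f c\<bar>)\<^sup>2)"
  proof (rule prod.cong[OF refl])
    fix c assume c: "c \<in> closers A' f"
    then have cA: "c \<in> A'" by (simp add: closers_def)
    have cD: "c \<notin> D" using c closers_glue(2)[OF f s] R by blast
    then have "c \<noteq> \<bar>s\<bar>" using s0 by blast
    then show "(y c \<bullet> y \<bar>glue f s c\<bar>)\<^sup>2 = (?y c \<bullet> ?y \<bar>f c\<bar>)\<^sup>2"
      unfolding glue_values(5)[OF f s cA cD] by simp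
  qed
  then show ?thesis
    unfolding match_term_def w R using fin nt glue_values(1)[OF f s] by (simp add: mult_ac)
qed

text \<open>\<open>t\<close> either stays open or is the first closer, and in the second case the
  matching is glued from a smaller one.\<close>

lemma sum_openers_peak:
  "(\<Sum>f\<in>openers A D. match_term qp qm A y f) =
    (\<Sum>f\<in>openers A (insert t D). match_term qp qm A y f) +
    (\<Sum>s\<in>sy D. stw qp qm s d * (y t \<bullet> y \<bar>s\<bar>)\<^sup>2 *
      (\<Sum>f\<in>openers A' D'. match_term qp qm A' (y(\<bar>s\<bar> := y d)) f))"
proof -
  let ?T = "match_term qp qm A y"
  have "openers A D = openers A (insert t D) \<union> {f \<in> openers A D. t \<in> closers A f}"
    by (auto simp: openers_def)
  moreover have "openers A (insert t D) \<inter> {f \<in> openers A D. t \<in> closers A f} = {}"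
    by (auto simp: openers_def)
  ultimately have "sum ?T (openers A D) = sum ?T (openers A (insert t D)) + sum ?T {f \<in> openers A D. t \<in> closers A f}"
    using finite_openers[OF pos, of D] finite_openers[OF pos, of "insert t D"]
    by (metis (no_types, lifting) finite_Un sum.union_disjoint)
  also have "sum ?T {f \<in> openers A D. t \<in> closers A f} = (\<Sum>(f, s)\<in>openers A' D' \<times> sy D. ?T (glue f s))"
    using sum.reindex_bij_betw[OF glue_bij, of ?T] by (simp add: case_prod_unfold)
  also have "\<dots> = (\<Sum>f\<in>openers A' D'. \<Sum>s\<in>sy D. ?T (glue f s))"
    by (simp add: sum.cartesian_product)
  also have "\<dots> = (\<Sum>s\<in>sy D. \<Sum>f\<in>openers A' D'. ?T (glue f s))" by (rule sum.swap)
  also have "\<dots> = (\<Sum>s\<in>sy D. stw qp qm s d * (y t \<bullet> y \<bar>s\<bar>)\<^sup>2 *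
      (\<Sum>f\<in>openers A' D'. match_term qp qm A' (y(\<bar>s\<bar> := y d)) f))"
    unfolding sum_distrib_left by (intro sum.cong refl) (rule match_term_glue)
  finally show ?thesis .
qed

lemma sum_sy_peak:
  fixes g :: "int \<Rightarrow> real"
  shows "(\<Sum>s\<in>sy D. stw qp qm s d * g \<bar>s\<bar>) = (1 + qm) * g d + (\<Sum>i\<in>D'. 2 * qp * g i)"
proof -
  have fin: "finite D" using D pos finite_subset by (auto simp: pos_finite_def)
  have nz: "\<And>i. i \<in> D \<Longrightarrow> 0 < i" by (rule basic(7))
  have sy: "sy D = {d, - d} \<union> (D' \<union> uminus ` D')"
  proof (rule set_eqI)
    fix i
    have "i \<in> uminus ` D' \<longleftrightarrow> - i \<in> D'" by force
    then show "i \<in> sy D \<longleftrightarrow> i \<in> {d, - d} \<union> (D' \<union> uminus ` D')"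
      using nz[of i] nz[of "- i"] d basic(1) by (cases "i > 0") (auto simp: sy_def)
  qed
  let ?g = "\<lambda>s. stw qp qm s d * g \<bar>s\<bar>"
  have g1: "?g i = qp * g i" "?g (- i) = qp * g i" if "i \<in> D'" for i
    using that nz[of i] basic(1) by (auto simp: stw_def)
  have d1: "{d, - d} \<inter> (D' \<union> uminus ` D') = {}" using nz basic(1) by force
  have d2: "D' \<inter> uminus ` D' = {}"
  proof -
    have False if "i \<in> D'" "- i \<in> D'" for i using that nz[of i] nz[of "- i"] by auto
    then show ?thesis by fastforce
  qed
  have "sum ?g (sy D) = sum ?g {d, - d} + sum ?g (D' \<union> uminus ` D')"
    unfolding sy by (rule sum.union_disjoint[OF _ _ d1]) (use fin in auto)
  also have "sum ?g (D' \<union> uminus ` D') = sum ?g D' + sum ?g (uminus ` D')"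
    by (rule sum.union_disjoint[OF _ _ d2]) (use fin in auto)
  also have "sum ?g (uminus ` D') = (\<Sum>i\<in>D'. ?g (- i))"
    by (subst sum.reindex) auto
  also have "sum ?g {d, - d} = (1 + qm) * g d"
    using basic(1) by (simp add: stw_def distrib_right)
  also have "sum ?g D' = (\<Sum>i\<in>D'. qp * g i)" using g1(1) by (rule sum.cong[OF refl])
  also have "(\<Sum>i\<in>D'. ?g (- i)) = (\<Sum>i\<in>D'. qp * g i)" using g1(2) by (rule sum.cong[OF refl])
  finally show ?thesis by (simp add: sum.distrib[symmetric] mult.assoc)
qed

end

text \<open>The branches of \<open>stack_sum\<close> are the parts of
  \<open>sum_openers_peak\<close>: pushing \<open>t\<close> leaves it open, popping closes it. The
  sorting makes the top of the stack the last point before \<open>t\<close>, which is the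
  \<open>d\<close> of the locale.\<close>

lemma match_sum_eq_stack_sum:
  fixes y :: "int \<Rightarrow> 'a::real_inner"
  assumes "pos_finite (set U \<union> set D)" "sorted_wrt (<) (rev D @ U)"
  shows "(\<Sum>f\<in>openers (set U \<union> set D) (set D). match_term qp qm (set U \<union> set D) y f) = stack_sum qp qm U D y"
  using assms
proof (induction U arbitrary: D y)
  case Nil
  show ?case
  proof (cases "D = []")
    case True
    have "openers {} {} = {id}" by (auto simp: openers_def matching_def closers_def)
    moreover have "match_term qp qm {} y id = 1"
      by (simp add: match_term_def match_wt_def closers_def sy_def wt_empty)
    ultimately show ?thesis using True by (simp add: id_def)
  next
    case False
    \<comment> \<open>All points would have to stay open, but a matching of a nonempty set has a
      closer.\<close>
    have "openers (set D) (set D) = {}"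
    proof (rule ccontr)
      assume "openers (set D) (set D) \<noteq> {}"
      then obtain f where f: "f \<in> openers (set D) (set D)" by blast
      then have "matching (set D) f" by (simp add: openers_def)
      then obtain D' d t where "t \<in> closers (set D) f"
        using peak_exists[of "set D" f] Nil.prems False by auto
      then show False using f by (auto simp: openers_def closers_def)
    qed
    then show ?thesis using False by simp
  qed
next
  case (Cons t U)
  let ?A = "set (t # U) \<union> set D"
  have eqA: "set U \<union> set (t # D) = ?A" by auto
  have push: "(\<Sum>f\<in>openers ?A (insert t (set D)). match_term qp qm ?A y f) = stack_sum qp qm U (t # D) y"
    using Cons.IH[of "t # D" y] Cons.prems unfolding eqA by simp
  show ?case
  proof (cases D)
    case Nil
    \<comment> \<open>With an empty stack \<open>t\<close> is the smallest point; it has no smaller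
      partner and cannot close.\<close>
    have "openers ?A {} = openers ?A {t}"
    proof -
      have "t \<notin> closers ?A f" if m: "matching ?A f" for f
      proof
        assume "t \<in> closers ?A f"
        then have "\<bar>f t\<bar> < t" "\<bar>f t\<bar> \<in> ?A"
          using matching_in_pos[OF m Cons.prems(1), of t] by (auto simp: closers_def)
        then show False using Cons.prems(2) Nil by auto
      qed
      then show ?thesis by (auto simp: openers_def)
    qed
    then show ?thesis using push Nil by simp
  next
    case (Cons d D')
    note Dc = this
    have srt: "sorted_wrt (<) (rev D' @ [d] @ t # U)" using Cons.prems(2) Dc by simp
    have lt: "\<And>a. a \<in> set D' \<Longrightarrow> a < d" "d < t" "\<And>a. a \<in> set D' \<Longrightarrow> a < t" "\<And>u. u \<in> set U \<Longrightarrow> t < u"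
      "\<And>u. u \<in> set U \<Longrightarrow> d < u" "\<And>a u. a \<in> set D' \<Longrightarrow> u \<in> set U \<Longrightarrow> a < u"
      using srt by (auto simp: sorted_wrt_append)
    interpret peak ?A "set D" d t
    proof
      show "t \<le> a" if "a \<in> ?A" "a \<notin> set D" for a using that lt(4) by fastforce
      show "a \<le> d" if "a \<in> set D" for a using that lt(1) Dc by fastforce
    qed (use Cons.prems Dc lt in auto)
    have A'eq: "?A - {d, t} = set U \<union> set D'" and D'eq: "set D - {d} = set D'"
    proof -
      have "d \<notin> set D'" "t \<notin> set D'" "t \<notin> set U" "d \<notin> set U" using lt by fastforce+
      then show "?A - {d, t} = set U \<union> set D'" "set D - {d} = set D'" using Dc by auto
    qed
    have pop: "(\<Sum>f\<in>openers (?A - {d, t}) (set D - {d}). match_term qp qm (?A - {d, t}) y' f) = stack_sum qp qm U D' y'" for y' :: "int \<Rightarrow> 'a"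
    proof -
      have "sorted_wrt (<) (rev D' @ U)" using srt by (auto simp: sorted_wrt_append)
      then show ?thesis using Cons.IH[of D' y'] basic(6) unfolding A'eq D'eq by blast
    qed
    have "(\<Sum>f\<in>openers ?A (set D). match_term qp qm ?A y f) = stack_sum qp qm U (t # D) y +
       (\<Sum>s\<in>sy (set D). stw qp qm s d * (\<lambda>i. (y t \<bullet> y i)\<^sup>2 * stack_sum qp qm U D' (y(i := y d))) \<bar>s\<bar>)"
      unfolding sum_openers_peak push pop by (simp add: mult.assoc)
    also have "\<dots> = stack_sum qp qm U (t # D) y + ((1 + qm) * ((y t \<bullet> y d)\<^sup>2 * stack_sum qp qm U D' (y(d := y d))) +
        (\<Sum>i\<in>set D'. 2 * qp * ((y t \<bullet> y i)\<^sup>2 * stack_sum qp qm U D' (y(i := y d)))))"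
      using sum_sy_peak[where g = "\<lambda>i. (y t \<bullet> y i)\<^sup>2 * stack_sum qp qm U D' (y(i := y d))" and qp = qp and qm = qm]
      unfolding D'eq by (simp only:)
    finally show ?thesis unfolding Dc by (simp add: mult.assoc)
  qed
qed

section \<open>Symmetric pair partitions\<close>


definition pairing :: "nat \<Rightarrow> (int \<Rightarrow> int) \<Rightarrow> int set set" where
  "pairing N f = (\<lambda>i. {i, f i}) ` pm N"

abbreviation points :: "nat \<Rightarrow> int set" where
  "points N \<equiv> {1..int N}"

lemma pos_finite_points: "pos_finite (points N)"
  by (simp add: pos_finite_def)

lemma pm_eq_sy: "pm N = sy (points N)"
  by (auto simp: pm_def sy_def)

lemma pm_iff: "i \<in> pm N \<longleftrightarrow> \<bar>i\<bar> \<in> points N"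
  by (simp add: pm_eq_sy sy_def)

lemma neg_pm: "- i \<in> pm N \<longleftrightarrow> i \<in> pm N"
  by (simp add: pm_iff)

lemma matching_pm: "matching (points N) f \<Longrightarrow> i \<in> pm N \<Longrightarrow> f i \<in> pm N"
  using matching_in[of "points N" f i] by (simp add: pm_iff)

lemma matching_neq:
  assumes "matching (points N) f" "i \<in> pm N"
  shows "f i \<noteq> i" "f i \<noteq> - i"
  using matchingD(3)[OF assms(1), of i] assms(2) by (auto simp: pm_iff)

lemma pairing_block:
  assumes "matching (points N) f" "B \<in> pairing N f" "i \<in> B"
  shows "B = {i, f i}" "i \<in> pm N"
  using assms matchingD(1)[OF assms(1)] matching_pm[OF assms(1)] by (auto simp: pairing_def)

lemma pairing_P2_sym:
  assumes f: "matching (points N) f"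
  shows "pairing N f \<in> P2_sym N" "Pair (pairing N f) = pairing N f"
proof -
  have c2: "card B = 2" if "B \<in> pairing N f" for B
    using that matching_neq(1)[OF f] by (fastforce simp: pairing_def card_2_iff)
  then show P: "Pair (pairing N f) = pairing N f" by (auto simp: Pair_def)
  have p: "partition_on (pm N) (pairing N f)"
  proof (rule partition_onI)
    show "\<Union> (pairing N f) = pm N" using matching_pm[OF f] by (auto simp: pairing_def)
    show "{} \<notin> pairing N f" by (auto simp: pairing_def)
    show "disjnt B C" if "B \<in> pairing N f" "C \<in> pairing N f" "B \<noteq> C" for B C
      using that pairing_block(1)[OF f] unfolding disjnt_def by blast
  qed
  have bar_b: "bar {i, f i} = {- i, f (- i)}" for i
    using matchingD(2)[OF f] by (auto simp: bar_def)
  have "bar ` pairing N f = pairing N f"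
  proof -
    have "bar ` pairing N f = (\<lambda>i. {i, f i}) ` uminus ` pm N"
      unfolding pairing_def image_image bar_b ..
    also have "uminus ` pm N = pm N" using pm_props(3)[of N] unfolding bar_def .
    finally show ?thesis by (simp add: pairing_def)
  qed
  moreover have "bar B \<noteq> B" if "B \<in> pairing N f" for B
  proof
    assume eq: "bar B = B"
    obtain i where i: "i \<in> pm N" "B = {i, f i}" using \<open>B \<in> pairing N f\<close> by (auto simp: pairing_def)
    have "- i \<in> B" using eq i by (metis in_bar_iff insertI1 minus_minus)
    moreover have "i \<noteq> 0" using i pm_props(2) by metis
    ultimately show False using i matching_neq[OF f i(1)] by auto
  qed
  ultimately show "pairing N f \<in> P2_sym N"
    using p c2 P by (auto simp: P2_sym_def P12_sym_def)
qed

lemma pairing_inj: "inj_on (pairing N) {f. matching (points N) f}"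
proof (rule inj_onI, clarsimp)
  fix f g assume f: "matching (points N) f" and g: "matching (points N) g" and eq: "pairing N f = pairing N g"
  show "f = g"
  proof
    fix i show "f i = g i"
    proof (cases "i \<in> pm N")
      case True
      then have "{i, f i} \<in> pairing N g" unfolding eq[symmetric] by (auto simp: pairing_def)
      then have "{i, f i} = {i, g i}" using pairing_block(1)[OF g] by blast
      then show ?thesis using matching_neq(1)[OF f True] by (auto simp: doubleton_eq_iff)
    next
      case False
      then show ?thesis using matchingD(4)[OF f, of i] matchingD(4)[OF g, of i] by (simp add: pm_iff)
    qed
  qed
qed

lemma pairing_surj:
  assumes \<pi>: "\<pi> \<in> P2_sym N"
  shows "\<exists>f. matching (points N) f \<and> \<pi> = pairing N f"
proof -
  have p: "partition_on (pm N) \<pi>" and c2: "\<And>B. B \<in> \<pi> \<Longrightarrow> card B = 2"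
    and bar: "\<And>B. B \<in> \<pi> \<Longrightarrow> bar B \<in> \<pi>" and nb: "\<And>B. B \<in> \<pi> \<Longrightarrow> bar B \<noteq> B"
    using \<pi> by (auto simp: P2_sym_def P12_sym_def Pair_def)
  have ex: "\<exists>j. j \<noteq> i \<and> {i, j} \<in> \<pi>" if "i \<in> pm N" for i
  proof -
    have "i \<in> \<Union>\<pi>" using that partition_onD1[OF p] by simp
    then obtain B where B: "B \<in> \<pi>" "i \<in> B" by blast
    then obtain a b where "B = {a, b}" "a \<noteq> b" using c2[OF B(1)] by (auto simp: card_2_iff)
    then show ?thesis using B by (metis insert_commute insert_iff singletonD)
  qed
  have un: "j = k" if "{i, j} \<in> \<pi>" "{i, k} \<in> \<pi>" "j \<noteq> i" "k \<noteq> i" for i j k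
    using partition_on_eqI[OF p that(1,2), of i] that(3,4) by (auto simp: doubleton_eq_iff)
  define f where "f i = (if i \<in> pm N then (THE j. j \<noteq> i \<and> {i, j} \<in> \<pi>) else i)" for i
  have f: "f i \<noteq> i" "{i, f i} \<in> \<pi>" if i: "i \<in> pm N" for i
  proof -
    have "\<exists>!j. j \<noteq> i \<and> {i, j} \<in> \<pi>" using ex[OF i] un by blast
    from theI'[OF this] show "f i \<noteq> i" "{i, f i} \<in> \<pi>" using i by (auto simp: f_def)
  qed
  have feq: "f i = j" if "{i, j} \<in> \<pi>" "j \<noteq> i" for i j
  proof -
    have "i \<in> pm N" using that(1) partition_onD1[OF p] by blast
    then show ?thesis using un[OF f(2) that(1) f(1) that(2)] by blast
  qed
  have fpm: "f i \<in> pm N" if "i \<in> pm N" for i using f(2)[OF that] partition_onD1[OF p] by blast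
  have m: "matching (points N) f"
    unfolding matching_def
  proof (intro conjI allI impI)
    fix i
    show "f (f i) = i"
    proof (cases "i \<in> pm N")
      case True
      then show ?thesis using f[OF True] by (intro feq) (auto simp: insert_commute)
    next
      case False
      then show ?thesis by (simp add: f_def)
    qed
    show "f (- i) = - f i"
    proof (cases "i \<in> pm N")
      case True
      have "bar {i, f i} = {- i, - f i}" by (auto simp: bar_def)
      then have "{- i, - f i} \<in> \<pi>" using bar[OF f(2)[OF True]] by simp
      then show ?thesis using f(1)[OF True] by (intro feq) auto
    next
      case False
      then show ?thesis by (simp add: f_def neg_pm)
    qed
    show "\<bar>f i\<bar> \<noteq> \<bar>i\<bar>" if "\<bar>i\<bar> \<in> points N"
    proof
      have i: "i \<in> pm N" using that by (simp add: pm_iff)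
      assume "\<bar>f i\<bar> = \<bar>i\<bar>"
      then have "f i = - i" using f(1)[OF i] by linarith
      then have "bar {i, f i} = {i, f i}" by (auto simp: bar_def)
      then show False using nb[OF f(2)[OF i]] by simp
    qed
    show "f i = i" if "\<bar>i\<bar> \<notin> points N" using that unfolding pm_iff[symmetric] by (simp add: f_def)
  qed
  have "\<pi> = pairing N f"
  proof (intro equalityI subsetI)
    fix B assume B: "B \<in> \<pi>"
    then obtain a b where ab: "B = {a, b}" "a \<noteq> b" using c2 by (meson card_2_iff)
    then have "a \<in> pm N" "f a = b" using B partition_onD1[OF p] feq[of a b] by auto
    then show "B \<in> pairing N f" using ab by (auto simp: pairing_def)
  next
    fix B assume "B \<in> pairing N f"
    then show "B \<in> \<pi>" using f(2) by (auto simp: pairing_def)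
  qed
  then show ?thesis using m by blast
qed

lemma bij_pairing: "bij_betw (pairing N) {f. matching (points N) f} (P2_sym N)"
  unfolding bij_betw_def using pairing_inj pairing_surj pairing_P2_sym(1) by blast

section \<open>Legs, closers and the hat of a pair partition\<close>

lemma doubleton_Min_Max:
  "a < b \<Longrightarrow> Min {a, b} = a \<and> Max {a, b} = (b::int)" "a < b \<Longrightarrow> Min {b, a} = a \<and> Max {b, a} = (b::int)"
  by auto

text \<open>The right leg of a positive pair is positive and exceeds its partner in absolute value,
  which is what makes it a closer.\<close>

lemma pos_right_legs_pairing:
  assumes f: "matching (points N) f"
  shows "pos_right_legs (pairing N f) = closers (points N) f"
proof (intro equalityI subsetI)
  fix c assume "c \<in> pos_right_legs (pairing N f)"
  then obtain B where B: "B \<in> pairing N f" "pos_pair B" "c = Max B"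
    unfolding pos_right_legs_def pairing_P2_sym(2)[OF f] by blast
  then have fin: "finite B" "B \<noteq> {}" by (auto simp: pairing_def)
  then have "c \<in> B" using B(3) by simp
  then have "B = {c, f c}" "c \<in> pm N" using pairing_block[OF f B(1)] by blast+
  moreover from this have "f c < c" using matching_neq(1)[OF f, of c] B(3) fin(1) Max_ge[of B "f c"] by force
  ultimately show "c \<in> closers (points N) f"
    using B(2) doubleton_Min_Max(2)[of "f c" c] by (auto simp: pos_pair_def closers_def pm_iff)
next
  fix c assume c: "c \<in> closers (points N) f"
  then have "f c < c" "- f c < c" "c \<in> pm N" by (auto simp: closers_def pm_iff)
  then have "{c, f c} \<in> pairing N f" "pos_pair {c, f c}" "Max {c, f c} = c"
    using doubleton_Min_Max(2)[of "f c" c] by (auto simp: pairing_def pos_pair_def)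
  then show "c \<in> pos_right_legs (pairing N f)"
    unfolding pos_right_legs_def pairing_P2_sym(2)[OF f] by force
qed

lemma neg_left_legs_pairing:
  assumes f: "matching (points N) f"
  shows "neg_left_legs (pairing N f) = uminus ` closers (points N) f"
proof (intro equalityI subsetI)
  fix c assume "c \<in> neg_left_legs (pairing N f)"
  then obtain B where B: "B \<in> pairing N f" "\<not> pos_pair B" "c = Min B"
    unfolding neg_left_legs_def pairing_P2_sym(2)[OF f] by blast
  then have fin: "finite B" "B \<noteq> {}" by (auto simp: pairing_def)
  then have "c \<in> B" using B(3) by simp
  then have c: "B = {c, f c}" "c \<in> pm N" using pairing_block[OF f B(1)] by blast+
  then have lt: "c < f c" using matching_neq(1)[OF f, of c] B(3) fin(1) Min_le[of B "f c"] by force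
  have "f c \<noteq> - c" using matching_neq(2)[OF f c(2)] .
  then have "\<bar>f c\<bar> < - c" using B(2) lt doubleton_Min_Max(1)[OF lt] c(1) by (auto simp: pos_pair_def)
  then have "- c \<in> closers (points N) f" using c(2) matchingD(2)[OF f, of c] by (auto simp: closers_def pm_iff)
  then show "c \<in> uminus ` closers (points N) f" by force
next
  fix c assume "c \<in> uminus ` closers (points N) f"
  then have c: "- c \<in> closers (points N) f" by auto
  then have lt: "c < f c" "\<not> f c > - c" "c \<in> pm N"
    using matchingD(2)[OF f, of c] by (auto simp: closers_def pm_iff)
  then have "{c, f c} \<in> pairing N f" "\<not> pos_pair {c, f c}" "Min {c, f c} = c"
    using doubleton_Min_Max(1)[OF lt(1)] by (auto simp: pairing_def pos_pair_def)
  then show "c \<in> neg_left_legs (pairing N f)"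
    unfolding neg_left_legs_def pairing_P2_sym(2)[OF f] by force
qed

lemma closers_pm:
  assumes f: "matching (points N) f"
  shows "sy (closers (points N) f) \<subseteq> pm N"
    "i \<in> pm N \<Longrightarrow> f i \<in> sy (closers (points N) f) \<longleftrightarrow> i \<notin> sy (closers (points N) f)"
proof -
  show "sy (closers (points N) f) \<subseteq> pm N" by (auto simp: sy_def closers_def pm_iff)
  show "i \<in> pm N \<Longrightarrow> f i \<in> sy (closers (points N) f) \<longleftrightarrow> i \<notin> sy (closers (points N) f)"
    using closers_flip[OF f pos_finite_points, of i] by (simp add: sy_def pm_iff)
qed

lemma card_sy: "pos_finite R \<Longrightarrow> card (sy R) = 2 * card R"
proof -
  assume R: "pos_finite R"
  have "{i \<in> sy R. i > 0} = R" using R by (auto simp: sy_def pos_finite_def)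
  then show ?thesis using card_bar_closed[OF pos_finite_sy[OF R]] by simp
qed

text \<open>\<open>f\<close> exchanges the signed closers with the remaining points, so they are
  half of all 2N points.\<close>

lemma card_closers:
  assumes f: "matching (points N) f"
  shows "2 * card (closers (points N) f) = N"
proof -
  let ?S = "sy (closers (points N) f)"
  have "bij_betw f ?S (pm N - ?S)"
    by (rule bij_betw_byWitness[where f' = f])
      (use matchingD(1)[OF f] closers_pm[OF f] matching_pm[OF f] in auto)
  then have "card ?S = card (pm N - ?S)" by (rule bij_betw_same_card)
  also have "\<dots> = 2 * N - card ?S"
    using card_Diff_subset[OF finite_subset[OF closers_pm(1)[OF f] pm_props(1)] closers_pm(1)[OF f]] by simp
  finally show ?thesis
    using card_mono[OF pm_props(1) closers_pm(1)[OF f]] card_sy[OF pos_finite_closers[OF pos_finite_points, of N f]] by simp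
qed

text \<open>A crossing with \<open>a > 0\<close> contradicts the nesting in \<open>is_hat\<close>.
  Otherwise, since pairs of the hat do not mix signs, all four points are negative, and their mirror
  images cross on the positive half.\<close>

lemma noncrossing_pairing:
  assumes h: "is_hat (points N) f h"
  shows "noncrossing (pairing N h)"
  unfolding noncrossing_def
proof (intro notI, elim bexE exE conjE)
  fix A B a b c d
  assume AB: "A \<in> pairing N h" "B \<in> pairing N h" "A \<noteq> B" and abcd: "a \<in> A" "b \<in> B" "c \<in> A" "d \<in> B" "a < b" "b < c" "c < d"
  have m: "matching (points N) h" and pos: "\<And>a. a \<in> points N \<Longrightarrow> 0 < h a"
    and nc: "\<And>a b. a \<in> points N \<Longrightarrow> b \<in> points N \<Longrightarrow> a < b \<Longrightarrow> b < h a \<Longrightarrow> h b < h a"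
    using h unfolding is_hat_def by blast+
  have c: "c = h a" and d: "d = h b"
    using pairing_block(1)[OF m AB(1) abcd(1)] pairing_block(1)[OF m AB(2) abcd(2)] abcd by auto
  have in_pm: "a \<in> pm N" "b \<in> pm N" "c \<in> pm N" "d \<in> pm N"
    using pairing_block(2)[OF m] AB abcd by blast+
  show False
  proof (cases "a > 0")
    case True
    then have "a \<in> points N" "b \<in> points N" using in_pm abcd by (auto simp: pm_iff)
    then show False using nc[of a b] c d abcd by simp
  next
    case False
    have negp: "- i \<in> points N" if "i \<in> pm N" "i \<le> 0" for i
      using that unfolding pm_iff by (simp add: abs_of_nonpos)
    have a: "- a \<in> points N" using negp in_pm False by simp
    have neg: "h (- i) = - h i" for i by (rule matchingD(2)[OF m])
    have "c < 0" using pos[OF a] c neg[of a] by simp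
    then have c': "- c \<in> points N" "- b \<in> points N" using negp in_pm abcd by simp_all
    have "d < 0" using pos[OF c'(2)] d neg[of b] by simp
    then have d': "- d \<in> points N" using negp in_pm by simp
    have "h (- d) = - b" "h (- c) = - a" using c d neg matchingD(1)[OF m] by auto
    then show False using nc[OF d' c'(1)] abcd by simp
  qed
qed

text \<open>Nesting is non-crossing restricted to positive points; that pairs do not mix signs comes
  from comparing a pair with its mirror image.\<close>

lemma is_hat_of_noncrossing:
  assumes h: "matching (points N) h" and nc: "noncrossing (pairing N h)" and R: "closers (points N) h = closers (points N) f"
  shows "is_hat (points N) f h"
proof -
  have neg: "h (- i) = - h i" for i by (rule matchingD(2)[OF h])
  have no: False if "i \<in> pm N" "j \<in> pm N" "i < j" "j < h i" "h i < h j" for i j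
  proof -
    have "{i, h i} \<in> pairing N h" "{j, h j} \<in> pairing N h" using that by (auto simp: pairing_def)
    moreover have "{i, h i} \<noteq> {j, h j}" using that by (auto simp: doubleton_eq_iff)
    ultimately have "\<exists>A\<in>pairing N h. \<exists>B\<in>pairing N h. A \<noteq> B \<and>
        (\<exists>a\<in>A. \<exists>b\<in>B. \<exists>c\<in>A. \<exists>d\<in>B. a < b \<and> b < c \<and> c < d)"
      by (intro bexI[where x = "{i, h i}"] bexI[where x = "{j, h j}"]) (use that(3-5) in auto)
    then show False using nc unfolding noncrossing_def by (rule notE[rotated])
  qed
  \<comment> \<open>A closer with \<open>h c < 0\<close> satisfies - c < h c < - h c < c, so its
    pair crosses the mirror image.\<close>
  have cl: "0 < h c" if c: "c \<in> closers (points N) h" for c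
  proof (rule ccontr)
    assume "\<not> 0 < h c"
    have cA: "c \<in> points N" "\<bar>h c\<bar> < c" using c by (auto simp: closers_def)
    then have cpm: "c \<in> pm N" by (auto simp: pm_iff)
    have "h c \<noteq> 0" using matching_pm[OF h cpm] pm_props(2) by metis
    then have "h c < 0" using \<open>\<not> 0 < h c\<close> by simp
    then show False
      using no[of "- c" "h c"] cA cpm neg[of c] matching_pm[OF h cpm] matchingD(1)[OF h, of c] neg_pm by auto
  qed
  have pos: "0 < h a" if a: "a \<in> points N" for a
  proof (cases "a \<in> closers (points N) h")
    case True then show ?thesis by (rule cl)
  next
    case False
    have "\<bar>a\<bar> = a" using a by simp
    then have "\<bar>h a\<bar> \<in> closers (points N) h"
      using closers_flip[OF h pos_finite_points, of a] False a by simp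
    from cl[OF this] have "0 < h \<bar>h a\<bar>" .
    moreover have "h a \<noteq> 0" using matching_in[OF h, of a] a by auto
    ultimately show ?thesis
      using neg[of "h a"] matchingD(1)[OF h, of a] a by (auto simp: abs_if split: if_splits)
  qed
  have "h b < h a" if ab: "a \<in> points N" "b \<in> points N" "a < b" "b < h a" for a b
  proof (rule ccontr)
    assume "\<not> h b < h a"
    moreover have "h b \<noteq> h a" using ab matchingD(1)[OF h] by (metis less_irrefl)
    ultimately show False using no[of a b] ab by (auto simp: pm_iff)
  qed
  then show ?thesis unfolding is_hat_def using h R pos by blast
qed

text \<open>Positive pairs are counted by their right legs and negative ones by their left legs.
  With the prescribed legs there are N pairs, which cover all 2N points and leave no
  singleton.\<close>

lemma P12_sym_full:
  assumes \<pi>: "\<pi> \<in> P12_sym N" and f: "matching (points N) f"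
    and r: "pos_right_legs \<pi> = closers (points N) f" and l: "neg_left_legs \<pi> = uminus ` closers (points N) f"
  shows "\<pi> \<in> P2_sym N"
proof -
  let ?R = "closers (points N) f"
  have p: "partition_on (pm N) \<pi>" using \<pi> by (simp add: P12_sym_def)
  have fin: "finite \<pi>" using finite_elements[OF pm_props(1) p] .
  have finR: "finite ?R" using pos_finite_closers[OF pos_finite_points, of N f] by (simp add: pos_finite_def)
  have cP: "card B = 2" "finite B" "B \<noteq> {}" if "B \<in> Pair \<pi>" for B
    using that by (auto simp: Pair_def intro: card_ge_0_finite)
  let ?P = "{B \<in> Pair \<pi>. pos_pair B}" and ?N = "{B \<in> Pair \<pi>. \<not> pos_pair B}"
  have finP: "finite (Pair \<pi>)" using fin by (simp add: Pair_def)
  have "inj_on Max ?P"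
  proof (rule inj_onI)
    fix B C assume a: "B \<in> ?P" "C \<in> ?P" "Max B = Max C"
    then have "Max B \<in> B" "Max B \<in> C" using cP Max_in by (metis mem_Collect_eq)+
    then show "B = C" using partition_on_eqI[OF p] a by (auto simp: Pair_def)
  qed
  moreover have "Max ` ?P = ?R" unfolding r[symmetric] pos_right_legs_def by auto
  ultimately have c1: "card ?P = card ?R" using card_image by metis
  have "inj_on Min ?N"
  proof (rule inj_onI)
    fix B C assume a: "B \<in> ?N" "C \<in> ?N" "Min B = Min C"
    then have "Min B \<in> B" "Min B \<in> C" using cP Min_in by (metis mem_Collect_eq)+
    then show "B = C" using partition_on_eqI[OF p] a by (auto simp: Pair_def)
  qed
  moreover have "Min ` ?N = uminus ` ?R" unfolding l[symmetric] neg_left_legs_def by auto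
  ultimately have c2: "card ?N = card ?R" using card_image[of uminus ?R] card_image[of Min ?N] by auto
  have "card (?P \<union> ?N) = card ?P + card ?N"
    by (rule card_Un_disjoint) (use finP in auto)
  moreover have "?P \<union> ?N = Pair \<pi>" by blast
  ultimately have cN: "card (Pair \<pi>) = N" using c1 c2 card_closers[OF f] by simp
  have "pairwise disjnt (Pair \<pi>)"
    using partition_onD2[OF p] by (rule pairwise_subset) (auto simp: Pair_def)
  then have "card (\<Union> (Pair \<pi>)) = (\<Sum>B\<in>Pair \<pi>. card B)"
    by (rule card_Union_disjoint) (rule cP(2))
  also have "\<dots> = (\<Sum>B\<in>Pair \<pi>. 2)" by (rule sum.cong) (auto simp: cP)
  finally have "card (\<Union> (Pair \<pi>)) = card (pm N)" using cN by simp
  moreover have "\<Union> (Pair \<pi>) \<subseteq> pm N" using partition_onD1[OF p] by (auto simp: Pair_def)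
  ultimately have full: "\<Union> (Pair \<pi>) = pm N" using card_subset_eq[OF pm_props(1)] by blast
  have "card B \<noteq> 1" if B: "B \<in> \<pi>" for B
  proof
    assume c: "card B = 1"
    then obtain s where s: "B = {s}" by (auto simp: card_1_singleton_iff)
    then have "s \<in> pm N" using B partition_onD1[OF p] by blast
    then obtain C where C: "C \<in> Pair \<pi>" "s \<in> C" using full by blast
    then have "B = C" using partition_on_eqI[OF p B, of C s] s by (auto simp: Pair_def)
    then show False using c cP(1)[OF C(1)] by simp
  qed
  then show ?thesis using \<pi> by (simp add: P2_sym_def)
qed

lemma hat_pairing:
  assumes f: "matching (points N) f" and h: "is_hat (points N) f h"
  shows "hat N (pairing N f) = pairing N h"
  unfolding hat_def
proof (rule the_equality)
  have m: "matching (points N) h" and R: "closers (points N) h = closers (points N) f"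
    using h unfolding is_hat_def by blast+
  have "pairing N h \<in> P2_sym N" by (rule pairing_P2_sym(1)[OF m])
  moreover from this have "\<not> covers_singleton (pairing N h)"
    unfolding covers_singleton_def P2_sym_def by (auto simp: card_1_singleton_iff)
  ultimately show "pairing N h \<in> P12_sym N \<and> noncrossing (pairing N h) \<and>
      pos_right_legs (pairing N h) = pos_right_legs (pairing N f) \<and> neg_left_legs (pairing N h) = neg_left_legs (pairing N f) \<and>
      \<not> covers_singleton (pairing N h)"
    using noncrossing_pairing[OF h] pos_right_legs_pairing[OF m] pos_right_legs_pairing[OF f]
      neg_left_legs_pairing[OF m] neg_left_legs_pairing[OF f] R by (simp add: P2_sym_def)
next
  fix \<pi> assume \<pi>: "\<pi> \<in> P12_sym N \<and> noncrossing \<pi> \<and>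
      pos_right_legs \<pi> = pos_right_legs (pairing N f) \<and> neg_left_legs \<pi> = neg_left_legs (pairing N f) \<and>
      \<not> covers_singleton \<pi>"
  then have "\<pi> \<in> P2_sym N"
    using P12_sym_full[OF _ f] pos_right_legs_pairing[OF f] neg_left_legs_pairing[OF f] by metis
  then obtain g where g: "matching (points N) g" "\<pi> = pairing N g" using pairing_surj by blast
  have "closers (points N) g = closers (points N) f"
    using \<pi> unfolding g(2) pos_right_legs_pairing[OF g(1)] pos_right_legs_pairing[OF f] by blast
  then have "is_hat (points N) f g" using is_hat_of_noncrossing[OF g(1)] \<pi> g(2) by blast
  then show "\<pi> = pairing N h" using hat_unique[OF pos_finite_points _ h] g(2) by blast
qed

text \<open>Each pair has exactly one signed closer, so restricting the components of the graph to
  the signed closers loses no cycle and gives the orbits of \<open>hat_perm\<close>.\<close>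

lemma pair_cycles:
  assumes f: "matching (points N) f" and h: "is_hat (points N) f h"
  defines "R \<equiv> closers (points N) f"
  defines "E \<equiv> pair_graph N (pairing N f)"
  shows "Cyc N (pairing N f) = (\<lambda>S. S \<union> bar S) ` comps (pm N) E"
    "c_total N (pairing N f) = ctot (orbs (sy R) (hat_perm R f h))"
    "c_minus N (pairing N f) = cneg (orbs (sy R) (hat_perm R f h))"
    "l_c N (pairing N f) = card R - c_total N (pairing N f)"
proof -
  have m: "matching (points N) h" and R': "closers (points N) h = R"
    using h unfolding is_hat_def R_def by blast+
  have E: "E = {(i, j). i \<in> pm N \<and> (j = i \<or> j = f i \<or> j = h i)}"
  proof -
    have "E = {(i, j). \<exists>B\<in>pairing N f \<union> pairing N h. i \<in> B \<and> j \<in> B}"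
      unfolding E_def pair_graph_def hat_pairing[OF f h] pairing_P2_sym(2)[OF f] pairing_P2_sym(2)[OF m] ..
    also have "\<dots> = {(i, j). i \<in> pm N \<and> (j = i \<or> j = f i \<or> j = h i)}"
    proof (intro equalityI subsetI)
      fix p assume "p \<in> {(i, j). \<exists>B\<in>pairing N f \<union> pairing N h. i \<in> B \<and> j \<in> B}"
      then obtain i j B where p: "p = (i, j)" "B \<in> pairing N f \<union> pairing N h" "i \<in> B" "j \<in> B" by blast
      then show "p \<in> {(i, j). i \<in> pm N \<and> (j = i \<or> j = f i \<or> j = h i)}"
        using pairing_block[OF f, of B i] pairing_block[OF m, of B i] by auto
    next
      fix p assume "p \<in> {(i, j). i \<in> pm N \<and> (j = i \<or> j = f i \<or> j = h i)}"
      then obtain i j where p: "p = (i, j)" "i \<in> pm N" "j = i \<or> j = f i \<or> j = h i" by blast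
      have B: "{i, f i} \<in> pairing N f \<union> pairing N h" "{i, h i} \<in> pairing N f \<union> pairing N h"
        using p(2) by (auto simp: pairing_def)
      have "j \<in> {i, f i} \<or> j \<in> {i, h i}" using p(3) by blast
      then have "\<exists>B\<in>pairing N f \<union> pairing N h. i \<in> B \<and> j \<in> B"
      proof
        assume "j \<in> {i, f i}"
        then show ?thesis by (intro bexI[OF _ B(1)]) simp
      next
        assume "j \<in> {i, h i}"
        then show ?thesis by (intro bexI[OF _ B(2)]) simp
      qed
      then show "p \<in> {(i, j). \<exists>B\<in>pairing N f \<union> pairing N h. i \<in> B \<and> j \<in> B}" using p(1) by simp
    qed
    finally show ?thesis .
  qed
  have ff: "f (f i) = i" "h (h i) = i" "f (- i) = - f i" "h (- i) = - h i" for i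
    using matchingD(1,2)[OF f] matchingD(1,2)[OF m] by auto
  have pmf: "f i \<in> pm N" "h i \<in> pm N" if "i \<in> pm N" for i
    using that matching_pm[OF f] matching_pm[OF m] by auto
  have Esub: "E \<subseteq> pm N \<times> pm N" unfolding E using pmf by auto
  have "sym E" unfolding E sym_def using pmf ff by auto
  then have symE: "sym (E\<^sup>*)" by (rule sym_rtrancl)
  have Eneg: "(- v, - w) \<in> E" if "(v, w) \<in> E" for v w
    using that unfolding E by (auto simp: ff neg_pm)
  have bp: "bar_partition (pm N) (comps (pm N) E)"
    by (rule bar_partition_comps[OF pm_props Esub symE Eneg])
  let ?S = "comps (pm N) E" and ?Q = "(\<lambda>S. S \<union> bar S) ` comps (pm N) E"
  have bar_in: "\<And>S. S \<in> ?S \<Longrightarrow> bar S \<in> ?S" using bp by (simp add: bar_partition_def)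
  \<comment> \<open>Both matchings are perfect, so every component of the graph is closed.\<close>
  have full: "\<Union> (Pair (pairing N f)) = pm N" "\<Union> (Pair (hat N (pairing N f))) = pm N"
    unfolding hat_pairing[OF f h] pairing_P2_sym(2)[OF f] pairing_P2_sym(2)[OF m] using pmf by (auto simp: pairing_def)
  have "S \<subseteq> pm N" if "S \<in> ?S" for S
    using that bp by (auto simp: bar_partition_def partition_on_def)
  then have cc: "closed_components N (pairing N f) = ?S"
    unfolding closed_components_def full E_def[symmetric] by (auto simp: comps_def)
  have negc: "neg_cycles N (pairing N f) = {S \<in> ?S. bar S = S}" unfolding neg_cycles_def cc ..
  show Cyc: "Cyc N (pairing N f) = ?Q"
  proof -
    have "{S \<in> ?S. bar S \<inter> S = {}} = {S \<in> ?S. bar S \<noteq> S}"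
      by (rule Collect_cong) (use bar_partition_Int_bar[OF bp] in blast)
    moreover have "pos_cycles N (pairing N f) = (\<lambda>S. S \<union> bar S) ` {S \<in> ?S. bar S \<inter> S = {}}"
      unfolding pos_cycles_def cc by (rule setcompr_eq_image)
    ultimately have "pos_cycles N (pairing N f) = (\<lambda>S. S \<union> bar S) ` {S \<in> ?S. bar S \<noteq> S}" by simp
    moreover have "neg_cycles N (pairing N f) = (\<lambda>S. S \<union> bar S) ` {S \<in> ?S. bar S = S}"
    proof -
      have "(\<lambda>S. S \<union> bar S) ` {S \<in> ?S. bar S = S} = (\<lambda>S. S) ` {S \<in> ?S. bar S = S}"
        by (rule image_cong) simp_all
      then show ?thesis unfolding negc by simp
    qed
    moreover have "?S = {S \<in> ?S. bar S \<noteq> S} \<union> {S \<in> ?S. bar S = S}" by blast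
    ultimately show ?thesis unfolding Cyc_def by (metis (no_types, lifting) image_Un)
  qed
  have pR: "pos_finite R" unfolding R_def by (rule pos_finite_closers[OF pos_finite_points])
  let ?V = "sy R" and ?\<sigma> = "hat_perm R f h"
  note V = pos_finite_sy[OF pR]
  have \<sigma>: "?\<sigma> \<in> sperm ?V" using hat_perm_sperm[OF pos_finite_points f m] R' unfolding R_def by simp
  then have \<sigma>p: "?\<sigma> permutes ?V" by (simp add: sperm_def)
  have Vpm: "?V \<subseteq> pm N" using closers_pm(1)[OF f] by (simp add: R_def)
  have fV: "f i \<in> ?V \<longleftrightarrow> i \<notin> ?V" "h i \<in> ?V \<longleftrightarrow> i \<notin> ?V" if "i \<in> pm N" for i
    using that closers_pm(2)[OF f] closers_pm(2)[OF m] by (simp_all add: R_def[symmetric] R')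
  have \<sigma>V: "?\<sigma> v = h (f v)" if "v \<in> ?V" for v using that by (simp add: hat_perm_def sy_def)
  \<comment> \<open>An opener is retracted to its hat partner, which is a closer. Edges of the hat
    collapse, and an edge of \<open>f\<close> leaving a closer becomes one step of
    \<open>hat_perm\<close>.\<close>
  let ?E' = "graph_on ?V ?\<sigma>" and ?r = "\<lambda>v. if v \<in> ?V then v else h v"
  have symE': "sym (?E'\<^sup>*)" by (rule sym_graph_on[OF V(1) \<sigma>p])
  have e': "(v, h (f v)) \<in> ?E'\<^sup>*" if "v \<in> ?V" for v
    using that \<sigma>V[OF that] by (auto simp: graph_on_def image_iff)
  have a1: "?E' \<subseteq> E\<^sup>*"
  proof
    fix p assume "p \<in> ?E'"
    then obtain v where v: "v \<in> ?V" "p = (v, ?\<sigma> v)" by (auto simp: graph_on_def)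
    have "v \<in> pm N" using v Vpm by blast
    then have "(v, f v) \<in> E" "(f v, h (f v)) \<in> E" using pmf by (auto simp: E)
    then have "(v, h (f v)) \<in> E\<^sup>*" by (meson r_into_rtrancl rtrancl_into_rtrancl)
    then show "p \<in> E\<^sup>*" using v \<sigma>V by simp
  qed
  have a2: "?E' \<subseteq> ?V \<times> ?V" using \<sigma>p by (auto simp: graph_on_def permutes_in_image)
  have a3: "?r v \<in> ?V \<and> (v, ?r v) \<in> E\<^sup>*" if v: "v \<in> pm N" for v
  proof -
    have "(v, h v) \<in> E" using v by (auto simp: E)
    then show ?thesis using fV(2)[OF v] by auto
  qed
  have a4: "?r v = v" if "v \<in> ?V" for v using that by simp
  have a5: "(?r v, ?r w) \<in> ?E'\<^sup>*" if vw: "(v, w) \<in> E" for v w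
  proof -
    have v: "v \<in> pm N" and w: "w = v \<or> w = f v \<or> w = h v" using vw by (auto simp: E)
    from w consider "w = v" | "w = h v" | "w = f v" "v \<in> ?V" | "w = f v" "v \<notin> ?V" by blast
    then show ?thesis
    proof cases
      case 2 then show ?thesis using fV(2)[OF v] ff by auto
    next
      case 3 then show ?thesis using fV(1)[OF v] e'[of v] by auto
    next
      case 4
      then have "f v \<in> ?V" using fV(1)[OF v] by blast
      from e'[OF this] have "(h v, f v) \<in> ?E'\<^sup>*" using symD[OF symE'] ff by auto
      then show ?thesis using 4 \<open>f v \<in> ?V\<close> by simp
    qed simp
  qed
  have tr: "orbs ?V ?\<sigma> = (\<lambda>S. S \<inter> ?V) ` ?S"
    unfolding orbs_eq_comps[OF V(1) \<sigma>p] by (rule comps_retract(1)[OF Vpm a1 a2 symE a3 a4 a5])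
  have ne: "S \<inter> ?V \<noteq> {}" if "S \<in> ?S" for S
    by (rule comps_retract(2)[OF Vpm a1 a2 symE a3 a4 a5 that])
  note counts = bar_partition_trace[OF bp V(3) ne, folded tr]
  show ct: "c_total N (pairing N f) = ctot (orbs ?V ?\<sigma>)"
    using counts(1) by (simp only: c_total_def Cyc ctot_def)
  show "c_minus N (pairing N f) = cneg (orbs ?V ?\<sigma>)"
    using counts(2) by (simp only: c_minus_def negc cneg_def)
  \<comment> \<open>The pairs inside \<open>C\<close> are indexed by their signed closers, that is
    by the points of \<open>C\<close> in \<open>sy R\<close>.\<close>
  have len: "cyc_length (pairing N f) C = card (C \<inter> ?V) div 2" if C: "C \<in> ?Q" for C
  proof -
    obtain S v where S: "C = S \<union> bar S" "S = E\<^sup>* `` {v}" "v \<in> pm N" using C by (auto simp: comps_def)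
    have Spm: "S \<subseteq> pm N" using rtrancl_closed_set[OF Esub] S by auto
    have fS: "f i \<in> S" if "i \<in> S" for i
      using that Spm S(2) by (auto simp: E intro: rtrancl_into_rtrancl)
    have fC: "f i \<in> C" if "i \<in> C" for i
      using that fS[of i] fS[of "- i"] ff(3)[of i] unfolding S(1) by auto
    have Cpm: "C \<subseteq> pm N" unfolding S(1) using Spm by (auto simp: neg_pm dest: subsetD)
    have "bij_betw (\<lambda>i. {i, f i}) (C \<inter> ?V) {B \<in> pairing N f. B \<subseteq> C}"
      unfolding bij_betw_def
    proof (intro conjI equalityI subsetI)
      show "inj_on (\<lambda>i. {i, f i}) (C \<inter> ?V)"
        using fV(1) Cpm by (auto simp: inj_on_def doubleton_eq_iff)
    next
      fix B assume "B \<in> (\<lambda>i. {i, f i}) ` (C \<inter> ?V)"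
      then show "B \<in> {B \<in> pairing N f. B \<subseteq> C}" using fC Cpm by (auto simp: pairing_def)
    next
      fix B assume "B \<in> {B \<in> pairing N f. B \<subseteq> C}"
      then obtain i where i: "i \<in> pm N" "B = {i, f i}" "i \<in> C" "f i \<in> C" by (auto simp: pairing_def)
      show "B \<in> (\<lambda>i. {i, f i}) ` (C \<inter> ?V)"
      proof (cases "i \<in> ?V")
        case True then show ?thesis using i by blast
      next
        case False
        then have "f i \<in> C \<inter> ?V" "B = {f i, f (f i)}" using i fV(1)[OF i(1)] ff by auto
        then show ?thesis by blast
      qed
    qed
    from bij_betw_same_card[OF this] show ?thesis
      unfolding cyc_length_def pairing_P2_sym(2)[OF f] by simp
  qed
  have bpV: "bar_partition ?V (orbs ?V ?\<sigma>)" by (rule bar_partition_orbs[OF V \<sigma>])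
  have q: "partition_on (pm N) ?Q" by (rule bar_partition_sym_closure[OF bp])
  have neQ: "C \<inter> ?V \<noteq> {}" if "C \<in> ?Q" for C using that ne by auto
  have inj: "inj_on (\<lambda>C. C \<inter> ?V) ?Q"
  proof (rule inj_onI)
    fix C C' assume a: "C \<in> ?Q" "C' \<in> ?Q" "C \<inter> ?V = C' \<inter> ?V"
    obtain i where "i \<in> C \<inter> ?V" using neQ[OF a(1)] by blast
    then have "i \<in> C" "i \<in> C'" using a(3) by auto
    then show "C = C'" using partition_on_eqI[OF q a(1,2)] by blast
  qed
  have imQ: "(\<lambda>C. C \<inter> ?V) ` ?Q = (\<lambda>S. S \<union> bar S) ` orbs ?V ?\<sigma>"
  proof -
    have "(S \<union> bar S) \<inter> ?V = S \<inter> ?V \<union> bar (S \<inter> ?V)" for S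
      unfolding bar_Int V(3) by blast
    then show ?thesis unfolding tr image_image by simp
  qed
  have "l_c N (pairing N f) = (\<Sum>C\<in>?Q. card (C \<inter> ?V) div 2 - 1)"
    unfolding l_c_def Cyc by (rule sum.cong) (auto simp: len)
  also have "\<dots> = (\<Sum>C\<in>(\<lambda>S. S \<union> bar S) ` orbs ?V ?\<sigma>. card C div 2 - 1)"
    unfolding imQ[symmetric] sum.reindex[OF inj] by simp
  also have "\<dots> = card ?V div 2 - ctot (orbs ?V ?\<sigma>)" by (rule bar_partition_sum_norm(1)[OF bpV])
  finally show "l_c N (pairing N f) = card R - c_total N (pairing N f)" unfolding ct using card_sy[OF pR] by simp
qed

text \<open>Signed closers index the pairs bijectively, and those at \<open>c\<close> and
  \<open>- c\<close> contribute the same real factor.\<close>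

lemma pair_product_pairing:
  fixes x :: "nat \<Rightarrow> 'a::real_inner"
  assumes f: "matching (points N) f"
  shows "pair_product x (pairing N f) = (\<Prod>c\<in>closers (points N) f. (x (nat c) \<bullet> x (nat \<bar>f c\<bar>))\<^sup>2)"
proof -
  let ?R = "closers (points N) f"
  have pR: "pos_finite ?R" by (rule pos_finite_closers[OF pos_finite_points])
  note V = pos_finite_sy[OF pR]
  have sub: "sy ?R \<subseteq> pm N" and fV: "\<And>i. i \<in> pm N \<Longrightarrow> f i \<in> sy ?R \<longleftrightarrow> i \<notin> sy ?R"
    using closers_pm[OF f] by blast+
  have bij: "bij_betw (\<lambda>i. {i, f i}) (sy ?R) (pairing N f)"
    unfolding bij_betw_def
  proof (intro conjI equalityI subsetI)
    show "inj_on (\<lambda>i. {i, f i}) (sy ?R)"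
      using fV sub by (auto simp: inj_on_def doubleton_eq_iff)
  next
    fix B assume "B \<in> (\<lambda>i. {i, f i}) ` sy ?R"
    then show "B \<in> pairing N f" using sub by (auto simp: pairing_def)
  next
    fix B assume "B \<in> pairing N f"
    then obtain i where i: "i \<in> pm N" "B = {i, f i}" by (auto simp: pairing_def)
    show "B \<in> (\<lambda>i. {i, f i}) ` sy ?R"
    proof (cases "i \<in> sy ?R")
      case True then show ?thesis using i by blast
    next
      case False
      then have "f i \<in> sy ?R" "B = {f i, f (f i)}" using i fV matchingD(1)[OF f] by auto
      then show ?thesis by blast
    qed
  qed
  let ?p = "\<lambda>v. x (nat \<bar>v\<bar>) \<bullet> x (nat \<bar>f v\<bar>)"
  have mm: "x (nat \<bar>Min {v, f v}\<bar>) \<bullet> x (nat \<bar>Max {v, f v}\<bar>) = ?p v" for v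
    by (cases v "f v" rule: linorder_cases) (auto simp: inner_commute doubleton_Min_Max)
  have "pair_product x (pairing N f) = (\<Prod>v\<in>sy ?R. ?p v)"
    unfolding pair_product_def pairing_P2_sym(2)[OF f]
    using prod.reindex_bij_betw[OF bij, of "\<lambda>B. x (nat \<bar>Min B\<bar>) \<bullet> x (nat \<bar>Max B\<bar>)"] mm by simp
  also have "sy ?R = ?R \<union> uminus ` ?R"
  proof (rule set_eqI)
    fix i
    have "i \<in> uminus ` ?R \<longleftrightarrow> - i \<in> ?R" by force
    moreover have "0 < i" if "i \<in> ?R" for i using pR that by (simp add: pos_finite_def)
    ultimately show "i \<in> sy ?R \<longleftrightarrow> i \<in> ?R \<union> uminus ` ?R" by (cases "i \<ge> 0") (force simp: sy_def)+
  qed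
  also have "(\<Prod>v\<in>?R \<union> uminus ` ?R. ?p v) = (\<Prod>v\<in>?R. ?p v) * (\<Prod>v\<in>uminus ` ?R. ?p v)"
  proof (rule prod.union_disjoint)
    show "finite ?R" "finite (uminus ` ?R)" using pR by (auto simp: pos_finite_def)
    show "?R \<inter> uminus ` ?R = {}" by (auto simp: closers_def)
  qed
  also have "(\<Prod>v\<in>uminus ` ?R. ?p v) = (\<Prod>v\<in>?R. ?p v)"
    by (subst prod.reindex) (auto simp: matchingD(2)[OF f])
  also have "(\<Prod>v\<in>?R. ?p v) * (\<Prod>v\<in>?R. ?p v) = (\<Prod>v\<in>?R. (x (nat v) \<bullet> x (nat \<bar>f v\<bar>))\<^sup>2)"
    unfolding prod.distrib[symmetric] power2_eq_square
    by (rule prod.cong) (auto simp: closers_def)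
  finally show ?thesis .
qed

lemma pairing_summand:
  fixes x :: "nat \<Rightarrow> 'a::real_inner"
  assumes f: "matching (points (2 * n)) f"
  shows "qm ^ c_minus (2 * n) (pairing (2 * n) f) * qp ^ (n - c_total (2 * n) (pairing (2 * n) f)) *
      pair_product x (pairing (2 * n) f) = match_term qp qm (points (2 * n)) (\<lambda>i. x (nat i)) f"
    and "l_c (2 * n) (pairing (2 * n) f) = n - c_total (2 * n) (pairing (2 * n) f)"
proof -
  let ?R = "closers (points (2 * n)) f" and ?h = "hatf (points (2 * n)) f"
  have h: "is_hat (points (2 * n)) f ?h" by (rule is_hat_hatf[OF pos_finite_points f])
  have cR: "card ?R = n" using card_closers[OF f] by simp
  have pR: "pos_finite ?R" by (rule pos_finite_closers[OF pos_finite_points])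
  note cyc = pair_cycles[OF f h]
  have "match_wt qp qm (points (2 * n)) f =
      qp ^ (n - c_total (2 * n) (pairing (2 * n) f)) * qm ^ c_minus (2 * n) (pairing (2 * n) f)"
    unfolding match_wt_def wt_def cyc(2,3) using card_sy[OF pR] cR by simp
  then show "qm ^ c_minus (2 * n) (pairing (2 * n) f) * qp ^ (n - c_total (2 * n) (pairing (2 * n) f)) *
      pair_product x (pairing (2 * n) f) = match_term qp qm (points (2 * n)) (\<lambda>i. x (nat i)) f"
    unfolding match_term_def pair_product_pairing[OF f] by simp
  show "l_c (2 * n) (pairing (2 * n) f) = n - c_total (2 * n) (pairing (2 * n) f)"
    using cyc(4) cR by simp
qed

theorem theorem4p15:
  fixes x :: "nat \<Rightarrow> 'a::{real_inner, complete_space, second_countable_topology}"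
    and qp qm :: real and n :: nat
  assumes "(\<exists>(M::nat) (N::nat) (\<epsilon>::real). M + N \<noteq> 0 \<and> \<epsilon> \<in> {1, - 1} \<and>
        qp = \<epsilon> / (real M + real N) \<and> qm = (real M - real N) / (real M + real N)) \<or>
     (qp = 0 \<and> - 1 \<le> qm \<and> qm \<le> 1)"
  shows "vacuum_state qp qm (foldr (\<circ>) (map (\<lambda>i. G_op qp qm (x i)) (rev [1..<2 * n + 1])) id) =
           complex_of_real (\<Sum>\<pi>\<in>P2_sym (2 * n).
             qm ^ c_minus (2 * n) \<pi> * qp ^ l_c (2 * n) \<pi> * pair_product x \<pi>) \<and>
         (\<Sum>\<pi>\<in>P2_sym (2 * n).
             qm ^ c_minus (2 * n) \<pi> * qp ^ l_c (2 * n) \<pi> * pair_product x \<pi>) =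
         (\<Sum>\<pi>\<in>P2_sym (2 * n).
             qm ^ c_minus (2 * n) \<pi> * qp ^ (n - c_total (2 * n) \<pi>) * pair_product x \<pi>)"
proof
  let ?U = "map int [1..<2 * n + 1]" and ?y = "\<lambda>i. x (nat i)"
  let ?s = "\<lambda>\<pi>. qm ^ c_minus (2 * n) \<pi> * qp ^ (n - c_total (2 * n) \<pi>) * pair_product x \<pi>"
  have l: "l_c (2 * n) \<pi> = n - c_total (2 * n) \<pi>" if "\<pi> \<in> P2_sym (2 * n)" for \<pi>
    using that pairing_surj pairing_summand(2) by metis
  show eq: "(\<Sum>\<pi>\<in>P2_sym (2 * n). qm ^ c_minus (2 * n) \<pi> * qp ^ l_c (2 * n) \<pi> * pair_product x \<pi>) =
      (\<Sum>\<pi>\<in>P2_sym (2 * n). ?s \<pi>)"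
    by (rule sum.cong) (simp_all add: l)
  have setU: "set ?U = points (2 * n)"
  proof -
    have "set ?U = int ` {1..2 * n}" by (simp add: atLeastLessThanSuc_atLeastAtMost del: upt_Suc)
    then show ?thesis by (simp add: image_int_atLeastAtMost)
  qed
  \<comment> \<open>With an empty stack there is no constraint, so the sum over openers is the sum
    over all matchings.\<close>
  have op: "openers (points (2 * n)) {} = {f. matching (points (2 * n)) f}" by (simp add: openers_def)
  have "vacuum_state qp qm (foldr (\<circ>) (map (\<lambda>i. G_op qp qm (x i)) (rev [1..<2 * n + 1])) id) =
      complex_of_real (stack_sum qp qm ?U [] ?y)"
    by (rule vacuum_state_stack_sum) (use assms in \<open>simp add: admissible_def\<close>)
  also have "stack_sum qp qm ?U [] ?y = (\<Sum>f\<in>openers (set ?U \<union> set []) (set []). match_term qp qm (set ?U \<union> set []) ?y f)"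
  proof (rule match_sum_eq_stack_sum[symmetric])
    show "pos_finite (set ?U \<union> set [])" unfolding setU using pos_finite_points[of "2 * n"] by simp
    show "sorted_wrt (<) (rev [] @ ?U)" by (simp add: sorted_wrt_map del: upt_Suc)
  qed
  also have "\<dots> = (\<Sum>f | matching (points (2 * n)) f. ?s (pairing (2 * n) f))"
    unfolding setU using op by (simp add: pairing_summand(1))
  also have "\<dots> = (\<Sum>\<pi>\<in>P2_sym (2 * n). ?s \<pi>)"
    by (rule sum.reindex_bij_betw[OF bij_pairing])
  finally show "vacuum_state qp qm (foldr (\<circ>) (map (\<lambda>i. G_op qp qm (x i)) (rev [1..<2 * n + 1])) id) =
      complex_of_real (\<Sum>\<pi>\<in>P2_sym (2 * n). qm ^ c_minus (2 * n) \<pi> * qp ^ l_c (2 * n) \<pi> * pair_product x \<pi>)"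
    unfolding eq .
qed

end
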